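(* Let $d \geq 5$ with $d \neq 6$, let $q$ be a prime power and let $e \geq 1$ be an integer with $q^e > 4d^2+1$. Then there exist two (symmetric) generating sets $A$ and $B$ of the group $\mathrm{PSL}_d(\mathbb{F}_{q^e})$ such that the Cayley graphs $\mathrm{Cay}(\mathrm{PSL}_d(\mathbb{F}_{q^e}); A)$ and $\mathrm{Cay}(\mathrm{PSL}_d(\mathbb{F}_{q^e}); B)$ are isospectral and not isomorphic. Moreover, the number of generators $r = |A| = |B|$ can be chosen to be either $r = 2\frac{q^d-1}{q-1}$ or $r = \binom{d}{1}_q + \binom{d}{2}_q + \cdots + \binom{d}{d-1}_q$.
   Context: For a group $G$ and a symmetric generating set $S$, the Cayley graph $\mathrm{Cay}(G;S)$ has vertex set $G$, with $g$ adjacent to $gs$ for every $s \in S$. Two finite graphs on the same number of vertices are isospectral if their adjacency matrices have the same multiset of eigenvalues. $\binom{d}{i}_q$ denotes the number of $i$-dimensional $\mathbb{F}_q$-subspaces of $\mathbb{F}_q^d$. *)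

theory Defs
  imports
    "HOL-Library.Cardinality"
    "HOL-Algebra.Coset"
    "HOL-Algebra.Generated_Groups"
    "HOL-Number_Theory.Prime_Powers"
    "Jordan_Normal_Form.Char_Poly"
    "Jordan_Normal_Form.VS_Connect"
    "Graph_Theory.Digraph_Isomorphism"
begin

section \<open>Projective special linear groups\<close>

definition SL :: "'f::field itself \<Rightarrow> nat \<Rightarrow> 'f mat monoid" where
  "SL _ d = \<lparr>carrier = {M \<in> carrier_mat d d. det M = 1}, monoid.mult = (*), one = 1\<^sub>m d\<rparr>"

definition group_center :: "('a, 'b) monoid_scheme \<Rightarrow> 'a set" where
  "group_center G = {z \<in> carrier G. \<forall>g \<in> carrier G. z \<otimes>\<^bsub>G\<^esub> g = g \<otimes>\<^bsub>G\<^esub> z}"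

definition PSL :: "'f::field itself \<Rightarrow> nat \<Rightarrow> 'f mat set monoid" where
  "PSL F d = SL F d Mod group_center (SL F d)"

lemma group_SL: "group (SL TYPE('f::field) d)"
proof (rule groupI)
  fix M assume "M \<in> carrier (SL TYPE('f) d)"
  then have M: "M \<in> carrier_mat d d" and dM: "det M = 1" by (auto simp: SL_def)
  have adj: "adj_mat M \<in> carrier_mat d d" "adj_mat M * M = 1\<^sub>m d"
    using adj_mat[OF M] dM by auto
  have "det (adj_mat M) * det M = 1" using det_mult[OF adj(1) M] adj(2) by simp
  then have "det (adj_mat M) = 1" using dM by simp
  then show "\<exists>N\<in>carrier (SL TYPE('f) d).
      N \<otimes>\<^bsub>SL TYPE('f) d\<^esub> M = \<one>\<^bsub>SL TYPE('f) d\<^esub>"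
    using adj by (auto simp: SL_def)
qed (auto simp: SL_def det_mult)

lemma normal_group_center:
  fixes G (structure)
  assumes "group G" shows "group_center G \<lhd> G"
proof -
  interpret group G by fact
  have sub: "subgroup (group_center G) G"
  proof
    fix x assume x: "x \<in> group_center G"
    then have xc: "x \<in> carrier G" and xg: "\<And>g. g \<in> carrier G \<Longrightarrow> x \<otimes> g = g \<otimes> x"
      by (auto simp: group_center_def)
    have "inv x \<otimes> g = g \<otimes> inv x" if g: "g \<in> carrier G" for g
      using xg[of "inv g"] xc g by (metis inv_closed inv_inv inv_mult_group)
    then show "inv x \<in> group_center G" using xc by (auto simp: group_center_def)
    fix y assume y: "y \<in> group_center G"
    then have yc: "y \<in> carrier G" and yg: "\<And>g. g \<in> carrier G \<Longrightarrow> y \<otimes> g = g \<otimes> y"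
      by (auto simp: group_center_def)
    have "x \<otimes> y \<otimes> g = g \<otimes> (x \<otimes> y)" if g: "g \<in> carrier G" for g
      using xg yg xc yc g by (metis m_assoc)
    then show "x \<otimes> y \<in> group_center G" using xc yc by (auto simp: group_center_def)
  qed (auto simp: group_center_def)
  show ?thesis
  proof (intro normal_invI sub)
    fix x h assume "x \<in> carrier G" and h: "h \<in> group_center G"
    then have "x \<otimes> h \<otimes> inv x = h"
      by (auto simp: group_center_def) (metis inv_closed inv_solve_right m_closed)
    then show "x \<otimes> h \<otimes> inv x \<in> group_center G" using h by simp
  qed
qed

lemma group_PSL: "group (PSL TYPE('f::field) d)"
  unfolding PSL_def by (intro normal.factorgroup_is_group normal_group_center group_SL)

section \<open>Cayley graphs\<close>

definition symmetric_generating_set :: "('a, 'b) monoid_scheme \<Rightarrow> 'a set \<Rightarrow> bool" where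
  "symmetric_generating_set G S \<longleftrightarrow>
     S \<subseteq> carrier G \<and> (\<forall>s\<in>S. inv\<^bsub>G\<^esub> s \<in> S) \<and> generate G S = carrier G"

text \<open>An undirected graph is represented by the symmetric set of ordered pairs of adjacent vertices.\<close>

definition Cayley_graph :: "('a, 'b) monoid_scheme \<Rightarrow> 'a set \<Rightarrow> 'a pair_pre_digraph" where
  "Cayley_graph G S =
     \<lparr>pverts = carrier G, parcs = {(g, g \<otimes>\<^bsub>G\<^esub> s) | g s. g \<in> carrier G \<and> s \<in> S}\<rparr>"

lemma wf_Cayley_graph:
  assumes "group G" "S \<subseteq> carrier G"
  shows "pair_wf_digraph (Cayley_graph G S)"
proof -
  interpret group G by fact
  show ?thesis using assms(2) by unfold_locales (auto simp: Cayley_graph_def)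
qed

lemma sym_Cayley_graph:
  fixes G (structure)
  assumes "group G" "symmetric_generating_set G S"
  shows "sym (parcs (Cayley_graph G S))"
proof (rule symI)
  interpret group G by fact
  fix x y assume "(x, y) \<in> parcs (Cayley_graph G S)"
  then obtain s where s: "x \<in> carrier G" "s \<in> S" "y = x \<otimes> s" by (auto simp: Cayley_graph_def)
  have "s \<in> carrier G" "inv s \<in> S" using assms(2) s by (auto simp: symmetric_generating_set_def)
  then have "x = y \<otimes> inv s" "y \<in> carrier G" using s by (auto simp: m_assoc)
  then show "(y, x) \<in> parcs (Cayley_graph G S)" using \<open>inv s \<in> S\<close> by (auto simp: Cayley_graph_def)
qed

text \<open>
  \<^const>\<open>digraph_iso\<close> also carries maps of arcs; for graphs without parallel arcs it is the
  existence of a bijection of the vertices that preserves adjacency in both directions.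
\<close>

lemma digraph_iso_with_proj_iff:
  assumes "pair_wf_digraph G" "pair_wf_digraph H"
  shows "digraph_iso (with_proj G) (with_proj H) \<longleftrightarrow>
    (\<exists>f. bij_betw f (pverts G) (pverts H) \<and>
       (\<forall>u\<in>pverts G. \<forall>v\<in>pverts G. (u, v) \<in> parcs G \<longleftrightarrow> (f u, f v) \<in> parcs H))"
    (is "?L \<longleftrightarrow> ?R")
proof
  interpret G: pair_wf_digraph G by fact
  assume ?L
  then obtain h where h: "pre_digraph.digraph_isomorphism (with_proj G) h"
    and H: "with_proj H = app_iso h (with_proj G)"
    by (auto simp: digraph_iso_def)
  let ?f = "iso_verts h"
  have V: "pverts H = ?f ` pverts G" and A: "parcs H = iso_arcs h ` parcs G"
    and t: "iso_tail h = fst" and hd: "iso_head h = snd"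
    using H by (auto simp: with_proj_def app_iso_def)
  have inj: "inj_on ?f (pverts G)"
    and ar: "\<And>a. a \<in> parcs G \<Longrightarrow> iso_arcs h a = (?f (fst a), ?f (snd a))"
    using h t hd by (auto simp: pre_digraph.digraph_isomorphism_def prod_eq_iff)
  have "(u, v) \<in> parcs G \<longleftrightarrow> (?f u, ?f v) \<in> parcs H" if uv: "u \<in> pverts G" "v \<in> pverts G" for u v
  proof
    assume "(u, v) \<in> parcs G"
    then show "(?f u, ?f v) \<in> parcs H" using ar A by force
  next
    assume "(?f u, ?f v) \<in> parcs H"
    then obtain a where a: "a \<in> parcs G" "?f u = ?f (fst a)" "?f v = ?f (snd a)"
      using A ar by auto
    have "fst a \<in> pverts G" "snd a \<in> pverts G" using a(1) G.in_arcsD1[of "fst a" "snd a"]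
      G.in_arcsD2[of "fst a" "snd a"] by auto
    then have "u = fst a" "v = snd a" using a uv inj by (auto dest: inj_onD)
    then show "(u, v) \<in> parcs G" using a by simp
  qed
  then show ?R using inj V by (intro exI[of _ ?f]) (auto simp: bij_betw_def)
next
  interpret G: pair_wf_digraph G by fact
  interpret H: pair_wf_digraph H by fact
  assume ?R
  then obtain f where f: "bij_betw f (pverts G) (pverts H)"
    and e: "\<And>u v. u \<in> pverts G \<Longrightarrow> v \<in> pverts G \<Longrightarrow> (u, v) \<in> parcs G \<longleftrightarrow> (f u, f v) \<in> parcs H"
    by blast
  define h where "h = \<lparr>iso_verts = f, iso_arcs = map_prod f f, iso_head = snd, iso_tail = fst\<rparr>"
  have inj: "inj_on f (pverts G)" and im: "f ` pverts G = pverts H"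
    using f by (auto simp: bij_betw_def)
  have sub: "parcs G \<subseteq> pverts G \<times> pverts G" using G.in_arcsD1 G.in_arcsD2 by auto
  have "inj_on (map_prod f f) (parcs G)"
    using inj map_prod_inj_on inj_on_subset sub by blast
  then have 1: "pre_digraph.digraph_isomorphism (with_proj G) h"
    using inj G.wf_digraph by (auto simp: pre_digraph.digraph_isomorphism_def h_def)
  have "parcs H \<subseteq> map_prod f f ` parcs G"
  proof
    fix a assume a: "a \<in> parcs H"
    obtain x y where xy: "a = (x, y)" by force
    then have "x \<in> f ` pverts G" "y \<in> f ` pverts G" using a im H.in_arcsD1 H.in_arcsD2 by auto
    then show "a \<in> map_prod f f ` parcs G" using a xy e by force
  qed
  moreover have "map_prod f f ` parcs G \<subseteq> parcs H" using sub e by auto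
  ultimately have "with_proj H = app_iso h (with_proj G)"
    using im by (auto simp: with_proj_def app_iso_def h_def)
  then show ?L using 1 by (auto simp: digraph_iso_def)
qed

section \<open>Isospectral graphs\<close>

definition adjacency_mat :: "'v pair_pre_digraph \<Rightarrow> 'v list \<Rightarrow> complex mat" where
  "adjacency_mat G vs =
     mat (length vs) (length vs) (\<lambda>(i, j). of_bool ((vs ! i, vs ! j) \<in> parcs G))"

text \<open>
  The multiset of eigenvalues, with algebraic multiplicities; by \<open>graph_spectrum_eq\<close> below it does
  not depend on the enumeration of the vertices.
\<close>

definition graph_spectrum :: "'v pair_pre_digraph \<Rightarrow> complex multiset" where
  "graph_spectrum G =
     proots (char_poly (adjacency_mat G (SOME vs. distinct vs \<and> set vs = pverts G)))"

definition isospectral :: "'v pair_pre_digraph \<Rightarrow> 'w pair_pre_digraph \<Rightarrow> bool" where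
  "isospectral G H \<longleftrightarrow>
     finite (pverts G) \<and> finite (pverts H) \<and> card (pverts G) = card (pverts H) \<and>
     graph_spectrum G = graph_spectrum H"

lemma char_poly_adjacency_mat_cong:
  assumes vs: "distinct vs" and ws: "distinct ws" and eq: "set vs = set ws"
  shows "char_poly (adjacency_mat G vs) = char_poly (adjacency_mat G ws)"
proof -
  define P :: "'a list \<Rightarrow> 'a list \<Rightarrow> complex mat" where
    "P xs ys = mat (length xs) (length ys) (\<lambda>(i, j). of_bool (xs ! i = ys ! j))" for xs ys
  have sumr: "(\<Sum>j = 0..<length xs. f (xs ! j)) = sum f (set xs)"
    if "distinct xs" for xs :: "'a list" and f :: "'a \<Rightarrow> complex"
    using sum.reindex_bij_betw[OF bij_betw_nth[OF that refl refl], of f]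
    by (simp add: atLeast0LessThan)
  have len: "length vs = length ws" using vs ws eq by (metis distinct_card)
  define n where "n = length vs"
  have inv: "P xs ys * P ys xs = 1\<^sub>m (length xs)"
    if "distinct xs" "distinct ys" "set xs = set ys" for xs ys
  proof (rule eq_matI)
    fix i j assume ij: "i < dim_row (1\<^sub>m (length xs) :: complex mat)"
      "j < dim_col (1\<^sub>m (length xs) :: complex mat)"
    then have "(P xs ys * P ys xs) $$ (i, j) =
        (\<Sum>k = 0..<length ys. of_bool (xs ! i = ys ! k) * of_bool (ys ! k = xs ! j))"
      by (simp add: P_def scalar_prod_def)
    also have "\<dots> = (\<Sum>y\<in>set ys. of_bool (xs ! i = y) * of_bool (y = xs ! j))"
      using sumr[OF that(2), of "\<lambda>y. of_bool (xs ! i = y) * of_bool (y = xs ! j)"] .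
    also have "\<dots> = (\<Sum>y\<in>set ys. if xs ! i = y then of_bool (y = xs ! j) else 0)"
      by (intro sum.cong) auto
    also have "\<dots> = of_bool (xs ! i = xs ! j)"
      using ij that by (subst sum.delta') (auto simp flip: that(3))
    finally show "(P xs ys * P ys xs) $$ (i, j) = 1\<^sub>m (length xs) $$ (i, j)"
      using ij that by (auto simp: nth_eq_iff_index_eq)
  qed (auto simp: P_def)
  have PA: "P vs ws * adjacency_mat G ws =
      mat n n (\<lambda>(i, j). of_bool ((vs ! i, ws ! j) \<in> parcs G))" (is "_ = ?C")
  proof (rule eq_matI)
    fix i j assume ij: "i < dim_row ?C" "j < dim_col ?C"
    then have "(P vs ws * adjacency_mat G ws) $$ (i, j) =
        (\<Sum>k = 0..<length ws. of_bool (vs ! i = ws ! k) * of_bool ((ws ! k, ws ! j) \<in> parcs G))"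
      using len by (simp add: P_def n_def adjacency_mat_def scalar_prod_def)
    also have "\<dots> = (\<Sum>y\<in>set ws. of_bool (vs ! i = y) * of_bool ((y, ws ! j) \<in> parcs G))"
      using sumr[OF ws, of "\<lambda>y. of_bool (vs ! i = y) * of_bool ((y, ws ! j) \<in> parcs G)"] .
    also have "\<dots> = (\<Sum>y\<in>set ws. if vs ! i = y then of_bool ((y, ws ! j) \<in> parcs G) else 0)"
      by (intro sum.cong) auto
    also have "\<dots> = of_bool ((vs ! i, ws ! j) \<in> parcs G)"
      using ij by (subst sum.delta') (auto simp: n_def simp flip: eq)
    finally show "(P vs ws * adjacency_mat G ws) $$ (i, j) = ?C $$ (i, j)" using ij by simp
  qed (auto simp: P_def n_def adjacency_mat_def len)
  have PAQ: "?C * P ws vs = adjacency_mat G vs"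
  proof (rule eq_matI)
    fix i j assume ij: "i < dim_row (adjacency_mat G vs)" "j < dim_col (adjacency_mat G vs)"
    then have "(?C * P ws vs) $$ (i, j) =
        (\<Sum>k = 0..<length ws. of_bool ((vs ! i, ws ! k) \<in> parcs G) * of_bool (ws ! k = vs ! j))"
      using len by (simp add: P_def n_def adjacency_mat_def scalar_prod_def)
    also have "\<dots> = (\<Sum>y\<in>set ws. of_bool ((vs ! i, y) \<in> parcs G) * of_bool (y = vs ! j))"
      using sumr[OF ws, of "\<lambda>y. of_bool ((vs ! i, y) \<in> parcs G) * of_bool (y = vs ! j)"] .
    also have "\<dots> = (\<Sum>y\<in>set ws. if y = vs ! j then of_bool ((vs ! i, y) \<in> parcs G) else 0)"
      by (intro sum.cong) auto
    also have "\<dots> = of_bool ((vs ! i, vs ! j) \<in> parcs G)"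
      using ij by (subst sum.delta) (auto simp: adjacency_mat_def simp flip: eq)
    finally show "(?C * P ws vs) $$ (i, j) = adjacency_mat G vs $$ (i, j)"
      using ij by (simp add: adjacency_mat_def)
  qed (auto simp: P_def n_def adjacency_mat_def)
  have "similar_mat_wit (adjacency_mat G vs) (adjacency_mat G ws) (P vs ws) (P ws vs)"
    unfolding similar_mat_wit_def Let_def
    using inv[OF vs ws eq] inv[OF ws vs eq[symmetric]] PA PAQ len
    by (auto simp: P_def adjacency_mat_def)
  then show ?thesis by (intro char_poly_similar) (auto simp: similar_mat_def)
qed

lemma graph_spectrum_eq:
  assumes "distinct vs" "set vs = pverts G"
  shows "graph_spectrum G = proots (char_poly (adjacency_mat G vs))"
proof -
  have "distinct (SOME vs. distinct vs \<and> set vs = pverts G) \<and>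
      set (SOME vs. distinct vs \<and> set vs = pverts G) = pverts G"
    using someI[of "\<lambda>vs. distinct vs \<and> set vs = pverts G" vs] assms by blast
  then show ?thesis
    unfolding graph_spectrum_def using char_poly_adjacency_mat_cong assms by metis
qed

section \<open>Gaussian binomial coefficients\<close>

text \<open>The number of \<open>i\<close>-dimensional subspaces of the space of \<open>d\<close>-tuples over the field \<open>'k\<close>.\<close>

definition gaussian_binomial :: "'k::field itself \<Rightarrow> nat \<Rightarrow> nat \<Rightarrow> nat" where
  "gaussian_binomial K d i =
     card {W. VectorSpace.subspace class_ring W (module_vec K d) \<and>
              vectorspace.dim (class_ring :: 'k ring) ((module_vec K d)\<lparr>carrier := W\<rparr>) = i}"

end

theory Submission
  imports Defs "HOL-Algebra.Multiplicative_Group"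
begin

text \<open>
  Let \<open>E = \<langle>w, c\<rangle>\<close> be a copy of \<open>S\<^sub>3\<close> in the group \<open>G\<close>, with \<open>w\<^sup>3 = c\<^sup>2 = 1\<close> and \<open>N = \<langle>w\<rangle>\<close>, and let the
  involution \<open>y\<close> and the element \<open>f\<close> of a subgroup \<open>F\<close> commute with each other and with \<open>E\<close>. Put
  \<open>A = P \<union> yN \<union> D\<close> and \<open>B = P \<union> ycN \<union> D\<close>, where \<open>P\<close> consists of \<open>wc\<close> and some powers of \<open>f\<close>, and \<open>D\<close> is
  symmetric and invariant under multiplication by \<open>c\<close> on both sides. On the functions that transform under
  \<open>E\<close> by the sign character, \<open>D\<close> acts as zero, and \<open>yN\<close> and \<open>ycN\<close> act by opposite operators. The change
  of sign is undone by a function \<open>\<chi> : G \<rightarrow> {1, -1}\<close> that is constant on the left cosets of \<open>FE\<close> and satisfies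
  \<open>\<chi> (g y) = - \<chi> g\<close>; on the complement \<open>A\<close> and \<open>B\<close> act in the same way. Hence the Cayley graphs
  of \<open>A\<close> and \<open>B\<close> are isospectral.

  If \<open>D\<close> meets the translates \<open>f\<^sup>i yE\<close> with \<open>f\<^sup>i \<in> P\<close> exactly in the products of \<open>f\<close> and its inverse with \<open>y\<close> and
  the elements of \<open>E - {1, c}\<close>, then the sums of the cubed number of common neighbours over all arcs from a vertex
  differ by \<open>24\<close>, so the two graphs are not isomorphic.

  In \<open>PSL\<^sub>d\<close> the elements \<open>w\<close>, \<open>c\<close> and \<open>y\<close> are signed permutation matrices and \<open>f\<close> is diagonal. The rest of
  \<open>D\<close> is arbitrary up to symmetry: it takes in the few elements that are needed to generate the group by
  transvections, and is then enlarged until \<open>A\<close> and \<open>B\<close> have the prescribed size, for which there is room because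
  both values of \<open>r\<close> are at most \<open>Q\<^bsup>d(d - 1)\<^esup>\<close>, where \<open>Q\<close> is the order of the field, and
  \<open>\<bar>PSL\<^sub>d\<bar> \<ge> 2Q\<^bsup>d(d - 1)\<^esup>\<close>.
\<close>

section \<open>Isospectral Cayley graphs\<close>

text \<open>Two opposing demands shape the sets. Isospectrality tolerates much freedom: a subset of
  \<open>L\<close> acts alike from left and right on the sign functions, and a set invariant under
  \<open>c\<close> on both sides acts on them as zero. Non-isomorphism needs a count that feels the
  exchange of \<open>N\<close> and \<open>cN\<close>. Inserting \<open>c c = 1\<close> between two
  factors shows that products of \<open>yN\<close> with itself and with \<open>D\<close> give the
  same counts as those of \<open>ycN\<close>; only products with \<open>P\<close> can change, and
  for this \<open>P\<close> contains \<open>wc\<close> and powers of \<open>f\<close>, which break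
  the symmetry under \<open>c\<close>. The elements of \<open>D\<close> in the translates of
  \<open>yE\<close> by \<open>f\<close> and its inverse make the change visible. The sum of the
  counts themselves is the number of closed walks of length 3 at a vertex, which the spectrum
  determines; the cube is the first power that separates.

  The exact value of \<open>r\<close> is a second obstacle: \<open>D\<close> grows in classes of up
  to 8 elements, so up to 7 places may stay open, and these are filled by further powers of
  \<open>f\<close>, which are free inside \<open>L\<close>.

  In PSL matrices are known only up to a scalar, so elements are told apart by underlying
  permutations and by ratios of entries.\<close>

definition kernel_mat :: "'v list \<Rightarrow> ('v \<Rightarrow> 'v \<Rightarrow> complex) \<Rightarrow> complex mat" where
  "kernel_mat vs k = mat (length vs) (length vs) (\<lambda>(i, j). k (vs ! i) (vs ! j))"

lemma kernel_mat_carrier [simp]: "kernel_mat vs k \<in> carrier_mat (length vs) (length vs)"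
  by (simp add: kernel_mat_def)

lemma dim_kernel_mat [simp]:
  "dim_row (kernel_mat vs k) = length vs" "dim_col (kernel_mat vs k) = length vs"
  by (simp_all add: kernel_mat_def)

lemma kernel_mat_mult:
  assumes "distinct vs"
  shows "kernel_mat vs k * kernel_mat vs l = kernel_mat vs (\<lambda>x y. \<Sum>z\<in>set vs. k x z * l z y)"
proof (rule eq_matI)
  fix i j
  assume ij: "i < dim_row (kernel_mat vs (\<lambda>x y. \<Sum>z\<in>set vs. k x z * l z y))"
    "j < dim_col (kernel_mat vs (\<lambda>x y. \<Sum>z\<in>set vs. k x z * l z y))"
  have "(kernel_mat vs k * kernel_mat vs l) $$ (i, j) =
      (\<Sum>m = 0..<length vs. k (vs ! i) (vs ! m) * l (vs ! m) (vs ! j))"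
    using ij by (simp add: kernel_mat_def scalar_prod_def)
  also have "\<dots> = (\<Sum>z\<in>set vs. k (vs ! i) z * l z (vs ! j))"
    using sum.reindex_bij_betw[OF bij_betw_nth[OF assms refl refl],
        of "\<lambda>z. k (vs ! i) z * l z (vs ! j)"]
    by (simp add: atLeast0LessThan)
  finally show "(kernel_mat vs k * kernel_mat vs l) $$ (i, j) =
      kernel_mat vs (\<lambda>x y. \<Sum>z\<in>set vs. k x z * l z y) $$ (i, j)"
    using ij by (simp add: kernel_mat_def)
qed (auto simp: kernel_mat_def)

lemma kernel_mat_cong:
  assumes "\<And>x y. x \<in> set vs \<Longrightarrow> y \<in> set vs \<Longrightarrow> k x y = l x y"
  shows "kernel_mat vs k = kernel_mat vs l"
  by (rule eq_matI) (auto simp: kernel_mat_def assms)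

text \<open>The kernel \<open>P\<close> is its own inverse, so the intertwining relation becomes a
  conjugation of adjacency matrices, and similar matrices have equal characteristic polynomials.
  Kernels indexed by vertices keep the enumeration out of the hypotheses.\<close>

lemma isospectral_if_intertwined:
  fixes P :: "'v \<Rightarrow> 'v \<Rightarrow> complex"
  assumes fin: "finite (pverts X)" and V: "pverts Y = pverts X"
    and invol: "\<And>x y. x \<in> pverts X \<Longrightarrow> y \<in> pverts X \<Longrightarrow>
      (\<Sum>z\<in>pverts X. P x z * P z y) = of_bool (x = y)"
    and intertwine: "\<And>x y. x \<in> pverts X \<Longrightarrow> y \<in> pverts X \<Longrightarrow>
      (\<Sum>z\<in>pverts X. P x z * of_bool ((z, y) \<in> parcs X)) =
      (\<Sum>z\<in>pverts X. of_bool ((x, z) \<in> parcs Y) * P z y)"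
  shows "isospectral X Y"
proof -
  obtain vs where vs: "set vs = pverts X" "distinct vs"
    using finite_distinct_list[OF fin] by blast
  let ?n = "length vs"
  let ?P = "kernel_mat vs P"
  have A: "adjacency_mat Z vs = kernel_mat vs (\<lambda>x y. of_bool ((x, y) \<in> parcs Z))"
    for Z :: "'v pair_pre_digraph"
    by (simp add: adjacency_mat_def kernel_mat_def)
  have PP: "?P * ?P = 1\<^sub>m ?n"
  proof -
    have "?P * ?P = kernel_mat vs (\<lambda>x y. of_bool (x = y))"
      unfolding kernel_mat_mult[OF vs(2)] vs(1) by (rule kernel_mat_cong) (simp add: vs invol)
    also have "\<dots> = 1\<^sub>m ?n"
      by (rule eq_matI) (auto simp: kernel_mat_def nth_eq_iff_index_eq[OF vs(2)])
    finally show ?thesis .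
  qed
  have PA: "?P * adjacency_mat X vs = adjacency_mat Y vs * ?P"
    unfolding A kernel_mat_mult[OF vs(2)] vs(1)
    by (rule kernel_mat_cong) (simp add: vs intertwine)
  have carr: "adjacency_mat Z vs \<in> carrier_mat ?n ?n" for Z :: "'v pair_pre_digraph"
    by (simp add: A)
  have "?P * adjacency_mat X vs * ?P = adjacency_mat Y vs * (?P * ?P)"
    unfolding PA by (rule assoc_mult_mat[OF carr]) auto
  then have eq: "adjacency_mat Y vs = ?P * adjacency_mat X vs * ?P"
    unfolding PP right_mult_one_mat[OF carr] by (rule sym)
  have "similar_mat_wit (adjacency_mat Y vs) (adjacency_mat X vs) ?P ?P"
    using PP eq carr by (intro similar_mat_witI[where n = ?n] kernel_mat_carrier)
  then have "char_poly (adjacency_mat Y vs) = char_poly (adjacency_mat X vs)"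
    by (intro char_poly_similar) (auto simp: similar_mat_def)
  then show ?thesis
    using fin V vs by (simp add: isospectral_def graph_spectrum_eq[of vs])
qed

lemma sum_of_bool_delta:
  fixes F :: "'v \<Rightarrow> complex"
  assumes "finite V" "x \<in> V"
  shows "(\<Sum>z\<in>V. of_bool (x = z) * F z) = F x" "(\<Sum>z\<in>V. of_bool (z = x) * F z) = F x"
    "(\<Sum>z\<in>V. F z * of_bool (z = x)) = F x"
proof -
  have "(\<Sum>z\<in>V. of_bool (x = z) * F z) = (\<Sum>z\<in>V. if z = x then F z else 0)"
    by (intro sum.cong) auto
  then show 1: "(\<Sum>z\<in>V. of_bool (x = z) * F z) = F x" using assms by simp
  then show 2: "(\<Sum>z\<in>V. of_bool (z = x) * F z) = F x" by (subst eq_commute)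
  then show "(\<Sum>z\<in>V. F z * of_bool (z = x)) = F x" by (simp add: mult.commute)
qed

lemma (in group) Cayley_arc_iff:
  assumes "g \<in> carrier G" "h \<in> carrier G" "S \<subseteq> carrier G"
  shows "(g, h) \<in> parcs (Cayley_graph G S) \<longleftrightarrow> inv g \<otimes> h \<in> S"
proof
  assume "(g, h) \<in> parcs (Cayley_graph G S)"
  then show "inv g \<otimes> h \<in> S"
    using assms by (auto simp: Cayley_graph_def m_assoc[symmetric])
next
  assume "inv g \<otimes> h \<in> S"
  moreover have "h = g \<otimes> (inv g \<otimes> h)" using assms by (simp add: m_assoc[symmetric])
  ultimately show "(g, h) \<in> parcs (Cayley_graph G S)"
    using assms by (auto simp: Cayley_graph_def)
qed

text \<open>
  The intertwiner is \<open>1 - \<Pi> + \<chi>\<Pi>\<close>, where \<open>\<Pi>\<close> projects onto the functions that transform under right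
  translation by \<open>E\<close> according to the sign character.
\<close>

lemma (in group) isospectral_Cayley_twist:
  fixes \<sigma> \<chi> :: "'a \<Rightarrow> complex"
  assumes fin: "finite (carrier G)" and E: "subgroup E G"
    and A: "A \<subseteq> carrier G" and B: "B \<subseteq> carrier G"
    and \<sigma>_mult: "\<And>x y. x \<in> E \<Longrightarrow> y \<in> E \<Longrightarrow> \<sigma> (x \<otimes> y) = \<sigma> x * \<sigma> y"
    and \<sigma>_sq: "\<And>x. x \<in> E \<Longrightarrow> \<sigma> x * \<sigma> x = 1"
    and \<chi>_sq: "\<And>g. g \<in> carrier G \<Longrightarrow> \<chi> g * \<chi> g = 1"
    and \<chi>_E: "\<And>g x. g \<in> carrier G \<Longrightarrow> x \<in> E \<Longrightarrow> \<chi> (g \<otimes> x) = \<chi> g"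
    and diff: "\<And>s. s \<in> carrier G \<Longrightarrow>
      of_bool (s \<in> A) - (\<Sum>x\<in>E. \<sigma> x * of_bool (x \<otimes> s \<in> A)) / card E =
      of_bool (s \<in> B) - (\<Sum>x\<in>E. \<sigma> x * of_bool (s \<otimes> x \<in> B)) / card E"
    and twist: "\<And>g s. g \<in> carrier G \<Longrightarrow> s \<in> carrier G \<Longrightarrow>
      \<chi> g * (\<Sum>x\<in>E. \<sigma> x * of_bool (x \<otimes> s \<in> A)) =
      \<chi> (g \<otimes> s) * (\<Sum>x\<in>E. \<sigma> x * of_bool (s \<otimes> x \<in> B))"
  shows "isospectral (Cayley_graph G A) (Cayley_graph G B)"
proof -
  define \<pi> where "\<pi> g h = (if inv g \<otimes> h \<in> E then \<sigma> (inv g \<otimes> h) / card E else 0)" for g h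
  define P where "P g h = of_bool (g = h) + (\<chi> g - 1) * \<pi> g h" for g h
  have Ecar: "x \<in> carrier G" if "x \<in> E" for x using subgroup.mem_carrier[OF E that] .
  have Einv: "inv x \<in> E" if "x \<in> E" for x using subgroup.m_inv_closed[OF E that] .
  have Efin: "finite E" using fin subgroup.subset[OF E] finite_subset by blast
  have cE: "card E \<noteq> 0" using Efin subgroup.one_closed[OF E] by auto
  have \<sigma>_one: "\<sigma> \<one> = 1"
    using \<sigma>_mult[of \<one> \<one>] \<sigma>_sq[of \<one>] subgroup.one_closed[OF E] by simp
  have \<sigma>_inv: "\<sigma> (inv x) = \<sigma> x" if x: "x \<in> E" for x
  proof -
    have "\<sigma> (inv x) * \<sigma> x = 1"
      using \<sigma>_mult[OF Einv[OF x] x] Ecar[OF x] \<sigma>_one by simp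
    then have "\<sigma> (inv x) * (\<sigma> x * \<sigma> x) = \<sigma> x" by (simp add: mult.assoc[symmetric])
    then show ?thesis using \<sigma>_sq[OF x] by simp
  qed
  have bij_l: "bij_betw (\<lambda>x. g \<otimes> x) E {h \<in> carrier G. inv g \<otimes> h \<in> E}" if g: "g \<in> carrier G" for g
    using g Ecar
    by (intro bij_betwI[where g = "\<lambda>h. inv g \<otimes> h"]) (auto simp: m_assoc[symmetric])
  have bij_inv: "bij_betw (\<lambda>x. inv x) E E"
    using Ecar Einv by (intro bij_betwI[where g = "\<lambda>x. inv x"]) auto
  have sum_l: "(\<Sum>z\<in>carrier G. \<pi> g z * F z) = (\<Sum>x\<in>E. \<sigma> x * F (g \<otimes> x)) / card E"
    if g: "g \<in> carrier G" for g and F :: "'a \<Rightarrow> complex"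
  proof -
    have "(\<Sum>z\<in>carrier G. \<pi> g z * F z) =
        (\<Sum>z\<in>{h \<in> carrier G. inv g \<otimes> h \<in> E}. \<sigma> (inv g \<otimes> z) / card E * F z)"
      by (intro sum.mono_neutral_cong_right) (auto simp: \<pi>_def fin)
    also have "\<dots> = (\<Sum>x\<in>E. \<sigma> (inv g \<otimes> (g \<otimes> x)) / card E * F (g \<otimes> x))"
      by (rule sum.reindex_bij_betw[OF bij_l[OF g], symmetric])
    also have "\<dots> = (\<Sum>x\<in>E. \<sigma> x * F (g \<otimes> x) / card E)"
      using g Ecar by (intro sum.cong) (auto simp: m_assoc[symmetric])
    finally show ?thesis by (simp add: sum_divide_distrib)
  qed
  have \<pi>_sym: "\<pi> g h = \<pi> h g" if "g \<in> carrier G" "h \<in> carrier G" for g h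
  proof -
    have eq: "inv h \<otimes> g = inv (inv g \<otimes> h)" using that by (simp add: inv_mult_group)
    have "inv g \<otimes> h \<in> E \<longleftrightarrow> inv h \<otimes> g \<in> E"
      using Einv[of "inv g \<otimes> h"] Einv[of "inv h \<otimes> g"] that eq by auto
    then show ?thesis using \<sigma>_inv[of "inv g \<otimes> h"] eq by (auto simp: \<pi>_def)
  qed
  \<comment> \<open>\<open>\<pi> g h\<close> is nonzero only when \<open>h\<close> lies in the left
    coset of \<open>g\<close> by \<open>E\<close>, where \<open>\<chi>\<close> is constant:
    multiplication by \<open>\<chi>\<close> commutes with the projection.\<close>
  have \<chi>_\<pi>: "\<chi> h * \<pi> g h = \<chi> g * \<pi> g h" if "g \<in> carrier G" "h \<in> carrier G" for g h
    using \<chi>_E[OF that(1), of "inv g \<otimes> h"] that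
    by (auto simp: \<pi>_def m_assoc[symmetric])
  \<comment> \<open>Moving the first argument inside its coset by \<open>x\<close> multiplies
    \<open>\<pi>\<close> by \<open>\<sigma> x\<close>. Each of the \<open>card E\<close> terms then
    carries \<open>\<sigma> x * \<sigma> x = 1\<close>, and the normalisation divides by their
    number.\<close>
  have \<pi>_idem: "(\<Sum>z\<in>carrier G. \<pi> g z * \<pi> z h) = \<pi> g h"
    if g: "g \<in> carrier G" and h: "h \<in> carrier G" for g h
  proof -
    have "\<pi> (g \<otimes> x) h = \<sigma> x * \<pi> g h" if x: "x \<in> E" for x
    proof -
      have xc: "x \<in> carrier G" using Ecar x by simp
      have eq: "inv (g \<otimes> x) \<otimes> h = inv x \<otimes> (inv g \<otimes> h)"
        using g h xc by (simp add: inv_mult_group m_assoc)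
      have "inv x \<otimes> (inv g \<otimes> h) \<in> E \<longleftrightarrow> inv g \<otimes> h \<in> E"
      proof
        assume "inv x \<otimes> (inv g \<otimes> h) \<in> E"
        then have "x \<otimes> (inv x \<otimes> (inv g \<otimes> h)) \<in> E" using subgroup.m_closed[OF E x] by blast
        then show "inv g \<otimes> h \<in> E" using g h xc by (simp add: m_assoc[symmetric])
      qed (use subgroup.m_closed[OF E] Einv[OF x] in blast)
      then show ?thesis
        using \<sigma>_mult[OF Einv[OF x]] \<sigma>_inv[OF x] unfolding \<pi>_def eq by auto
    qed
    then have "(\<Sum>x\<in>E. \<sigma> x * \<pi> (g \<otimes> x) h) = (\<Sum>x\<in>E. (\<sigma> x * \<sigma> x) * \<pi> g h)"
      by (intro sum.cong) (auto simp: mult.assoc)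
    also have "\<dots> = card E * \<pi> g h" by (simp add: \<sigma>_sq)
    finally show ?thesis using sum_l[OF g] cE by simp
  qed
  show ?thesis
  proof (rule isospectral_if_intertwined[where P = P])
    show "finite (pverts (Cayley_graph G A))" using fin by (simp add: Cayley_graph_def)
    show "pverts (Cayley_graph G B) = pverts (Cayley_graph G A)" by (simp add: Cayley_graph_def)
    fix g h assume "g \<in> pverts (Cayley_graph G A)" "h \<in> pverts (Cayley_graph G A)"
    then have g: "g \<in> carrier G" and h: "h \<in> carrier G" by (auto simp: Cayley_graph_def)
    let ?s = "inv g \<otimes> h"
    have s: "?s \<in> carrier G" using g h by simp
    have "(\<Sum>z\<in>carrier G. P g z * P z h) =
        (\<Sum>z\<in>carrier G. of_bool (g = z) * (of_bool (z = h) + (\<chi> z - 1) * \<pi> z h)) +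
        (\<Sum>z\<in>carrier G. (\<chi> g - 1) * \<pi> g z * of_bool (z = h)) +
        (\<Sum>z\<in>carrier G. (\<chi> g - 1) * (\<chi> g - 1) * (\<pi> g z * \<pi> z h))"
      unfolding sum.distrib[symmetric]
    proof (rule sum.cong[OF refl])
      fix z assume z: "z \<in> carrier G"
      \<comment> \<open>The side condition is the termwise form of the commutation: wherever
        \<open>\<pi> g z\<close> is nonzero, \<open>\<chi> z\<close> may be replaced by
        \<open>\<chi> g\<close>.\<close>
      have expand: "(a + x * p) * (b + x' * p') = a * (b + x' * p') + x * p * b + x * x * (p * p')"
        if "p = 0 \<or> x' = x" for a b x x' p p' :: complex
        using that by (elim disjE) (simp_all add: distrib_left distrib_right)
      have "\<pi> g z = 0 \<or> \<chi> z - 1 = \<chi> g - 1" using \<chi>_\<pi>[OF g z] by simp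
      then show "P g z * P z h = of_bool (g = z) * (of_bool (z = h) + (\<chi> z - 1) * \<pi> z h) +
        (\<chi> g - 1) * \<pi> g z * of_bool (z = h) + (\<chi> g - 1) * (\<chi> g - 1) * (\<pi> g z * \<pi> z h)"
        unfolding P_def by (rule expand)
    qed
    also have "\<dots> = of_bool (g = h) + (\<chi> g - 1) * \<pi> g h + (\<chi> g - 1) * \<pi> g h +
        (\<chi> g - 1) * (\<chi> g - 1) * \<pi> g h"
      unfolding sum_distrib_left[symmetric] \<pi>_idem[OF g h]
      by (simp only: sum_of_bool_delta[OF fin g] sum_of_bool_delta[OF fin h])
    \<comment> \<open>The coefficient of \<open>\<pi> g h\<close> vanishes by
      \<open>\<chi>_sq\<close>, which makes \<open>P\<close> an involution.\<close>
    also have "\<dots> = of_bool (g = h) + (\<chi> g * \<chi> g - 1) * \<pi> g h" by (simp add: algebra_simps)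
    finally show "(\<Sum>z\<in>pverts (Cayley_graph G A). P g z * P z h) = of_bool (g = h)"
      using \<chi>_sq[OF g] by (simp add: Cayley_graph_def)
    have "(\<Sum>z\<in>carrier G. P g z * of_bool ((z, h) \<in> parcs (Cayley_graph G A))) =
        (\<Sum>z\<in>carrier G. of_bool (g = z) * of_bool (inv z \<otimes> h \<in> A)) +
        (\<Sum>z\<in>carrier G. (\<chi> g - 1) * (\<pi> g z * of_bool (inv z \<otimes> h \<in> A)))"
      unfolding sum.distrib[symmetric] using h
      by (intro sum.cong refl) (simp only: P_def Cayley_arc_iff[OF _ h A] distrib_right mult.assoc)
    also have "\<dots> = of_bool (?s \<in> A) +
        (\<chi> g - 1) * ((\<Sum>x\<in>E. \<sigma> x * of_bool (inv (g \<otimes> x) \<otimes> h \<in> A)) / card E)"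
      unfolding sum_distrib_left[symmetric] sum_l[OF g] sum_of_bool_delta[OF fin g] ..
    \<comment> \<open>The summation variable is then replaced by its inverse, under which
      \<open>\<sigma>\<close> does not change.\<close>
    also have "(\<Sum>x\<in>E. \<sigma> x * of_bool (inv (g \<otimes> x) \<otimes> h \<in> A)) =
        (\<Sum>x\<in>E. \<sigma> (inv x) * of_bool (inv x \<otimes> ?s \<in> A))"
      using g h Ecar by (intro sum.cong) (auto simp: inv_mult_group m_assoc \<sigma>_inv)
    also have "\<dots> = (\<Sum>x\<in>E. \<sigma> x * of_bool (x \<otimes> ?s \<in> A))"
      using sum.reindex_bij_betw[OF bij_inv, of "\<lambda>x. \<sigma> x * of_bool (x \<otimes> ?s \<in> A)"] by simp
    finally have L: "(\<Sum>z\<in>carrier G. P g z * of_bool ((z, h) \<in> parcs (Cayley_graph G A))) =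
        of_bool (?s \<in> A) + (\<chi> g - 1) * ((\<Sum>x\<in>E. \<sigma> x * of_bool (x \<otimes> ?s \<in> A)) / card E)" .
    have "(\<Sum>z\<in>carrier G. of_bool ((g, z) \<in> parcs (Cayley_graph G B)) * P z h) =
        (\<Sum>z\<in>carrier G. of_bool (z = h) * of_bool (inv g \<otimes> z \<in> B)) +
        (\<Sum>z\<in>carrier G. (\<chi> h - 1) * (\<pi> h z * of_bool (inv g \<otimes> z \<in> B)))"
      unfolding sum.distrib[symmetric]
    proof (rule sum.cong[OF refl])
      fix z assume z: "z \<in> carrier G"
      have "\<chi> z * \<pi> z h = \<chi> h * \<pi> z h" using \<chi>_\<pi>[OF h z] \<pi>_sym[OF h z] by simp
      then show "of_bool ((g, z) \<in> parcs (Cayley_graph G B)) * P z h =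
          of_bool (z = h) * of_bool (inv g \<otimes> z \<in> B) +
          (\<chi> h - 1) * (\<pi> h z * of_bool (inv g \<otimes> z \<in> B))"
        unfolding P_def Cayley_arc_iff[OF g z B] using \<pi>_sym[OF h z]
        by (simp only: left_diff_distrib distrib_left mult.commute mult.left_commute) simp
    qed
    also have "\<dots> = of_bool (?s \<in> B) +
        (\<chi> h - 1) * ((\<Sum>x\<in>E. \<sigma> x * of_bool (inv g \<otimes> (h \<otimes> x) \<in> B)) / card E)"
      unfolding sum_distrib_left[symmetric] sum_l[OF h] sum_of_bool_delta[OF fin h] ..
    also have "(\<Sum>x\<in>E. \<sigma> x * of_bool (inv g \<otimes> (h \<otimes> x) \<in> B)) =
        (\<Sum>x\<in>E. \<sigma> x * of_bool (?s \<otimes> x \<in> B))"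
      using g h Ecar by (intro sum.cong) (auto simp: m_assoc)
    finally have R: "(\<Sum>z\<in>carrier G. of_bool ((g, z) \<in> parcs (Cayley_graph G B)) * P z h) =
        of_bool (?s \<in> B) + (\<chi> h - 1) * ((\<Sum>x\<in>E. \<sigma> x * of_bool (?s \<otimes> x \<in> B)) / card E)" .
    have "g \<otimes> ?s = h" using g h by (simp add: m_assoc[symmetric])
    then have tw: "\<chi> g * ((\<Sum>x\<in>E. \<sigma> x * of_bool (x \<otimes> ?s \<in> A)) / card E) =
        \<chi> h * ((\<Sum>x\<in>E. \<sigma> x * of_bool (?s \<otimes> x \<in> B)) / card E)"
      using twist[OF g s] by (simp only: times_divide_eq_right)
    \<comment> \<open>\<open>diff\<close> is the agreement of the two operators on the complement of
      the sign functions, \<open>twist\<close> their agreement up to \<open>\<chi>\<close> on the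
      sign functions; together they give the intertwining relation entry by entry.\<close>
    have combine: "a + (x - 1) * l = b + (x' - 1) * l'"
      if "a - l = b - l'" "x * l = x' * l'" for a b x x' l l' :: complex
    proof -
      have "a + (x - 1) * l = (a - l) + x * l" by (simp add: left_diff_distrib)
      also have "\<dots> = b + (x' - 1) * l'" unfolding that by (simp add: left_diff_distrib)
      finally show ?thesis .
    qed
    show "(\<Sum>z\<in>pverts (Cayley_graph G A). P g z * of_bool ((z, h) \<in> parcs (Cayley_graph G A))) =
        (\<Sum>z\<in>pverts (Cayley_graph G A). of_bool ((g, z) \<in> parcs (Cayley_graph G B)) * P z h)"
      using L R combine[OF diff[OF s] tw] by (simp add: Cayley_graph_def)
  qed
qed

section \<open>A switching configuration\<close>

text \<open>\<open>www\<close>, \<open>cc\<close>, \<open>cw\<close> with \<open>w_neq\<close> and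
  \<open>c_notin\<close> describe a copy of S_3; \<open>indep\<close> makes its product with
  \<open>F\<close> direct, and \<open>y_notin\<close> keeps \<open>y\<close> outside this product.
  Words are bracketed to the right so that the relations serve as rewrite rules.\<close>

locale switching = group G for G (structure) +
  fixes w c y :: 'a and F :: "'a set"
  assumes fin: "finite (carrier G)"
    and w [simp]: "w \<in> carrier G" and c [simp]: "c \<in> carrier G" and y [simp]: "y \<in> carrier G"
    and F: "subgroup F G"
    and www: "w \<otimes> (w \<otimes> w) = \<one>" and cc: "c \<otimes> c = \<one>" and yy: "y \<otimes> y = \<one>"
    and cw: "c \<otimes> w = w \<otimes> (w \<otimes> c)" and wy: "w \<otimes> y = y \<otimes> w" and cy: "c \<otimes> y = y \<otimes> c"
    and wF: "z \<in> F \<Longrightarrow> w \<otimes> z = z \<otimes> w" and cF: "z \<in> F \<Longrightarrow> c \<otimes> z = z \<otimes> c"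
    and yF: "z \<in> F \<Longrightarrow> z \<otimes> y = y \<otimes> z"
    and w_neq: "w \<noteq> \<one>" and c_notin: "c \<notin> {\<one>, w, w \<otimes> w}"
    and indep: "{\<one>, w, w \<otimes> w, c, w \<otimes> c, w \<otimes> (w \<otimes> c)} \<inter> F = {\<one>}"
    and y_notin: "x \<in> {\<one>, w, w \<otimes> w, c, w \<otimes> c, w \<otimes> (w \<otimes> c)} \<Longrightarrow> z \<in> F \<Longrightarrow> y \<noteq> z \<otimes> x"
begin

definition N :: "'a set" where "N = {\<one>, w, w \<otimes> w}"
definition N' :: "'a set" where "N' = {c, w \<otimes> c, w \<otimes> (w \<otimes> c)}"
definition E :: "'a set" where "E = N \<union> N'"
text \<open>The double coset of \<open>w\<close> for the subgroup {1, c} of \<open>E\<close>. As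
  \<open>D\<close> is invariant under \<open>c\<close> on both sides, it can only contain whole
  double cosets.\<close>

definition Q :: "'a set" where "Q = {w, w \<otimes> w, w \<otimes> c, w \<otimes> (w \<otimes> c)}"
definition L :: "'a set" where "L = {z \<otimes> x | z x. z \<in> F \<and> x \<in> E}"
definition Y :: "'a set" where "Y = {y \<otimes> x | x. x \<in> N}"
definition Y' :: "'a set" where "Y' = {y \<otimes> x | x. x \<in> N'}"

lemma absorb:
  assumes "x \<in> carrier G"
  shows "w \<otimes> (w \<otimes> (w \<otimes> x)) = x" "c \<otimes> (c \<otimes> x) = x" "y \<otimes> (y \<otimes> x) = x"
    "c \<otimes> (w \<otimes> x) = w \<otimes> (w \<otimes> (c \<otimes> x))" "w \<otimes> (y \<otimes> x) = y \<otimes> (w \<otimes> x)"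
    "c \<otimes> (y \<otimes> x) = y \<otimes> (c \<otimes> x)"
proof -
  show "w \<otimes> (w \<otimes> (w \<otimes> x)) = x" using assms www by (metis l_one m_assoc m_closed w)
  show "c \<otimes> (c \<otimes> x) = x" using assms cc by (metis l_one m_assoc c)
  show "y \<otimes> (y \<otimes> x) = x" using assms yy by (metis l_one m_assoc y)
  show "c \<otimes> (w \<otimes> x) = w \<otimes> (w \<otimes> (c \<otimes> x))" using assms cw by (metis m_assoc m_closed w c)
  show "w \<otimes> (y \<otimes> x) = y \<otimes> (w \<otimes> x)" using assms wy by (metis m_assoc w y)
  show "c \<otimes> (y \<otimes> x) = y \<otimes> (c \<otimes> x)" using assms cy by (metis m_assoc c y)
qed

lemma F_carrier: "z \<in> F \<Longrightarrow> z \<in> carrier G"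
  using subgroup.mem_carrier[OF F] .

lemma absorbF:
  assumes "x \<in> carrier G" "z \<in> F"
  shows "w \<otimes> (z \<otimes> x) = z \<otimes> (w \<otimes> x)" "c \<otimes> (z \<otimes> x) = z \<otimes> (c \<otimes> x)"
    "y \<otimes> (z \<otimes> x) = z \<otimes> (y \<otimes> x)"
  using assms wF[of z] cF[of z] yF[of z] F_carrier[of z] by (metis m_assoc w, metis m_assoc c, metis m_assoc y)

text \<open>Rewriting brings every word into the order: factor from \<open>F\<close>, then
  \<open>y\<close>, then powers of \<open>w\<close>, then \<open>c\<close>.\<close>

lemmas word_simps = m_assoc absorb www cc yy cw wy cy wF cF yF[symmetric] absorbF

text \<open>If \<open>w c\<close> or its product with a further \<open>w\<close> were a power of
  \<open>w\<close>, cancelling the powers of \<open>w\<close> would make \<open>c\<close> one,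
  against \<open>c_notin\<close>.\<close>

lemma distinct_E: "distinct [\<one>, w, w \<otimes> w, c, w \<otimes> c, w \<otimes> (w \<otimes> c)]"
proof -
  have 1: "w \<otimes> w \<noteq> \<one>" using www w_neq by (metis r_one w)
  have 2: "w \<otimes> w \<noteq> w" using w_neq by (metis l_cancel_one w one_closed)
  have 3: "w \<otimes> c \<noteq> x" if x: "x \<in> {\<one>, w, w \<otimes> w}" for x
  proof
    assume "w \<otimes> c = x"
    then have "w \<otimes> (w \<otimes> (w \<otimes> c)) = w \<otimes> (w \<otimes> x)" by simp
    then show False using x c_notin by (auto simp: word_simps)
  qed
  have 4: "w \<otimes> (w \<otimes> c) \<noteq> x" if x: "x \<in> {\<one>, w, w \<otimes> w}" for x
  proof
    assume "w \<otimes> (w \<otimes> c) = x"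
    then have "w \<otimes> (w \<otimes> (w \<otimes> c)) = w \<otimes> x" by simp
    then show False using x c_notin by (auto simp: word_simps)
  qed
  have 5: "w \<otimes> x \<noteq> x" if "x \<in> carrier G" for x
    using that w_neq by (metis r_cancel_one w)
  have 6: "w \<otimes> (w \<otimes> c) \<noteq> c" using 1 by (metis m_assoc r_cancel_one w m_closed c)
  show ?thesis using 1 2 3 4 5 6 w_neq c_notin by (auto simp: eq_commute)
qed

lemma neqs:
  "\<one> \<noteq> w" "w \<noteq> \<one>" "\<one> \<noteq> w \<otimes> w" "w \<otimes> w \<noteq> \<one>" "\<one> \<noteq> c" "c \<noteq> \<one>" "\<one> \<noteq> w \<otimes> c" "w \<otimes> c \<noteq> \<one>"
  "\<one> \<noteq> w \<otimes> (w \<otimes> c)" "w \<otimes> (w \<otimes> c) \<noteq> \<one>" "w \<noteq> w \<otimes> w" "w \<otimes> w \<noteq> w" "w \<noteq> c" "c \<noteq> w"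
  "w \<noteq> w \<otimes> c" "w \<otimes> c \<noteq> w" "w \<noteq> w \<otimes> (w \<otimes> c)" "w \<otimes> (w \<otimes> c) \<noteq> w" "w \<otimes> w \<noteq> c" "c \<noteq> w \<otimes> w"
  "w \<otimes> w \<noteq> w \<otimes> c" "w \<otimes> c \<noteq> w \<otimes> w" "w \<otimes> w \<noteq> w \<otimes> (w \<otimes> c)" "w \<otimes> (w \<otimes> c) \<noteq> w \<otimes> w"
  "c \<noteq> w \<otimes> c" "w \<otimes> c \<noteq> c" "c \<noteq> w \<otimes> (w \<otimes> c)" "w \<otimes> (w \<otimes> c) \<noteq> c"
  "w \<otimes> c \<noteq> w \<otimes> (w \<otimes> c)" "w \<otimes> (w \<otimes> c) \<noteq> w \<otimes> c"
  using distinct_E by auto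

lemma E_eq: "E = {\<one>, w, w \<otimes> w, c, w \<otimes> c, w \<otimes> (w \<otimes> c)}"
  by (auto simp: E_def N_def N'_def)

lemma E_cases [consumes 1]:
  assumes "x \<in> E"
  obtains "x = \<one>" | "x = w" | "x = w \<otimes> w" | "x = c" | "x = w \<otimes> c" | "x = w \<otimes> (w \<otimes> c)"
  using assms by (auto simp: E_eq)

lemma E_carrier: "x \<in> E \<Longrightarrow> x \<in> carrier G"
  by (auto simp: E_eq)

lemma E_mult: "x \<in> E \<Longrightarrow> x' \<in> E \<Longrightarrow> x \<otimes> x' \<in> E"
  by (auto simp: E_eq word_simps)

lemma E_inv: "x \<in> E \<Longrightarrow> inv x \<in> E"
proof -
  have *: "inv x \<in> E" if "x \<in> E" "x' \<in> E" "x' \<otimes> x = \<one>" for x x'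
    using inv_equality[OF that(3)] that E_carrier by simp
  assume "x \<in> E"
  then show ?thesis
  proof (cases x rule: E_cases)
    case 1 then show ?thesis by (simp add: E_eq)
  next
    case 2 show ?thesis using 2 by (intro *[of _ "w \<otimes> w"]) (auto simp: E_eq word_simps)
  next
    case 3 show ?thesis using 3 by (intro *[of _ w]) (auto simp: E_eq word_simps)
  next
    case 4 show ?thesis using 4 by (intro *[of _ c]) (auto simp: E_eq word_simps)
  next
    case 5 show ?thesis using 5 by (intro *[of _ "w \<otimes> c"]) (auto simp: E_eq word_simps)
  next
    case 6 show ?thesis using 6 by (intro *[of _ "w \<otimes> (w \<otimes> c)"]) (auto simp: E_eq word_simps)
  qed
qed

lemma subgroup_E: "subgroup E G"
  by (rule subgroupI) (auto simp: E_carrier E_mult E_inv, auto simp: E_eq)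

lemma EF_comm: "x \<in> E \<Longrightarrow> z \<in> F \<Longrightarrow> x \<otimes> z = z \<otimes> x"
  using F_carrier[of z] by (auto simp: E_eq word_simps)

lemma Ey_comm: "x \<in> E \<Longrightarrow> x \<otimes> y = y \<otimes> x"
  by (auto simp: E_eq word_simps)

lemma E_F: "x \<in> E \<Longrightarrow> x \<in> F \<Longrightarrow> x = \<one>"
  using indep by (auto simp: E_eq)

lemma Q_E: "x \<in> Q \<Longrightarrow> x \<in> E"
  by (auto simp: Q_def E_eq)

lemma L_I: "z \<in> F \<Longrightarrow> x \<in> E \<Longrightarrow> z \<otimes> x \<in> L"
  by (auto simp: L_def)

lemma E_L: "x \<in> E \<Longrightarrow> x \<in> L"
  using L_I[OF subgroup.one_closed[OF F]] E_carrier by force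

lemma F_L: "z \<in> F \<Longrightarrow> z \<in> L"
  using L_I[of z \<one>] F_carrier by (force simp: E_eq)

lemma subgroup_L: "subgroup L G"
proof (rule subgroupI)
  show "L \<subseteq> carrier G" using F_carrier E_carrier by (auto simp: L_def)
  show "L \<noteq> {}" using F_L subgroup.one_closed[OF F] by blast
  fix a assume "a \<in> L"
  then obtain z x where a: "a = z \<otimes> x" "z \<in> F" "x \<in> E" by (auto simp: L_def)
  have "inv a = inv z \<otimes> inv x"
    using a EF_comm[of "inv x" "inv z"] E_inv subgroup.m_inv_closed[OF F] F_carrier E_carrier
    by (simp add: inv_mult_group)
  then show "inv a \<in> L" using a E_inv subgroup.m_inv_closed[OF F] L_I by simp
  fix b assume "b \<in> L"
  then obtain z' x' where b: "b = z' \<otimes> x'" "z' \<in> F" "x' \<in> E" by (auto simp: L_def)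
  have "a \<otimes> b = z \<otimes> ((x \<otimes> z') \<otimes> x')"
    using a b F_carrier E_carrier by (simp add: m_assoc)
  also have "\<dots> = (z \<otimes> z') \<otimes> (x \<otimes> x')"
    unfolding EF_comm[OF a(3) b(2)] using a b F_carrier E_carrier by (simp add: m_assoc)
  finally show "a \<otimes> b \<in> L" using a b L_I E_mult subgroup.m_closed[OF F] by simp
qed

lemmas L_mult = subgroup.m_closed[OF subgroup_L]
lemmas L_inv = subgroup.m_inv_closed[OF subgroup_L]
lemmas L_carrier = subgroup.mem_carrier[OF subgroup_L]

lemma Ly_comm: "a \<in> L \<Longrightarrow> a \<otimes> y = y \<otimes> a"
proof -
  assume "a \<in> L"
  then obtain z x where a: "a = z \<otimes> x" "z \<in> F" "x \<in> E" by (auto simp: L_def)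
  then show ?thesis
    using Ey_comm[of x] yF[of z] F_carrier E_carrier by (metis m_assoc y)
qed

lemma y_notin_L: "y \<notin> L"
  using y_notin by (auto simp: L_def E_eq)

lemma yL_notin_L: "a \<in> L \<Longrightarrow> y \<otimes> a \<notin> L"
proof
  assume a: "a \<in> L" and "y \<otimes> a \<in> L"
  then have "(y \<otimes> a) \<otimes> inv a \<in> L" using L_mult L_inv by blast
  then show False using y_notin_L a L_carrier by (simp add: m_assoc)
qed

text \<open>Since \<open>y\<close> is an involution commuting with \<open>L\<close> and outside it,
  this is a subgroup in which \<open>L\<close> has index 2. All constraints on \<open>D\<close>
  concern elements of \<open>H\<close>, so additional generators and filler elements are kept
  outside.\<close>

definition H :: "'a set" where "H = L \<union> (\<lambda>a. y \<otimes> a) ` L"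

lemma inv_y: "inv y = y"
  using yy by (intro inv_equality) auto

lemma subgroup_H: "subgroup H G"
proof (rule subgroupI)
  show "H \<subseteq> carrier G" using L_carrier by (auto simp: H_def)
  show "H \<noteq> {}" using subgroup.one_closed[OF subgroup_L] by (auto simp: H_def)
  have yL: "y \<otimes> (a \<otimes> (y \<otimes> b)) = a \<otimes> b" "a \<otimes> (y \<otimes> b) = y \<otimes> (a \<otimes> b)" if "a \<in> L" "b \<in> L" for a b
  proof -
    have "a \<otimes> (y \<otimes> b) = (a \<otimes> y) \<otimes> b" using that L_carrier by (simp add: m_assoc)
    then show "a \<otimes> (y \<otimes> b) = y \<otimes> (a \<otimes> b)" using that L_carrier Ly_comm by (simp add: m_assoc)
    then show "y \<otimes> (a \<otimes> (y \<otimes> b)) = a \<otimes> b" using that L_carrier by (simp add: absorb)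
  qed
  show "inv a \<in> H" if "a \<in> H" for a
    using that L_inv L_carrier Ly_comm by (auto simp: H_def inv_mult_group inv_y)
  show "a \<otimes> b \<in> H" if "a \<in> H" "b \<in> H" for a b
    using that L_mult L_carrier by (auto simp: H_def m_assoc yL absorb)
qed

lemma subgroup_cancel:
  assumes "subgroup K G" "b \<in> K" "a \<in> carrier G"
  shows "a \<otimes> b \<in> K \<longleftrightarrow> a \<in> K" "b \<otimes> a \<in> K \<longleftrightarrow> a \<in> K"
proof -
  have b: "inv b \<in> K" "b \<in> carrier G"
    using assms subgroup.m_inv_closed subgroup.mem_carrier by metis+
  show "a \<otimes> b \<in> K \<longleftrightarrow> a \<in> K"
  proof
    assume "a \<otimes> b \<in> K"
    from subgroup.m_closed[OF assms(1) this b(1)] show "a \<in> K" using assms(3) b by (simp add: m_assoc)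
  qed (use subgroup.m_closed[OF assms(1)] assms(2) in blast)
  show "b \<otimes> a \<in> K \<longleftrightarrow> a \<in> K"
  proof
    assume "b \<otimes> a \<in> K"
    from subgroup.m_closed[OF assms(1) b(1) this] show "a \<in> K"
      using assms(3) b by (simp add: m_assoc[symmetric])
  qed (use subgroup.m_closed[OF assms(1)] assms(2) in blast)
qed

text \<open>After cancelling \<open>y\<close>, the element
  \<open>inv z' \<otimes> z = x' \<otimes> inv x\<close> lies in \<open>F\<close> and in
  \<open>E\<close>, hence is trivial.\<close>

lemma zyx_inj:
  assumes z: "z \<in> F" "z' \<in> F" and x: "x \<in> E" "x' \<in> E" and eq: "z \<otimes> (y \<otimes> x) = z' \<otimes> (y \<otimes> x')"
  shows "z = z'" "x = x'"
proof -
  have c: "z \<in> carrier G" "z' \<in> carrier G" "x \<in> carrier G" "x' \<in> carrier G"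
    using z F_carrier E_carrier x by auto
  have "y \<otimes> (z \<otimes> x) = y \<otimes> (z' \<otimes> x')" using eq z c by (simp add: absorbF)
  then have zx: "z \<otimes> x = z' \<otimes> x'" using c by simp
  have "inv z' \<otimes> z = inv z' \<otimes> ((z \<otimes> x) \<otimes> inv x)" using c by (simp add: m_assoc)
  also have "\<dots> = x' \<otimes> inv x" unfolding zx using c by (simp add: m_assoc[symmetric])
  finally have "inv z' \<otimes> z = x' \<otimes> inv x" .
  moreover have "inv z' \<otimes> z \<in> F" using subgroup.m_closed[OF F subgroup.m_inv_closed[OF F]] z by blast
  moreover have "x' \<otimes> inv x \<in> E" using E_mult E_inv x by blast
  ultimately have "inv z' \<otimes> z = \<one>" using E_F by simp
  then show "z = z'" using c by (metis inv_equality inv_inv inv_closed)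
  then show "x = x'" using zx c by simp
qed

lemma inj_on_zyx: "inj_on (\<lambda>(z, x). z \<otimes> (y \<otimes> x)) (F \<times> E)"
proof (rule inj_onI, clarify)
  fix z x z' x'
  assume "z \<in> F" "x \<in> E" "z' \<in> F" "x' \<in> E" "z \<otimes> (y \<otimes> x) = z' \<otimes> (y \<otimes> x')"
  then show "z = z' \<and> x = x'" using zyx_inj[of z z' x x'] by simp
qed

lemma Y_eq: "Y = {y, y \<otimes> w, y \<otimes> (w \<otimes> w)}"
  "Y' = {y \<otimes> c, y \<otimes> (w \<otimes> c), y \<otimes> (w \<otimes> (w \<otimes> c))}"
proof -
  have "Y = (\<lambda>x. y \<otimes> x) ` N" "Y' = (\<lambda>x. y \<otimes> x) ` N'" by (auto simp: Y_def Y'_def)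
  then show "Y = {y, y \<otimes> w, y \<otimes> (w \<otimes> w)}" "Y' = {y \<otimes> c, y \<otimes> (w \<otimes> c), y \<otimes> (w \<otimes> (w \<otimes> c))}"
    by (simp_all add: N_def N'_def)
qed

lemma inv_Y: "u \<in> Y \<Longrightarrow> inv u \<in> Y" "u \<in> Y' \<Longrightarrow> inv u \<in> Y'"
proof -
  have inv_yx: "inv (y \<otimes> x) = y \<otimes> inv x" if "x \<in> E" for x
    using Ey_comm[OF E_inv[OF that]] E_carrier[OF that] by (simp add: inv_mult_group inv_y)
  have "inv w = w \<otimes> w" "inv (w \<otimes> w) = w" "inv c = c" "inv (w \<otimes> c) = w \<otimes> c"
    "inv (w \<otimes> (w \<otimes> c)) = w \<otimes> (w \<otimes> c)"
    by (rule inv_equality; simp add: word_simps)+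
  then have N: "inv x \<in> N" "x \<in> E" if "x \<in> N" for x using that by (auto simp: N_def E_eq)
  have N': "inv x \<in> N'" "x \<in> E" if "x \<in> N'" for x
    using that \<open>inv c = c\<close> \<open>inv (w \<otimes> c) = w \<otimes> c\<close> \<open>inv (w \<otimes> (w \<otimes> c)) = w \<otimes> (w \<otimes> c)\<close>
    by (auto simp: N'_def E_eq)
  show "u \<in> Y \<Longrightarrow> inv u \<in> Y" using N inv_yx by (auto simp: Y_def)
  show "u \<in> Y' \<Longrightarrow> inv u \<in> Y'" using N' inv_yx by (auto simp: Y'_def)
qed

lemma L_cancel: "a \<in> carrier G \<Longrightarrow> b \<in> L \<Longrightarrow> a \<otimes> b \<in> L \<longleftrightarrow> a \<in> L"
  by (rule subgroup_cancel(1)[OF subgroup_L])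

section \<open>The sign character of \<open>E\<close> and twisted sums over \<open>E\<close>\<close>

text \<open>The sign character of \<open>E\<close>, with kernel \<open>N\<close>; off
  \<open>E\<close> the value -1 is only a default, and multiplicativity is claimed on
  \<open>E\<close> alone.\<close>

definition sg :: "'a \<Rightarrow> complex" where "sg x = (if x \<in> N then 1 else - 1)"

lemma N'_iff: "x \<in> E \<Longrightarrow> x \<in> N' \<longleftrightarrow> x \<notin> N"
  by (elim E_cases) (simp_all add: N_def N'_def neqs)

lemma sg_mult: "x \<in> E \<Longrightarrow> x' \<in> E \<Longrightarrow> sg (x \<otimes> x') = sg x * sg x'"
  by (elim E_cases) (simp_all add: sg_def N_def word_simps neqs)

lemma sg_sq: "sg x * sg x = 1"
  by (simp add: sg_def)

lemma sg_cancel: "sg x * (sg x * v) = v" "sg x * (sg x' * (sg x * v)) = sg x' * v"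
  by (simp_all add: sg_def)

lemma sg_c: "x \<in> E \<Longrightarrow> sg (c \<otimes> x) = - sg x" "x \<in> E \<Longrightarrow> sg (x \<otimes> c) = - sg x"
  by (simp_all add: sg_mult E_eq) (auto simp: sg_def N_def neqs)

lemma finite_E: "finite E" and card_E: "card E = 6"
  using distinct_card[OF distinct_E] by (simp_all add: E_eq)

lemma bij_left: "a \<in> E \<Longrightarrow> bij_betw (\<lambda>x. a \<otimes> x) E E"
  and bij_right: "a \<in> E \<Longrightarrow> bij_betw (\<lambda>x. x \<otimes> a) E E"
proof -
  assume a: "a \<in> E"
  then have ac: "a \<in> carrier G" by (rule E_carrier)
  show "bij_betw (\<lambda>x. a \<otimes> x) E E"
    using a ac E_inv[OF a] E_mult E_carrier
    by (intro bij_betwI[where g = "\<lambda>x. inv a \<otimes> x"]) (auto simp: m_assoc[symmetric])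
  show "bij_betw (\<lambda>x. x \<otimes> a) E E"
    using a ac E_inv[OF a] E_mult E_carrier
    by (intro bij_betwI[where g = "\<lambda>x. x \<otimes> inv a"]) (auto simp: m_assoc)
qed

text \<open>The function need not be a homomorphism. Every left coset of \<open>H\<close> splits
  into two left cosets of \<open>L\<close>; a representative of the former is chosen and the sign
  tells in which half \<open>g\<close> lies. Right multiplication by \<open>y\<close> exchanges the
  halves because \<open>y\<close> commutes with \<open>L\<close>.\<close>

lemma parity_character:
  obtains \<chi> :: "'a \<Rightarrow> complex" where "\<And>g. g \<in> carrier G \<Longrightarrow> \<chi> g * \<chi> g = 1"
    "\<And>g a. g \<in> carrier G \<Longrightarrow> a \<in> L \<Longrightarrow> \<chi> (g \<otimes> a) = \<chi> g"
    "\<And>g. g \<in> carrier G \<Longrightarrow> \<chi> (g \<otimes> y) = - \<chi> g"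
proof -
  have H_cancel: "a \<otimes> b \<in> H \<longleftrightarrow> a \<in> H" if "a \<in> carrier G" "b = y \<or> b \<in> L" for a b
  proof (rule subgroup_cancel(1)[OF subgroup_H _ that(1)])
    have "y = y \<otimes> \<one>" by simp
    then show "b \<in> H" using that(2) subgroup.one_closed[OF subgroup_L] unfolding H_def by blast
  qed
  define rep where "rep g = (SOME h. h \<in> carrier G \<and> inv h \<otimes> g \<in> H)" for g
  have "\<one> \<in> H" by (rule subgroup.one_closed[OF subgroup_H])
  then have ex: "\<exists>h. h \<in> carrier G \<and> inv h \<otimes> g \<in> H" if "g \<in> carrier G" for g
    using that by (intro exI[of _ g]) simp
  have rep: "rep g \<in> carrier G \<and> inv (rep g) \<otimes> g \<in> H" if "g \<in> carrier G" for g
    using someI_ex[OF ex[OF that]] unfolding rep_def .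
  \<comment> \<open>\<open>SOME\<close> is applied to the same predicate for \<open>g\<close> and
    \<open>g \<otimes> b\<close>, so the chosen representative is the same element, not merely one
    in the same coset.\<close>
  have rep_eq: "rep (g \<otimes> b) = rep g" if g: "g \<in> carrier G" and b: "b = y \<or> b \<in> L" for g b
  proof -
    have "b \<in> carrier G" using b L_carrier by auto
    then have "(h \<in> carrier G \<and> inv h \<otimes> (g \<otimes> b) \<in> H) = (h \<in> carrier G \<and> inv h \<otimes> g \<in> H)" for h
      using H_cancel[of "inv h \<otimes> g" b] g b by (auto simp: m_assoc)
    then show ?thesis unfolding rep_def by simp
  qed
  define \<chi> where "\<chi> g = (if inv (rep g) \<otimes> g \<in> L then 1 else - 1 :: complex)" for g
  show ?thesis
  proof
    show "\<chi> g * \<chi> g = 1" for g by (simp add: \<chi>_def)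
    show "\<chi> (g \<otimes> a) = \<chi> g" if g: "g \<in> carrier G" and a: "a \<in> L" for g a
      using rep_eq[OF g disjI2[OF a]] rep[OF g] L_cancel[of "inv (rep g) \<otimes> g" a] g a L_carrier[OF a]
      by (simp add: \<chi>_def m_assoc)
    show "\<chi> (g \<otimes> y) = - \<chi> g" if g: "g \<in> carrier G" for g
    proof -
      let ?h = "inv (rep g) \<otimes> g"
      have h: "?h \<in> carrier G" "?h \<in> H" using rep[OF g] g by auto
      have "?h \<otimes> y \<in> L \<longleftrightarrow> ?h \<notin> L"
      proof (cases "?h \<in> L")
        case True
        then show ?thesis using yL_notin_L[OF True] Ly_comm[OF True] by simp
      next
        case False
        then obtain l where "l \<in> L" "?h = y \<otimes> l" using h by (auto simp: H_def)
        then have "?h \<otimes> y = l" using Ly_comm[of l] L_carrier[of l] by (simp add: m_assoc absorb)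
        then show ?thesis using False \<open>l \<in> L\<close> by simp
      qed
      then show ?thesis using rep_eq[OF g disjI1[OF refl]] rep[OF g] g by (simp add: \<chi>_def m_assoc)
    qed
  qed
qed

text \<open>For \<open>s = z a\<close> with \<open>z\<close> in \<open>F\<close> and
  \<open>a\<close> in \<open>E\<close>, \<open>z\<close> commutes with \<open>E\<close>, so
  reindexing by left or right multiplication with \<open>a\<close> turns both sums into
  \<open>sg a\<close> times the sum of \<open>sg x\<close> over the \<open>x\<close> with
  \<open>z x\<close> in \<open>P\<close>. Left and right projection to the sign functions therefore
  agree for subsets of \<open>L\<close>.\<close>

lemma sg_sum_L:
  assumes P: "P \<subseteq> L" and s: "s \<in> carrier G"
  shows "(\<Sum>x\<in>E. sg x * of_bool (x \<otimes> s \<in> P)) = (\<Sum>x\<in>E. sg x * of_bool (s \<otimes> x \<in> P))"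
    and "s \<notin> L \<Longrightarrow> (\<Sum>x\<in>E. sg x * of_bool (s \<otimes> x \<in> P)) = 0"
proof -
  have 0: "x \<otimes> s \<in> P \<Longrightarrow> s \<in> L" "s \<otimes> x \<in> P \<Longrightarrow> s \<in> L" if x: "x \<in> E" for x
  proof -
    have "x \<in> L" "inv x \<in> L" "x \<in> carrier G" using x E_L E_inv E_carrier by auto
    then show "s \<in> L" if "s \<otimes> x \<in> P"
      using L_cancel[OF s, of x] subsetD[OF P that] by simp
    assume "x \<otimes> s \<in> P"
    then have "inv x \<otimes> (x \<otimes> s) \<in> L" using L_mult[OF \<open>inv x \<in> L\<close>] subsetD[OF P] by simp
    then show "s \<in> L" using s \<open>x \<in> carrier G\<close> by (simp add: m_assoc[symmetric])
  qed
  then show "s \<notin> L \<Longrightarrow> (\<Sum>x\<in>E. sg x * of_bool (s \<otimes> x \<in> P)) = 0"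
    by (intro sum.neutral) auto
  show "(\<Sum>x\<in>E. sg x * of_bool (x \<otimes> s \<in> P)) = (\<Sum>x\<in>E. sg x * of_bool (s \<otimes> x \<in> P))"
  proof (cases "s \<in> L")
    case False
    then show ?thesis using 0 by (intro sum.cong refl) auto
  next
    case True
    then obtain z a where za: "s = z \<otimes> a" "z \<in> F" "a \<in> E" by (auto simp: L_def)
    note zc = F_carrier[OF za(2)] and ac = E_carrier[OF za(3)]
    have "(\<Sum>x\<in>E. sg x * of_bool (x \<otimes> s \<in> P)) =
        (\<Sum>x\<in>E. sg a * (sg (x \<otimes> a) * of_bool (z \<otimes> (x \<otimes> a) \<in> P)))"
    proof (rule sum.cong[OF refl])
      fix x assume x: "x \<in> E"
      have "x \<otimes> s = (x \<otimes> z) \<otimes> a" using za(1) zc ac E_carrier[OF x] by (simp add: m_assoc)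
      then have "x \<otimes> s = z \<otimes> (x \<otimes> a)"
        unfolding EF_comm[OF x za(2)] using zc ac E_carrier[OF x] by (simp add: m_assoc)
      then show "sg x * of_bool (x \<otimes> s \<in> P) = sg a * (sg (x \<otimes> a) * of_bool (z \<otimes> (x \<otimes> a) \<in> P))"
        by (simp add: sg_mult[OF x za(3)] mult.assoc sg_cancel)
    qed
    also have "\<dots> = (\<Sum>x\<in>E. sg a * (sg x * of_bool (z \<otimes> x \<in> P)))"
      by (rule sum.reindex_bij_betw[OF bij_right[OF za(3)]])
    also have "\<dots> = (\<Sum>x\<in>E. sg a * (sg (a \<otimes> x) * of_bool (z \<otimes> (a \<otimes> x) \<in> P)))"
      by (rule sum.reindex_bij_betw[OF bij_left[OF za(3)], symmetric])
    also have "\<dots> = (\<Sum>x\<in>E. sg x * of_bool (s \<otimes> x \<in> P))"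
    proof (rule sum.cong[OF refl])
      fix x assume x: "x \<in> E"
      have "z \<otimes> (a \<otimes> x) = s \<otimes> x" using za(1) zc ac E_carrier[OF x] by (simp add: m_assoc)
      then show "sg a * (sg (a \<otimes> x) * of_bool (z \<otimes> (a \<otimes> x) \<in> P)) = sg x * of_bool (s \<otimes> x \<in> P)"
        by (simp add: sg_mult[OF za(3) x] mult.assoc sg_cancel)
    qed
    finally show ?thesis .
  qed
qed

lemma c_invariant_iff:
  assumes "\<And>x. x \<in> D \<Longrightarrow> c \<otimes> x \<in> D" "\<And>x. x \<in> D \<Longrightarrow> x \<otimes> c \<in> D" and x: "x \<in> carrier G"
  shows "x \<otimes> c \<in> D \<longleftrightarrow> x \<in> D" "c \<otimes> x \<in> D \<longleftrightarrow> x \<in> D"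
proof -
  have "c \<otimes> (c \<otimes> x) = x" "x \<otimes> c \<otimes> c = x" using x by (simp_all add: absorb m_assoc cc)
  then show "x \<otimes> c \<in> D \<longleftrightarrow> x \<in> D" "c \<otimes> x \<in> D \<longleftrightarrow> x \<in> D" using assms(1,2) by metis+
qed

text \<open>The substitution of \<open>c x\<close> (or \<open>x c\<close>) for \<open>x\<close>
  preserves membership in \<open>D\<close> and reverses \<open>sg\<close>, so each sum equals its
  own negative.\<close>

lemma sg_sum_biinvariant:
  assumes D: "\<And>x. x \<in> D \<Longrightarrow> c \<otimes> x \<in> D" "\<And>x. x \<in> D \<Longrightarrow> x \<otimes> c \<in> D" and s: "s \<in> carrier G"
  shows "(\<Sum>x\<in>E. sg x * of_bool (x \<otimes> s \<in> D)) = 0" "(\<Sum>x\<in>E. sg x * of_bool (s \<otimes> x \<in> D)) = 0"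
proof -
  have cE: "c \<in> E" by (simp add: E_eq)
  note 1 = c_invariant_iff[of D, OF D]
  have "(\<Sum>x\<in>E. sg x * of_bool (x \<otimes> s \<in> D)) = (\<Sum>x\<in>E. sg (c \<otimes> x) * of_bool ((c \<otimes> x) \<otimes> s \<in> D))"
    by (rule sum.reindex_bij_betw[OF bij_left[OF cE], symmetric])
  also have "\<dots> = (\<Sum>x\<in>E. - (sg x * of_bool (x \<otimes> s \<in> D)))"
    using s E_carrier by (intro sum.cong) (auto simp: sg_c m_assoc 1)
  finally show "(\<Sum>x\<in>E. sg x * of_bool (x \<otimes> s \<in> D)) = 0" by (simp add: sum_negf)
  have "(\<Sum>x\<in>E. sg x * of_bool (s \<otimes> x \<in> D)) = (\<Sum>x\<in>E. sg (x \<otimes> c) * of_bool (s \<otimes> (x \<otimes> c) \<in> D))"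
    by (rule sum.reindex_bij_betw[OF bij_right[OF cE], symmetric])
  also have "\<dots> = (\<Sum>x\<in>E. - (sg x * of_bool (s \<otimes> x \<in> D)))"
    using s E_carrier by (intro sum.cong) (auto simp: sg_c m_assoc[symmetric] 1)
  finally show "(\<Sum>x\<in>E. sg x * of_bool (s \<otimes> x \<in> D)) = 0" by (simp add: sum_negf)
qed

lemma yE_iff:
  assumes "x \<in> E"
  shows "y \<otimes> x \<in> Y \<longleftrightarrow> x \<in> N" "y \<otimes> x \<in> Y' \<longleftrightarrow> x \<in> N'"
proof -
  have "y \<otimes> x = y \<otimes> x' \<longleftrightarrow> x = x'" if "x' \<in> E" for x'
    using assms that E_carrier by simp
  then show "y \<otimes> x \<in> Y \<longleftrightarrow> x \<in> N" "y \<otimes> x \<in> Y' \<longleftrightarrow> x \<in> N'"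
    by (auto simp: Y_def Y'_def E_def)
qed

lemma Y_E: "s \<in> Y \<or> s \<in> Y' \<Longrightarrow> \<exists>x\<in>E. s = y \<otimes> x"
  by (auto simp: Y_def Y'_def E_def)

text \<open>For \<open>s = y x\<close> the indicator of \<open>Y\<close> selects the three
  \<open>a\<close> with the sign of \<open>x\<close>, and that of \<open>Y'\<close> the three with
  the other sign. The resulting opposite values are what \<open>\<chi>\<close> compensates.\<close>

lemma sg_sum_Y:
  assumes s: "s \<in> carrier G"
  shows "x \<in> E \<Longrightarrow> s = y \<otimes> x \<Longrightarrow> (\<Sum>a\<in>E. sg a * of_bool (a \<otimes> s \<in> Y)) = 3 * sg x"
    and "x \<in> E \<Longrightarrow> s = y \<otimes> x \<Longrightarrow> (\<Sum>a\<in>E. sg a * of_bool (s \<otimes> a \<in> Y')) = - 3 * sg x"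
    and "\<forall>x\<in>E. s \<noteq> y \<otimes> x \<Longrightarrow> (\<Sum>a\<in>E. sg a * of_bool (a \<otimes> s \<in> Y)) = 0"
    and "\<forall>x\<in>E. s \<noteq> y \<otimes> x \<Longrightarrow> (\<Sum>a\<in>E. sg a * of_bool (s \<otimes> a \<in> Y')) = 0"
proof -
  have N: "a \<otimes> x \<in> N \<longleftrightarrow> sg a = sg x" "x \<otimes> a \<in> N' \<longleftrightarrow> sg a \<noteq> sg x"
    if "a \<in> E" "x \<in> E" for a x
  proof -
    have sN: "u \<in> N \<longleftrightarrow> sg u = 1" for u by (simp add: sg_def)
    have "sg a = 1 \<or> sg a = - 1" "sg x = 1 \<or> sg x = - 1" by (auto simp: sg_def)
    then show "a \<otimes> x \<in> N \<longleftrightarrow> sg a = sg x" "x \<otimes> a \<in> N' \<longleftrightarrow> sg a \<noteq> sg x"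
      using that E_mult[of x a] by (auto simp: N'_iff sN sg_mult)
  qed
  have sgE: "(\<Sum>a\<in>E. sg a * of_bool (sg a = sg x)) = 3 * sg x"
    "(\<Sum>a\<in>E. sg a * of_bool (sg a \<noteq> sg x)) = - 3 * sg x" for x
  proof -
    have "sg x = 1 \<or> sg x = - 1" by (auto simp: sg_def)
    then show "(\<Sum>a\<in>E. sg a * of_bool (sg a = sg x)) = 3 * sg x"
      "(\<Sum>a\<in>E. sg a * of_bool (sg a \<noteq> sg x)) = - 3 * sg x"
      by (auto simp: E_eq neqs sg_def N_def)
  qed
  show "(\<Sum>a\<in>E. sg a * of_bool (a \<otimes> s \<in> Y)) = 3 * sg x" if x: "x \<in> E" and "s = y \<otimes> x"
  proof -
    have "a \<otimes> s = y \<otimes> (a \<otimes> x)" if "a \<in> E" for a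
      using Ey_comm[OF that] E_carrier that x \<open>s = y \<otimes> x\<close> by (simp add: m_assoc[symmetric])
    then show ?thesis unfolding sgE(1)[symmetric]
      using x by (intro sum.cong) (auto simp: yE_iff E_mult N)
  qed
  show "(\<Sum>a\<in>E. sg a * of_bool (s \<otimes> a \<in> Y')) = - 3 * sg x" if x: "x \<in> E" and "s = y \<otimes> x"
  proof -
    have "s \<otimes> a = y \<otimes> (x \<otimes> a)" if "a \<in> E" for a
      using E_carrier that x \<open>s = y \<otimes> x\<close> by (simp add: m_assoc)
    then show ?thesis unfolding sgE(2)[symmetric]
      using x by (intro sum.cong) (auto simp: yE_iff E_mult N)
  qed
  assume no: "\<forall>x\<in>E. s \<noteq> y \<otimes> x"
  have "a \<otimes> s \<notin> Y" if a: "a \<in> E" for a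
  proof
    assume "a \<otimes> s \<in> Y"
    then obtain x where x: "x \<in> E" "a \<otimes> s = y \<otimes> x" using Y_E by blast
    have "s = inv a \<otimes> (a \<otimes> s)" using s E_carrier[OF a] by (simp add: m_assoc[symmetric])
    also have "\<dots> = y \<otimes> (inv a \<otimes> x)"
      unfolding x(2) using Ey_comm[OF E_inv[OF a]] E_carrier[OF a] E_carrier[OF x(1)]
      by (simp add: m_assoc[symmetric])
    finally show False using no E_mult[OF E_inv[OF a] x(1)] by blast
  qed
  then show "(\<Sum>a\<in>E. sg a * of_bool (a \<otimes> s \<in> Y)) = 0" by simp
  have "s \<otimes> a \<notin> Y'" if a: "a \<in> E" for a
  proof
    assume "s \<otimes> a \<in> Y'"
    then obtain x where x: "x \<in> E" "s \<otimes> a = y \<otimes> x" using Y_E by blast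
    have "s = (s \<otimes> a) \<otimes> inv a" using s E_carrier[OF a] by (simp add: m_assoc)
    also have "\<dots> = y \<otimes> (x \<otimes> inv a)"
      unfolding x(2) using E_carrier[OF a] E_carrier[OF x(1)] by (simp add: m_assoc)
    finally show False using no E_mult[OF x(1) E_inv[OF a]] by blast
  qed
  then show "(\<Sum>a\<in>E. sg a * of_bool (s \<otimes> a \<in> Y')) = 0" by simp
qed

end

section \<open>The two connection sets and their isospectrality\<close>

text \<open>Apart from its symmetry under \<open>c\<close>, \<open>D\<close> is prescribed only on
  \<open>L\<close>, on the translate of \<open>E\<close> by \<open>y\<close>, and on the further
  translates of that by \<open>Z\<close>. Outside these places the counts for the two graphs will
  turn out to agree.\<close>

locale switching_sets = switching +
  fixes f :: 'a and Z D :: "'a set"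
  assumes Z: "Z \<subseteq> F" and f: "f \<in> Z" and f_inv: "inv f \<in> Z" and D: "D \<subseteq> carrier G"
    and cD: "x \<in> D \<Longrightarrow> c \<otimes> x \<in> D" and Dc: "x \<in> D \<Longrightarrow> x \<otimes> c \<in> D"
    and D_L: "x \<in> L \<Longrightarrow> x \<notin> D" and D_yE: "x \<in> E \<Longrightarrow> y \<otimes> x \<notin> D"
    and D_yZ: "z \<in> Z \<Longrightarrow> x \<in> E \<Longrightarrow> z \<otimes> (y \<otimes> x) \<in> D \<longleftrightarrow> (z = f \<or> z = inv f) \<and> x \<in> Q"
begin

definition P :: "'a set" where "P = insert (w \<otimes> c) Z"
definition A :: "'a set" where "A = P \<union> Y \<union> D"
definition B :: "'a set" where "B = P \<union> Y' \<union> D"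

lemma P_L: "P \<subseteq> L"
  using Z F_L E_L by (auto simp: P_def E_eq)

lemma Y_carrier: "Y \<subseteq> carrier G" and Y'_carrier: "Y' \<subseteq> carrier G"
  by (auto simp: Y_def Y'_def N_def N'_def)

lemma P_carrier: "P \<subseteq> carrier G"
  using P_L L_carrier by blast

lemma A_carrier: "A \<subseteq> carrier G" and B_carrier: "B \<subseteq> carrier G"
  using P_carrier Y_carrier Y'_carrier D by (auto simp: A_def B_def)

lemma y_shift_notin_L: "s \<in> Y \<or> s \<in> Y' \<Longrightarrow> s \<notin> L"
  using Y_E yL_notin_L E_L by blast

lemma disjoint:
  "P \<inter> Y = {}" "P \<inter> Y' = {}" "P \<inter> D = {}" "Y \<inter> D = {}" "Y' \<inter> D = {}" "Y \<inter> Y' = {}"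
proof -
  show "P \<inter> Y = {}" "P \<inter> Y' = {}" using P_L y_shift_notin_L by blast+
  show "P \<inter> D = {}" using P_L D_L by blast
  show "Y \<inter> D = {}" "Y' \<inter> D = {}" using Y_E D_yE by blast+
  show "Y \<inter> Y' = {}" by (auto simp: Y_def Y'_def N_def N'_def neqs)
qed

lemma of_bool_A: "of_bool (s \<in> A) = of_bool (s \<in> P) + of_bool (s \<in> Y) + (of_bool (s \<in> D) :: 'n :: semiring_1)"
  and of_bool_B: "of_bool (s \<in> B) = of_bool (s \<in> P) + of_bool (s \<in> Y') + (of_bool (s \<in> D) :: 'n :: semiring_1)"
  using disjoint by (auto simp: A_def B_def)

theorem isospectral_A_B: "isospectral (Cayley_graph G A) (Cayley_graph G B)"
proof -
  obtain \<chi> :: "'a \<Rightarrow> complex" where \<chi>: "\<And>g. g \<in> carrier G \<Longrightarrow> \<chi> g * \<chi> g = 1"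
    "\<And>g a. g \<in> carrier G \<Longrightarrow> a \<in> L \<Longrightarrow> \<chi> (g \<otimes> a) = \<chi> g"
    "\<And>g. g \<in> carrier G \<Longrightarrow> \<chi> (g \<otimes> y) = - \<chi> g"
    using parity_character by blast
  have LA: "(\<Sum>x\<in>E. sg x * of_bool (x \<otimes> s \<in> A)) =
      (\<Sum>x\<in>E. sg x * of_bool (s \<otimes> x \<in> P)) + (\<Sum>x\<in>E. sg x * of_bool (x \<otimes> s \<in> Y))"
    if s: "s \<in> carrier G" for s
    using sg_sum_L(1)[OF P_L s] sg_sum_biinvariant(1)[OF cD Dc s]
    by (simp add: of_bool_A distrib_left sum.distrib)
  have RB: "(\<Sum>x\<in>E. sg x * of_bool (s \<otimes> x \<in> B)) =
      (\<Sum>x\<in>E. sg x * of_bool (s \<otimes> x \<in> P)) + (\<Sum>x\<in>E. sg x * of_bool (s \<otimes> x \<in> Y'))"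
    if s: "s \<in> carrier G" for s
    using sg_sum_biinvariant(2)[OF cD Dc s]
    by (simp add: of_bool_B distrib_left sum.distrib)
  show ?thesis
  proof (rule isospectral_Cayley_twist[OF fin subgroup_E A_carrier B_carrier sg_mult sg_sq \<chi>(1)])
    show "\<chi> (g \<otimes> x) = \<chi> g" if "g \<in> carrier G" "x \<in> E" for g x using \<chi>(2) E_L that by blast
    show "of_bool (s \<in> A) - (\<Sum>x\<in>E. sg x * of_bool (x \<otimes> s \<in> A)) / card E =
        of_bool (s \<in> B) - (\<Sum>x\<in>E. sg x * of_bool (s \<otimes> x \<in> B)) / card E"
      if s: "s \<in> carrier G" for s
    proof (cases "\<exists>x\<in>E. s = y \<otimes> x")
      case True
      then obtain x where x: "x \<in> E" "s = y \<otimes> x" by blast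
      \<comment> \<open>As \<open>card E = 6\<close>, the averages over \<open>E\<close> are
        \<open>sg x / 2\<close> and \<open>- sg x / 2\<close>; their difference is exactly this
        difference of indicators.\<close>
      have sg_x: "of_bool (s \<in> Y) - of_bool (s \<in> Y') = sg x"
        using x(1) unfolding x(2) by (simp add: yE_iff N'_iff sg_def)
      show ?thesis
        unfolding LA[OF s] RB[OF s] sg_sum_Y(1)[OF s x] sg_sum_Y(2)[OF s x] of_bool_A[of s] of_bool_B[of s] card_E
        using sg_x by (simp add: field_simps)
    next
      case False
      then have "s \<notin> Y" "s \<notin> Y'" using Y_E by blast+
      then show ?thesis
        unfolding LA[OF s] RB[OF s] of_bool_A[of s] of_bool_B[of s] using False sg_sum_Y(3,4)[OF s] by simp
    qed
    show "\<chi> g * (\<Sum>x\<in>E. sg x * of_bool (x \<otimes> s \<in> A)) =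
        \<chi> (g \<otimes> s) * (\<Sum>x\<in>E. sg x * of_bool (s \<otimes> x \<in> B))"
      if g: "g \<in> carrier G" and s: "s \<in> carrier G" for g s
    proof (cases "\<exists>x\<in>E. s = y \<otimes> x")
      case True
      then obtain x where x: "x \<in> E" "s = y \<otimes> x" by blast
      then have "s \<notin> L" using yL_notin_L E_L by blast
      moreover have "\<chi> (g \<otimes> s) = - \<chi> g"
        using \<chi>(2)[of "g \<otimes> y" x] \<chi>(3)[OF g] x g E_L E_carrier by (simp add: m_assoc)
      ultimately show ?thesis
        unfolding LA[OF s] RB[OF s] sg_sum_Y(1)[OF s x] sg_sum_Y(2)[OF s x]
        using sg_sum_L(2)[OF P_L s] by simp
    next
      \<comment> \<open>Here only \<open>P\<close> contributes, and only for \<open>s\<close> in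
        \<open>L\<close>, where \<open>\<chi>\<close> does not change.\<close>
      case False
      then show ?thesis
        unfolding LA[OF s] RB[OF s] using sg_sum_Y(3,4)[OF s] sg_sum_L(2)[OF P_L s] \<chi>(2)[OF g, of s]
        by (cases "s \<in> L") auto
    qed
  qed
qed

end

section \<open>Non-isomorphism\<close>

(* The rule would turn the indicator sums below into cardinalities of comprehensions. *)
declare sum_of_bool_eq [simp del]

section \<open>A vertex-local isomorphism invariant of Cayley graphs\<close>

context group
begin

text \<open>For \<open>S = T\<close> this is the number of walks of two arcs from \<open>g\<close>
  to \<open>g \<otimes> s\<close> in the Cayley graph. It is integer-valued because differences
  between the two graphs have either sign.\<close>

definition cv :: "'a set \<Rightarrow> 'a set \<Rightarrow> 'a \<Rightarrow> int" where
  "cv S T s = (\<Sum>u\<in>S. \<Sum>v\<in>T. of_bool (u \<otimes> v = s))"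

lemma cv_left:
  assumes "finite T" "S \<subseteq> carrier G" "T \<subseteq> carrier G" "s \<in> carrier G"
  shows "cv S T s = (\<Sum>u\<in>S. of_bool (inv u \<otimes> s \<in> T))"
  unfolding cv_def
proof (rule sum.cong[OF refl])
  fix u assume "u \<in> S"
  then have u: "u \<in> carrier G" using assms by blast
  have "(\<Sum>v\<in>T. of_bool (u \<otimes> v = s)) = (\<Sum>v\<in>T. if v = inv u \<otimes> s then 1 else 0 :: int)"
  proof (rule sum.cong[OF refl])
    fix v assume "v \<in> T"
    then have v: "v \<in> carrier G" using assms by blast
    have "u \<otimes> v = s \<longleftrightarrow> v = inv u \<otimes> s"
      using u v assms(4) by (metis inv_solve_left)
    then show "of_bool (u \<otimes> v = s) = (if v = inv u \<otimes> s then 1 else 0 :: int)" by simp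
  qed
  then show "(\<Sum>v\<in>T. of_bool (u \<otimes> v = s)) = (of_bool (inv u \<otimes> s \<in> T) :: int)"
    using assms(1) by simp
qed

lemma cv_right:
  assumes "finite S" "S \<subseteq> carrier G" "T \<subseteq> carrier G" "s \<in> carrier G"
  shows "cv S T s = (\<Sum>v\<in>T. of_bool (s \<otimes> inv v \<in> S))"
  unfolding cv_def
proof (subst sum.swap, rule sum.cong[OF refl])
  fix v assume "v \<in> T"
  then have v: "v \<in> carrier G" using assms by blast
  have "(\<Sum>u\<in>S. of_bool (u \<otimes> v = s)) = (\<Sum>u\<in>S. if u = s \<otimes> inv v then 1 else 0 :: int)"
  proof (rule sum.cong[OF refl])
    fix u assume "u \<in> S"
    then have u: "u \<in> carrier G" using assms by blast
    have "u \<otimes> v = s \<longleftrightarrow> u = s \<otimes> inv v"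
      using u v assms(4) by (metis inv_solve_right)
    then show "of_bool (u \<otimes> v = s) = (if u = s \<otimes> inv v then 1 else 0 :: int)" by simp
  qed
  then show "(\<Sum>u\<in>S. of_bool (u \<otimes> v = s)) = (of_bool (s \<otimes> inv v \<in> S) :: int)"
    using assms(1) by simp
qed

lemma cv_union:
  assumes "finite S" "finite S'" "S \<inter> S' = {}"
  shows "cv (S \<union> S') T s = cv S T s + cv S' T s" "cv T (S \<union> S') s = cv T S s + cv T S' s"
  using assms by (simp_all add: cv_def sum.union_disjoint sum.distrib)

lemma Cayley_sum_arcs:
  fixes h :: "'a \<Rightarrow> int"
  assumes "finite (carrier G)" "S \<subseteq> carrier G" "g \<in> carrier G"
  shows "(\<Sum>x\<in>carrier G. of_bool ((g, x) \<in> parcs (Cayley_graph G S)) * h x) = (\<Sum>s\<in>S. h (g \<otimes> s))"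
proof -
  have "bij_betw (\<lambda>s. g \<otimes> s) S {x \<in> carrier G. inv g \<otimes> x \<in> S}"
    using assms by (intro bij_betwI[where g = "\<lambda>x. inv g \<otimes> x"]) (auto simp: m_assoc[symmetric])
  from sum.reindex_bij_betw[OF this, of h]
  have "(\<Sum>s\<in>S. h (g \<otimes> s)) = (\<Sum>x\<in>{x \<in> carrier G. inv g \<otimes> x \<in> S}. h x)" .
  also have "\<dots> = (\<Sum>x\<in>carrier G. of_bool ((g, x) \<in> parcs (Cayley_graph G S)) * h x)"
    using assms by (intro sum.mono_neutral_cong_left) (auto simp: Cayley_arc_iff)
  finally show ?thesis ..
qed

lemma cubed_common_neighbours:
  assumes fin: "finite (carrier G)" and S: "S \<subseteq> carrier G" and g: "g \<in> carrier G"
  shows "(\<Sum>h\<in>carrier G. of_bool ((g, h) \<in> parcs (Cayley_graph G S)) *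
      (\<Sum>x\<in>carrier G. of_bool ((g, x) \<in> parcs (Cayley_graph G S)) *
        of_bool ((x, h) \<in> parcs (Cayley_graph G S))) ^ 3) = (\<Sum>s\<in>S. cv S S s ^ 3)"
  unfolding Cayley_sum_arcs[OF fin S g]
proof (rule sum.cong[OF refl])
  fix s assume "s \<in> S"
  then have s: "s \<in> carrier G" using S by blast
  have "(\<Sum>u\<in>S. of_bool ((g \<otimes> u, g \<otimes> s) \<in> parcs (Cayley_graph G S))) = (cv S S s :: int)"
    unfolding cv_left[OF finite_subset[OF S fin] S S s]
  proof (rule sum.cong[OF refl])
    fix u assume "u \<in> S"
    then have u: "u \<in> carrier G" using S by blast
    have "inv g \<otimes> (g \<otimes> s) = s" using g s by (simp add: m_assoc[symmetric])
    then have "inv (g \<otimes> u) \<otimes> (g \<otimes> s) = inv u \<otimes> s" using g s u by (simp add: inv_mult_group m_assoc)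
    then show "of_bool ((g \<otimes> u, g \<otimes> s) \<in> parcs (Cayley_graph G S)) = (of_bool (inv u \<otimes> s \<in> S) :: int)"
      using Cayley_arc_iff[OF _ _ S, of "g \<otimes> u" "g \<otimes> s"] g u s by simp
  qed
  then show "(\<Sum>u\<in>S. of_bool ((g \<otimes> u, g \<otimes> s) \<in> parcs (Cayley_graph G S))) ^ 3 = cv S S s ^ 3"
    by simp
qed

text \<open>The isomorphism may move the identity, but \<open>cubed_common_neighbours\<close> gives
  the same value at every base vertex, so the image of the identity serves as well.\<close>

lemma Cayley_iso_invariant:
  assumes fin: "finite (carrier G)" and S: "S \<subseteq> carrier G" and T: "T \<subseteq> carrier G"
    and iso: "digraph_iso (with_proj (Cayley_graph G S)) (with_proj (Cayley_graph G T))"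
  shows "(\<Sum>s\<in>S. cv S S s ^ 3) = (\<Sum>s\<in>T. cv T T s ^ 3)"
proof -
  let ?A = "\<lambda>S p. of_bool (p \<in> parcs (Cayley_graph G S)) :: int"
  have "\<exists>\<phi>. bij_betw \<phi> (carrier G) (carrier G) \<and> (\<forall>u\<in>carrier G. \<forall>v\<in>carrier G.
      (u, v) \<in> parcs (Cayley_graph G S) \<longleftrightarrow> (\<phi> u, \<phi> v) \<in> parcs (Cayley_graph G T))"
    using iso S T unfolding digraph_iso_with_proj_iff[OF wf_Cayley_graph[OF is_group S]
        wf_Cayley_graph[OF is_group T]]
    by (simp add: Cayley_graph_def)
  then obtain \<phi> where \<phi>: "bij_betw \<phi> (carrier G) (carrier G)"
    and arc: "\<And>u v. u \<in> carrier G \<Longrightarrow> v \<in> carrier G \<Longrightarrow> ?A S (u, v) = ?A T (\<phi> u, \<phi> v)"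
    by auto
  have \<phi>1: "\<phi> \<one> \<in> carrier G" using \<phi> bij_betwE by blast
  have "(\<Sum>s\<in>S. cv S S s ^ 3) =
      (\<Sum>h\<in>carrier G. ?A S (\<one>, h) * (\<Sum>x\<in>carrier G. ?A S (\<one>, x) * ?A S (x, h)) ^ 3)"
    by (rule cubed_common_neighbours[OF fin S one_closed, symmetric])
  also have "\<dots> = (\<Sum>h\<in>carrier G. ?A T (\<phi> \<one>, \<phi> h) *
      (\<Sum>x\<in>carrier G. ?A T (\<phi> \<one>, \<phi> x) * ?A T (\<phi> x, \<phi> h)) ^ 3)"
    by (intro sum.cong arg_cong2[where f = "(*)"] arg_cong[where f = "\<lambda>t. t ^ 3"] refl arc one_closed)
  also have "\<dots> = (\<Sum>h\<in>carrier G. ?A T (\<phi> \<one>, \<phi> h) *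
      (\<Sum>x\<in>carrier G. ?A T (\<phi> \<one>, x) * ?A T (x, \<phi> h)) ^ 3)"
    by (intro sum.cong arg_cong2[where f = "(*)"] arg_cong[where f = "\<lambda>t. t ^ 3"] refl
        sum.reindex_bij_betw[OF \<phi>])
  also have "\<dots> = (\<Sum>h\<in>carrier G. ?A T (\<phi> \<one>, h) *
      (\<Sum>x\<in>carrier G. ?A T (\<phi> \<one>, x) * ?A T (x, h)) ^ 3)"
    by (rule sum.reindex_bij_betw[OF \<phi>])
  also have "\<dots> = (\<Sum>s\<in>T. cv T T s ^ 3)" by (rule cubed_common_neighbours[OF fin T \<phi>1])
  finally show ?thesis .
qed

end

section \<open>Comparison of the counts for \<open>A\<close> and \<open>B\<close>\<close>

context switching_sets
begin

text \<open>The parts of \<open>cv P T s\<close> and \<open>cv T P s\<close> that come from the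
  factors in \<open>Z\<close>; the remaining factor \<open>w c\<close> is split off in
  \<open>cv_P\<close>.\<close>

definition Zl :: "'a set \<Rightarrow> 'a \<Rightarrow> int" where "Zl T s = (\<Sum>z\<in>Z. of_bool (inv z \<otimes> s \<in> T))"
definition Zr :: "'a set \<Rightarrow> 'a \<Rightarrow> int" where "Zr T s = (\<Sum>z\<in>Z. of_bool (s \<otimes> inv z \<in> T))"

lemma Z_carrier: "z \<in> Z \<Longrightarrow> z \<in> carrier G"
  using Z F_carrier by blast

lemma Z_inv: "z \<in> Z \<Longrightarrow> inv z \<in> F"
  using Z subgroup.m_inv_closed[OF F] by blast

lemma finites: "finite P" "finite Y" "finite Y'" "finite D" "finite Z"
  using finite_subset[OF P_carrier fin] finite_subset[OF Y_carrier fin]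
    finite_subset[OF Y'_carrier fin] finite_subset[OF D fin]
    finite_subset[of Z "carrier G"] fin Z_carrier by blast+

lemma r_notin_Z: "w \<otimes> c \<notin> Z"
  using Z E_F[of "w \<otimes> c"] by (auto simp: E_eq neqs)

lemma inv_r: "inv (w \<otimes> c) = w \<otimes> c"
  by (rule inv_equality) (simp_all add: word_simps)

lemma cv_P:
  assumes T: "T \<subseteq> carrier G" and s: "s \<in> carrier G"
  shows "cv P T s = of_bool (w \<otimes> (c \<otimes> s) \<in> T) + Zl T s"
    and "cv T P s = of_bool (s \<otimes> (w \<otimes> c) \<in> T) + Zr T s"
proof -
  have fT: "finite T" using T fin finite_subset by blast
  show "cv P T s = of_bool (w \<otimes> (c \<otimes> s) \<in> T) + Zl T s"
    unfolding cv_left[OF fT P_carrier T s] Zl_def unfolding P_def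
    using r_notin_Z finites(5) s by (simp add: inv_r m_assoc)
  show "cv T P s = of_bool (s \<otimes> (w \<otimes> c) \<in> T) + Zr T s"
    unfolding cv_right[OF fT T P_carrier s] Zr_def unfolding P_def
    using r_notin_Z finites(5) s by (simp add: inv_r)
qed

lemma inj_c: "inj_on (\<lambda>u. u \<otimes> c) (carrier G)" "inj_on (\<lambda>u. c \<otimes> u) (carrier G)"
  by (auto intro!: inj_onI)

text \<open>As \<open>c\<close> is an involution, it can be inserted twice in the middle of a
  factorisation, or multiplied onto either end.\<close>

lemma cv_shift:
  assumes S: "S \<subseteq> carrier G" and T: "T \<subseteq> carrier G" and s: "s \<in> carrier G"
  shows "cv ((\<lambda>u. u \<otimes> c) ` S) ((\<lambda>v. c \<otimes> v) ` T) s = cv S T s"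
    and "cv S ((\<lambda>v. v \<otimes> c) ` T) (s \<otimes> c) = cv S T s"
    and "cv ((\<lambda>u. c \<otimes> u) ` S) T (c \<otimes> s) = cv S T s"
proof -
  note inj = inj_on_subset[OF inj_c(1) S] inj_on_subset[OF inj_c(2) S]
    inj_on_subset[OF inj_c(1) T] inj_on_subset[OF inj_c(2) T]
  have SC: "u \<in> carrier G" if "u \<in> S" for u using S that by blast
  have TC: "u \<in> carrier G" if "u \<in> T" for u using T that by blast
  show "cv ((\<lambda>u. u \<otimes> c) ` S) ((\<lambda>v. c \<otimes> v) ` T) s = cv S T s"
    unfolding cv_def sum.reindex[OF inj(1)] sum.reindex[OF inj(4)] o_def
    by (intro sum.cong refl) (simp add: SC TC m_assoc absorb)
  show "cv S ((\<lambda>v. v \<otimes> c) ` T) (s \<otimes> c) = cv S T s"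
    unfolding cv_def sum.reindex[OF inj(3)] o_def
    by (intro sum.cong refl) (simp add: SC TC s m_assoc[symmetric])
  show "cv ((\<lambda>u. c \<otimes> u) ` S) T (c \<otimes> s) = cv S T s"
    unfolding cv_def sum.reindex[OF inj(2)] o_def
    by (intro sum.cong refl) (simp add: SC TC s m_assoc)
qed

lemma D_images: "(\<lambda>u. u \<otimes> c) ` D = D" "(\<lambda>u. c \<otimes> u) ` D = D"
proof -
  have 1: "x = c \<otimes> (c \<otimes> x)" "x = (x \<otimes> c) \<otimes> c" if "x \<in> D" for x
    using that D by (auto simp: absorb m_assoc cc)
  show "(\<lambda>u. u \<otimes> c) ` D = D" using 1(2) Dc by (intro equalityI subsetI) blast+
  show "(\<lambda>u. c \<otimes> u) ` D = D" using 1(1) cD by (intro equalityI subsetI) blast+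
qed

lemma Y_images: "(\<lambda>u. u \<otimes> c) ` Y = Y'" "(\<lambda>u. c \<otimes> u) ` Y = Y'"
proof -
  show "(\<lambda>u. u \<otimes> c) ` Y = Y'" "(\<lambda>u. c \<otimes> u) ` Y = Y'"
    unfolding Y_eq by (auto simp: word_simps)
qed

lemmas D_c_iff = c_invariant_iff[of D, OF cD Dc]

lemma cv_expand:
  assumes "T = Y \<or> T = Y'"
  shows "cv (P \<union> T \<union> D) (P \<union> T \<union> D) s = cv P P s + cv P T s + cv P D s + cv T P s + cv T T s +
    cv T D s + cv D P s + cv D T s + cv D D s"
proof -
  have "finite T" "P \<inter> T = {}" "(P \<union> T) \<inter> D = {}" using assms finites disjoint by auto
  then show ?thesis using finites by (simp add: cv_union)
qed

text \<open>The reflection \<open>w c\<close> interchanges the two cosets \<open>N\<close> and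
  \<open>N'\<close>; this is one of the two ways in which \<open>P\<close> distinguishes
  \<open>Y\<close> from \<open>Y'\<close>.\<close>

lemma rY_iff:
  assumes s: "s \<in> carrier G"
  shows "w \<otimes> (c \<otimes> s) \<in> Y \<longleftrightarrow> s \<in> Y'" "w \<otimes> (c \<otimes> s) \<in> Y' \<longleftrightarrow> s \<in> Y"
    "s \<otimes> (w \<otimes> c) \<in> Y \<longleftrightarrow> s \<in> Y'" "s \<otimes> (w \<otimes> c) \<in> Y' \<longleftrightarrow> s \<in> Y"
proof -
  have l: "w \<otimes> (c \<otimes> u) \<in> Y' \<and> u \<otimes> (w \<otimes> c) \<in> Y'" if "u \<in> Y" for u
    using that unfolding Y_eq by (auto simp: word_simps)
  have l': "w \<otimes> (c \<otimes> u) \<in> Y \<and> u \<otimes> (w \<otimes> c) \<in> Y" if "u \<in> Y'" for u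
    using that unfolding Y_eq by (auto simp: word_simps)
  have s2: "w \<otimes> (c \<otimes> (w \<otimes> (c \<otimes> s))) = s" "(s \<otimes> (w \<otimes> c)) \<otimes> (w \<otimes> c) = s"
    using s by (simp_all add: word_simps)
  show "w \<otimes> (c \<otimes> s) \<in> Y \<longleftrightarrow> s \<in> Y'" "w \<otimes> (c \<otimes> s) \<in> Y' \<longleftrightarrow> s \<in> Y"
    "s \<otimes> (w \<otimes> c) \<in> Y \<longleftrightarrow> s \<in> Y'" "s \<otimes> (w \<otimes> c) \<in> Y' \<longleftrightarrow> s \<in> Y"
    using l[of s] l'[of s] l[of "w \<otimes> (c \<otimes> s)"] l'[of "w \<otimes> (c \<otimes> s)"]
      l[of "s \<otimes> (w \<otimes> c)"] l'[of "s \<otimes> (w \<otimes> c)"] unfolding s2 by blast+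
qed

lemma Zr_Y: "s \<in> carrier G \<Longrightarrow> T = Y \<or> T = Y' \<Longrightarrow> Zr T s = Zl T s"
proof -
  assume s: "s \<in> carrier G" and T: "T = Y \<or> T = Y'"
  have "s \<otimes> inv z \<in> T \<longleftrightarrow> inv z \<otimes> s \<in> T" if z: "z \<in> Z" for z
  proof -
    have comm: "z \<otimes> u = u \<otimes> z" "u \<in> carrier G" if "u \<in> T" for u
    proof -
      obtain x where x: "x \<in> E" "u = y \<otimes> x" using T Y_E \<open>u \<in> T\<close> by blast
      then show "u \<in> carrier G" using E_carrier by simp
      have zF: "z \<in> F" using z Z by blast
      have "z \<otimes> u = (z \<otimes> y) \<otimes> x" using x E_carrier Z_carrier[OF z] by (simp add: m_assoc)
      also have "\<dots> = y \<otimes> (z \<otimes> x)" unfolding yF[OF zF] using x E_carrier Z_carrier[OF z] by (simp add: m_assoc)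
      also have "\<dots> = u \<otimes> z" unfolding EF_comm[OF x(1) zF, symmetric]
        using x E_carrier Z_carrier[OF z] by (simp add: m_assoc)
      finally show "z \<otimes> u = u \<otimes> z" .
    qed
    have zc: "z \<in> carrier G" using Z_carrier z .
    show ?thesis
    proof
      assume "s \<otimes> inv z \<in> T"
      from comm[OF this] have "z \<otimes> (s \<otimes> inv z) = s" using s zc by (simp add: m_assoc)
      then have "inv z \<otimes> s = inv z \<otimes> (z \<otimes> (s \<otimes> inv z))" by simp
      also have "\<dots> = s \<otimes> inv z" using s zc by (simp add: m_assoc[symmetric])
      finally show "inv z \<otimes> s \<in> T" using \<open>s \<otimes> inv z \<in> T\<close> by simp
    next
      assume "inv z \<otimes> s \<in> T"
      from comm[OF this] have "(inv z \<otimes> s) \<otimes> z = s" using s zc by (simp add: m_assoc[symmetric])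
      then have "s \<otimes> inv z = ((inv z \<otimes> s) \<otimes> z) \<otimes> inv z" by simp
      also have "\<dots> = inv z \<otimes> s" using s zc by (simp add: m_assoc)
      finally show "s \<otimes> inv z \<in> T" using \<open>inv z \<otimes> s \<in> T\<close> by simp
    qed
  qed
  then show ?thesis unfolding Zr_def Zl_def by (intro sum.cong) auto
qed

lemma cv_PY:
  assumes "s \<in> carrier G"
  shows "cv P Y s = of_bool (s \<in> Y') + Zl Y s" "cv Y P s = of_bool (s \<in> Y') + Zl Y s"
    "cv P Y' s = of_bool (s \<in> Y) + Zl Y' s" "cv Y' P s = of_bool (s \<in> Y) + Zl Y' s"
  using assms Zr_Y by (simp_all add: cv_P Y_carrier Y'_carrier rY_iff)

text \<open>\<open>Y'\<close> is both \<open>Y c\<close> and \<open>c Y\<close>, while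
  \<open>D\<close> absorbs \<open>c\<close>; inserting \<open>c c\<close> between the factors
  therefore changes \<open>Y\<close> to \<open>Y'\<close> at no cost.\<close>

lemma cv_Y':
  assumes "s \<in> carrier G"
  shows "cv Y' Y' s = cv Y Y s" "cv Y' D s = cv Y D s" "cv D Y' s = cv D Y s"
  using cv_shift(1)[OF Y_carrier Y_carrier assms] cv_shift(1)[OF Y_carrier D assms]
    cv_shift(1)[OF D Y_carrier assms]
  unfolding Y_images D_images by blast+

text \<open>By \<open>cv_Y'\<close> all products without \<open>P\<close> agree. What is left are
  the products of \<open>P\<close> with \<open>Y\<close> and with \<open>Y'\<close>, and the factor
  2 accounts for the two orders.\<close>

lemma cv_B_eq:
  assumes "s \<in> carrier G"
  shows "cv B B s = cv A A s + 2 * (of_bool (s \<in> Y) - of_bool (s \<in> Y')) + 2 * (Zl Y' s - Zl Y s)"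
proof -
  have "cv A A s = cv P P s + cv P Y s + cv P D s + cv Y P s + cv Y Y s +
    cv Y D s + cv D P s + cv D Y s + cv D D s"
    unfolding A_def by (rule cv_expand) simp
  moreover have "cv B B s = cv P P s + cv P Y' s + cv P D s + cv Y' P s + cv Y' Y' s +
    cv Y' D s + cv D P s + cv D Y' s + cv D D s"
    unfolding B_def by (rule cv_expand) simp
  ultimately show ?thesis by (simp add: cv_PY[OF assms] cv_Y'[OF assms])
qed

text \<open>A parity argument for the index-2 subgroup \<open>L\<close> of \<open>H\<close>: two
  factors from the same coset of \<open>L\<close> in \<open>H\<close> have their product in
  \<open>L\<close>, and a factorisation of an element of \<open>y L\<close> with one factor in
  \<open>Y\<close> would force the other into \<open>L\<close>, which \<open>D\<close>
  avoids.\<close>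

lemma cv_support:
  assumes s: "s \<in> carrier G"
  shows "s \<notin> L \<Longrightarrow> cv P P s = 0" "s \<notin> L \<Longrightarrow> cv Y Y s = 0"
    and "z \<in> L \<Longrightarrow> s = y \<otimes> z \<Longrightarrow> cv Y D s = 0" "z \<in> L \<Longrightarrow> s = y \<otimes> z \<Longrightarrow> cv D Y s = 0"
proof -
  show "cv P P s = 0" if "s \<notin> L"
  proof -
    have "u \<otimes> v \<noteq> s" if "u \<in> P" "v \<in> P" for u v using L_mult P_L that \<open>s \<notin> L\<close> by blast
    then show ?thesis by (simp add: cv_def)
  qed
  have YY: "u \<otimes> v \<in> L" if "u \<in> Y" "v = y \<otimes> z" "z \<in> L" for u v z
  proof -
    obtain x where x: "x \<in> E" "u = y \<otimes> x" using Y_E \<open>u \<in> Y\<close> by blast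
    have "u \<otimes> v = (x \<otimes> y) \<otimes> (y \<otimes> z)"
      using that x E_carrier L_carrier Ey_comm[OF x(1)] by simp
    also have "\<dots> = x \<otimes> z" using x E_carrier L_carrier[OF \<open>z \<in> L\<close>] by (simp add: m_assoc absorb)
    finally show ?thesis using L_mult E_L x that by simp
  qed
  show "cv Y Y s = 0" if "s \<notin> L"
  proof -
    have "u \<otimes> v \<noteq> s" if "u \<in> Y" "v \<in> Y" for u v
      using YY[OF that(1)] Y_E[of v] that(2) E_L \<open>s \<notin> L\<close> by blast
    then show ?thesis by (simp add: cv_def)
  qed
  assume z: "z \<in> L" and sz: "s = y \<otimes> z"
  have "inv u \<otimes> s \<notin> D" if "u \<in> Y" for u
    using YY[OF inv_Y(1)[OF that] sz z] D_L by blast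
  then show "cv Y D s = 0" by (simp add: cv_left[OF finites(4) Y_carrier D s])
  have "s \<otimes> inv v \<notin> D" if v: "v \<in> Y" for v
  proof -
    obtain x where x: "x \<in> E" "inv v = y \<otimes> x" using Y_E inv_Y(1)[OF v] by blast
    have "s \<otimes> inv v = (z \<otimes> y) \<otimes> (y \<otimes> x)" unfolding sz x(2) Ly_comm[OF z] ..
    also have "\<dots> = z \<otimes> x" using x E_carrier L_carrier[OF z] by (simp add: m_assoc absorb)
    finally show ?thesis using L_mult[OF z E_L[OF x(1)]] D_L by simp
  qed
  then show "cv D Y s = 0" by (simp add: cv_right[OF finites(4) D Y_carrier s])
qed

lemma Zl_L:
  assumes "s \<in> L"
  shows "Zl Y s = 0" "Zl Y' s = 0"
proof -
  have "inv z \<otimes> s \<in> L" if "z \<in> Z" for z using L_mult[OF F_L[OF Z_inv[OF that]] assms] .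
  then have "inv z \<otimes> s \<notin> Y" "inv z \<otimes> s \<notin> Y'" if "z \<in> Z" for z
    using that y_shift_notin_L by blast+
  then show "Zl Y s = 0" "Zl Y' s = 0" by (simp_all add: Zl_def)
qed

lemma Zl_D:
  assumes "s \<in> D" "\<And>z x. z \<in> {f, inv f} \<Longrightarrow> x \<in> Q \<Longrightarrow> s \<noteq> z \<otimes> (y \<otimes> x)"
  shows "Zl Y s = 0" "Zl Y' s = 0"
proof -
  have "\<not> (inv z \<otimes> s \<in> Y \<or> inv z \<otimes> s \<in> Y')" if z: "z \<in> Z" for z
  proof
    assume "inv z \<otimes> s \<in> Y \<or> inv z \<otimes> s \<in> Y'"
    then obtain x where x: "x \<in> E" "inv z \<otimes> s = y \<otimes> x" using Y_E by blast
    have "s = z \<otimes> (inv z \<otimes> s)" using Z_carrier[OF z] D assms(1) by (auto simp: m_assoc[symmetric])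
    then have "s = z \<otimes> (y \<otimes> x)" using x by simp
    then show False using D_yZ[OF z x(1)] assms by blast
  qed
  then show "Zl Y s = 0" "Zl Y' s = 0" by (simp_all add: Zl_def)
qed

text \<open>By \<open>zyx_inj\<close> the only factor of \<open>Z\<close> that can contribute is
  \<open>z\<close> itself.\<close>

lemma Zl_zyx:
  assumes z: "z \<in> Z" and x: "x \<in> E"
  shows "Zl Y (z \<otimes> (y \<otimes> x)) = of_bool (x \<in> N)" "Zl Y' (z \<otimes> (y \<otimes> x)) = of_bool (x \<in> N')"
proof -
  have xc: "x \<in> carrier G" and zc: "z \<in> carrier G" using E_carrier x Z_carrier z by auto
  have key: "inv z' \<otimes> (z \<otimes> (y \<otimes> x)) \<in> T \<longleftrightarrow> z' = z \<and> y \<otimes> x \<in> T"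
    if z': "z' \<in> Z" and T: "T = Y \<or> T = Y'" for z' T
  proof (cases "z' = z")
    case True
    then show ?thesis using xc zc by (simp add: m_assoc[symmetric])
  next
    case False
    have z'c: "z' \<in> carrier G" using Z_carrier z' .
    have "inv z' \<otimes> (z \<otimes> (y \<otimes> x)) \<notin> T"
    proof
      assume "inv z' \<otimes> (z \<otimes> (y \<otimes> x)) \<in> T"
      then obtain x' where x': "x' \<in> E" "inv z' \<otimes> (z \<otimes> (y \<otimes> x)) = y \<otimes> x'" using Y_E T by blast
      have "z \<otimes> (y \<otimes> x) = z' \<otimes> (inv z' \<otimes> (z \<otimes> (y \<otimes> x)))"
        using xc zc z'c by (simp add: m_assoc[symmetric])
      also have "\<dots> = z' \<otimes> (y \<otimes> x')" unfolding x'(2) ..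
      finally have "z = z'" by (rule zyx_inj(1)[OF subsetD[OF Z z] subsetD[OF Z z'] x x'(1)])
      then show False using False by simp
    qed
    then show ?thesis using False by simp
  qed
  have "(\<Sum>z'\<in>Z. of_bool (inv z' \<otimes> (z \<otimes> (y \<otimes> x)) \<in> T)) = (of_bool (y \<otimes> x \<in> T) :: int)"
    if "T = Y \<or> T = Y'" for T
  proof -
    have "(\<Sum>z'\<in>Z. of_bool (inv z' \<otimes> (z \<otimes> (y \<otimes> x)) \<in> T)) =
        (\<Sum>z'\<in>Z. if z' = z then of_bool (y \<otimes> x \<in> T) else 0 :: int)"
      using key[OF _ that] by (intro sum.cong) auto
    then show ?thesis using z finites(5) by simp
  qed
  then show "Zl Y (z \<otimes> (y \<otimes> x)) = of_bool (x \<in> N)" "Zl Y' (z \<otimes> (y \<otimes> x)) = of_bool (x \<in> N')"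
    unfolding Zl_def using yE_iff[OF x] by simp_all
qed

text \<open>Collects what depends on the unspecified part of \<open>D\<close>. Its value is never
  computed; it suffices that it is constant on each block \<open>z y Q\<close>.\<close>

definition \<beta> :: "'a \<Rightarrow> int" where "\<beta> s = Zl D s + Zr D s + cv D D s"

lemma D_c_shift:
  assumes s: "s \<in> carrier G"
  shows "Zl D (s \<otimes> c) = Zl D s" "Zr D (s \<otimes> c) = Zr D s" "Zl D (c \<otimes> s) = Zl D s"
    "Zr D (c \<otimes> s) = Zr D s" "cv D D (s \<otimes> c) = cv D D s" "cv D D (c \<otimes> s) = cv D D s"
proof -
  have 1: "inv z \<otimes> (s \<otimes> c) = (inv z \<otimes> s) \<otimes> c" "(c \<otimes> s) \<otimes> inv z = c \<otimes> (s \<otimes> inv z)"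
    "inv z \<otimes> s \<in> carrier G" "s \<otimes> inv z \<in> carrier G" if "z \<in> Z" for z
    using Z_carrier[OF that] s by (simp_all add: m_assoc)
  have 2: "(s \<otimes> c) \<otimes> inv z = (s \<otimes> inv z) \<otimes> c" if "z \<in> Z" for z
    using Z_carrier[OF that] s cF[OF Z_inv[OF that]] by (simp add: m_assoc)
  have 3: "inv z \<otimes> (c \<otimes> s) = c \<otimes> (inv z \<otimes> s)" if "z \<in> Z" for z
    using Z_carrier[OF that] s cF[OF Z_inv[OF that]] by (simp add: m_assoc[symmetric])
  show "Zl D (s \<otimes> c) = Zl D s" "Zr D (s \<otimes> c) = Zr D s" "Zl D (c \<otimes> s) = Zl D s" "Zr D (c \<otimes> s) = Zr D s"
    unfolding Zl_def Zr_def using 1 2 3 by (intro sum.cong; simp add: D_c_iff)+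
  show "cv D D (s \<otimes> c) = cv D D s" "cv D D (c \<otimes> s) = cv D D s"
    using cv_shift(2,3)[OF D D s] unfolding D_images by blast+
qed

text \<open>The four elements of a block are obtained from \<open>z y w\<close> by multiplying with
  \<open>c\<close> on the left and on the right, and each term of \<open>\<beta>\<close> is
  invariant under both.\<close>

lemma \<beta>_Q:
  assumes z: "z \<in> Z" and x: "x \<in> Q"
  shows "\<beta> (z \<otimes> (y \<otimes> x)) = \<beta> (z \<otimes> (y \<otimes> w))"
proof -
  let ?s = "z \<otimes> (y \<otimes> w)"
  have zc: "z \<in> carrier G" and zF: "z \<in> F" using Z_carrier Z z by auto
  then have s: "?s \<in> carrier G" and sc: "?s \<otimes> c \<in> carrier G" by simp_all
  have \<beta>: "\<beta> (s \<otimes> c) = \<beta> s" "\<beta> (c \<otimes> s) = \<beta> s" if "s \<in> carrier G" for s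
    using D_c_shift[OF that] by (simp_all add: \<beta>_def)
  have 1: "?s \<otimes> c = z \<otimes> (y \<otimes> (w \<otimes> c))" "c \<otimes> ?s = z \<otimes> (y \<otimes> (w \<otimes> (w \<otimes> c)))"
    "c \<otimes> (z \<otimes> (y \<otimes> (w \<otimes> c))) = z \<otimes> (y \<otimes> (w \<otimes> w))"
    using zc zF by (simp_all add: word_simps)
  show ?thesis using x \<beta>[OF s] \<beta>(2)[OF sc] unfolding 1 \<beta>(1)[OF s] by (auto simp: Q_def)
qed

lemma cv_A_zyx:
  assumes z: "z \<in> {f, inv f}" and x: "x \<in> Q"
  shows "cv A A (z \<otimes> (y \<otimes> x)) = 2 * of_bool (x \<in> N) + of_bool (w \<otimes> (c \<otimes> x) \<in> Q) +
    of_bool (x \<otimes> (w \<otimes> c) \<in> Q) + \<beta> (z \<otimes> (y \<otimes> w))"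
proof -
  let ?s = "z \<otimes> (y \<otimes> x)"
  have zZ: "z \<in> Z" using z f f_inv by blast
  then have zF: "z \<in> F" and zc: "z \<in> carrier G" using Z Z_carrier by auto
  have xE: "x \<in> E" using x Q_E by blast
  then have xc: "x \<in> carrier G" by (rule E_carrier)
  have s: "?s \<in> carrier G" using xc zc by simp
  have sy: "?s = y \<otimes> (z \<otimes> x)" using xc zc yF[OF zF] by (simp add: m_assoc[symmetric])
  have zxL: "z \<otimes> x \<in> L" using L_I[OF zF xE] .
  have sL: "?s \<notin> L" unfolding sy using yL_notin_L[OF zxL] .
  have "?s \<in> D" using D_yZ[OF zZ xE] z x by auto
  then have Y0: "?s \<notin> Y" "?s \<notin> Y'" using disjoint(4,5) by auto
  have r1: "w \<otimes> (c \<otimes> ?s) \<in> D \<longleftrightarrow> w \<otimes> (c \<otimes> x) \<in> Q"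
  proof -
    have "w \<otimes> (c \<otimes> ?s) = z \<otimes> (y \<otimes> (w \<otimes> (c \<otimes> x)))" using zc zF xc by (simp add: absorb absorbF)
    moreover have "w \<otimes> (c \<otimes> x) \<in> E" using xE E_mult[of "w \<otimes> c" x] xc by (simp add: E_eq m_assoc)
    ultimately show ?thesis using D_yZ[OF zZ] z by auto
  qed
  have r2: "?s \<otimes> (w \<otimes> c) \<in> D \<longleftrightarrow> x \<otimes> (w \<otimes> c) \<in> Q"
  proof -
    have "?s \<otimes> (w \<otimes> c) = z \<otimes> (y \<otimes> (x \<otimes> (w \<otimes> c)))" using zc xc by (simp add: m_assoc)
    moreover have "x \<otimes> (w \<otimes> c) \<in> E" using xE E_mult[of x "w \<otimes> c"] by (simp add: E_eq)
    ultimately show ?thesis using D_yZ[OF zZ] z by auto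
  qed
  have "cv A A ?s = cv P P ?s + cv P Y ?s + cv P D ?s + cv Y P ?s + cv Y Y ?s +
    cv Y D ?s + cv D P ?s + cv D Y ?s + cv D D ?s"
    unfolding A_def by (rule cv_expand) simp
  also have "\<dots> = 2 * of_bool (x \<in> N) + of_bool (w \<otimes> (c \<otimes> x) \<in> Q) +
      of_bool (x \<otimes> (w \<otimes> c) \<in> Q) + \<beta> ?s"
    unfolding cv_PY(1,2)[OF s] cv_P[OF D s] cv_support(1,2)[OF s sL] cv_support(3,4)[OF s zxL sy]
      Zl_zyx[OF zZ xE] r1 r2 \<beta>_def using Y0 by simp
  finally show ?thesis unfolding \<beta>_Q[OF zZ x] .
qed

text \<open>Right multiplication by \<open>c\<close> transports the factorisations whose last factor
  lies in \<open>Y\<close> or \<open>D\<close>. Those ending in \<open>P\<close> are treated apart: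
  \<open>cv_PY\<close> reduces \<open>Y P\<close> to \<open>P Y\<close>, in \<open>D P\<close> the
  factor \<open>w c\<close> contributes nothing since \<open>D\<close> avoids the translate of
  \<open>E\<close> by \<open>y\<close>, and \<open>P P\<close> vanishes off
  \<open>L\<close>.\<close>

lemma cv_B_Y':
  assumes "s \<in> Y"
  shows "cv B B (s \<otimes> c) = cv A A s"
proof -
  obtain x where x: "x \<in> E" "s = y \<otimes> x" using Y_E assms by blast
  have xc: "x \<in> carrier G" by (rule E_carrier[OF x(1)])
  have s: "s \<in> carrier G" and sc: "s \<otimes> c \<in> carrier G" using x xc by auto
  have xc': "s \<otimes> c = y \<otimes> (x \<otimes> c)" "x \<otimes> c \<in> E" using x xc E_mult[of x c] by (auto simp: m_assoc E_eq)
  have notL: "s \<notin> L" "s \<otimes> c \<notin> L" using x xc' yL_notin_L E_L by auto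
  have notD: "s \<otimes> (w \<otimes> c) \<notin> D" "(s \<otimes> c) \<otimes> (w \<otimes> c) \<notin> D"
  proof -
    have "s \<otimes> (w \<otimes> c) = y \<otimes> (x \<otimes> (w \<otimes> c))" "(s \<otimes> c) \<otimes> (w \<otimes> c) = y \<otimes> ((x \<otimes> c) \<otimes> (w \<otimes> c))"
      using x xc by (simp_all add: m_assoc)
    moreover have "x \<otimes> (w \<otimes> c) \<in> E" "(x \<otimes> c) \<otimes> (w \<otimes> c) \<in> E"
      using E_mult[OF x(1), of "w \<otimes> c"] E_mult[OF xc'(2), of "w \<otimes> c"] by (auto simp: E_eq)
    ultimately show "s \<otimes> (w \<otimes> c) \<notin> D" "(s \<otimes> c) \<otimes> (w \<otimes> c) \<notin> D" using D_yE by auto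
  qed
  have "cv P Y' (s \<otimes> c) = cv P Y s"
    using cv_shift(2)[OF P_carrier Y_carrier s] unfolding Y_images .
  moreover from this have "cv Y' P (s \<otimes> c) = cv Y P s"
    unfolding cv_PY[OF s] cv_PY[OF sc] .
  moreover have "cv P D (s \<otimes> c) = cv P D s" "cv Y' D (s \<otimes> c) = cv Y D s"
    using cv_shift(2)[OF P_carrier D s] cv_shift(2)[OF Y_carrier D s] cv_Y'(2)[OF sc]
    unfolding D_images by auto
  moreover have "cv D Y' (s \<otimes> c) = cv D Y s"
    using cv_shift(2)[OF D Y_carrier s] unfolding Y_images .
  moreover have "cv D P (s \<otimes> c) = cv D P s"
    unfolding cv_P[OF D s] cv_P[OF D sc] D_c_shift[OF s] using notD by simp
  moreover have "cv D D (s \<otimes> c) = cv D D s" by (rule D_c_shift[OF s])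
  moreover have "cv P P s = 0" "cv P P (s \<otimes> c) = 0" "cv Y Y s = 0" "cv Y' Y' (s \<otimes> c) = 0"
    using cv_support(1,2)[OF s notL(1)] cv_support(1,2)[OF sc notL(2)] cv_Y'(1)[OF sc] by auto
  moreover have "cv A A s = cv P P s + cv P Y s + cv P D s + cv Y P s + cv Y Y s +
      cv Y D s + cv D P s + cv D Y s + cv D D s"
    unfolding A_def by (rule cv_expand) simp
  moreover have "cv B B (s \<otimes> c) = cv P P (s \<otimes> c) + cv P Y' (s \<otimes> c) + cv P D (s \<otimes> c) + cv Y' P (s \<otimes> c) +
      cv Y' Y' (s \<otimes> c) + cv Y' D (s \<otimes> c) + cv D P (s \<otimes> c) + cv D Y' (s \<otimes> c) + cv D D (s \<otimes> c)"
    unfolding B_def by (rule cv_expand) simp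
  ultimately show ?thesis by simp
qed

text \<open>On a block \<open>z y Q\<close> the counts minus the common \<open>\<beta>\<close> are
  3, 3, 0, 2 for \<open>A\<close> and 1, 1, 2, 4 for \<open>B\<close>. Both lists have sum 8 and sum
  of squares 22, so all terms containing \<open>\<beta>\<close> cancel in the difference of the
  cubes and 74 - 62 = 12 remains for each \<open>z\<close> in \<open>{f, inv f}\<close>. Elsewhere
  the counts agree, with \<open>Y\<close> matched to \<open>Y'\<close> by right multiplication with
  \<open>c\<close>.\<close>

theorem cubes_differ: "(\<Sum>s\<in>B. cv B B s ^ 3) = (\<Sum>s\<in>A. cv A A s ^ 3) + 12 * int (card {f, inv f})"
proof -
  define X where "X = (\<lambda>(z, x). z \<otimes> (y \<otimes> x)) ` ({f, inv f} \<times> Q)"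
  have fZ: "z \<in> Z" if "z \<in> {f, inv f}" for z using that f f_inv by blast
  have XD: "X \<subseteq> D" using D_yZ fZ Q_E by (force simp: X_def)
  have sumP: "(\<Sum>s\<in>P. cv B B s ^ 3) = (\<Sum>s\<in>P. cv A A s ^ 3)"
  proof (rule sum.cong[OF refl])
    fix s assume "s \<in> P"
    then have s: "s \<in> L" "s \<in> carrier G" using P_L P_carrier by auto
    then have "s \<notin> Y" "s \<notin> Y'" using y_shift_notin_L by blast+
    then show "cv B B s ^ 3 = cv A A s ^ 3" using cv_B_eq[OF s(2)] Zl_L[OF s(1)] by simp
  qed
  have sumD: "(\<Sum>s\<in>D - X. cv B B s ^ 3) = (\<Sum>s\<in>D - X. cv A A s ^ 3)"
  proof (rule sum.cong[OF refl])
    fix s assume s: "s \<in> D - X"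
    then have "s \<notin> Y" "s \<notin> Y'" using disjoint by blast+
    moreover have "s \<noteq> z \<otimes> (y \<otimes> x)" if "z \<in> {f, inv f}" "x \<in> Q" for z x
      using s that by (force simp: X_def)
    ultimately show "cv B B s ^ 3 = cv A A s ^ 3"
      using cv_B_eq[of s] Zl_D[of s] s D by auto
  qed
  have sumY: "(\<Sum>s\<in>Y'. cv B B s ^ 3) = (\<Sum>s\<in>Y. cv A A s ^ 3)"
    unfolding Y_images(1)[symmetric] sum.reindex[OF inj_on_subset[OF inj_c(1) Y_carrier]] o_def
    by (intro sum.cong refl) (simp add: cv_B_Y')
  have inj: "inj_on (\<lambda>(z, x). z \<otimes> (y \<otimes> x)) ({f, inv f} \<times> Q)"
    using fZ Z Q_E by (intro inj_on_subset[OF inj_on_zyx]) blast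
  have Qsum: "(\<Sum>x\<in>Q. h x) = h w + h (w \<otimes> w) + h (w \<otimes> c) + h (w \<otimes> (w \<otimes> c))" for h :: "'a \<Rightarrow> int"
    by (simp add: Q_def neqs add.assoc)
  have zsum: "(\<Sum>x\<in>Q. cv B B (z \<otimes> (y \<otimes> x)) ^ 3) = (\<Sum>x\<in>Q. cv A A (z \<otimes> (y \<otimes> x)) ^ 3) + 12"
    if z: "z \<in> {f, inv f}" for z
  proof -
    have Bz: "cv B B (z \<otimes> (y \<otimes> x)) = cv A A (z \<otimes> (y \<otimes> x)) + 2 * (of_bool (x \<in> N') - of_bool (x \<in> N))"
      if x: "x \<in> Q" for x
    proof -
      have "z \<otimes> (y \<otimes> x) \<in> D" using D_yZ[OF fZ[OF z] Q_E[OF x]] z x by simp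
      then have "z \<otimes> (y \<otimes> x) \<notin> Y" "z \<otimes> (y \<otimes> x) \<notin> Y'" "z \<otimes> (y \<otimes> x) \<in> carrier G"
        using disjoint D by blast+
      then show ?thesis using cv_B_eq Zl_zyx[OF fZ[OF z] Q_E[OF x]] by simp
    qed
    let ?b = "\<beta> (z \<otimes> (y \<otimes> w))"
    have Qs: "w \<in> Q" "w \<otimes> w \<in> Q" "w \<otimes> c \<in> Q" "w \<otimes> (w \<otimes> c) \<in> Q" by (auto simp: Q_def)
    have a: "cv A A (z \<otimes> (y \<otimes> w)) = 3 + ?b" "cv A A (z \<otimes> (y \<otimes> (w \<otimes> w))) = 3 + ?b"
      "cv A A (z \<otimes> (y \<otimes> (w \<otimes> c))) = ?b" "cv A A (z \<otimes> (y \<otimes> (w \<otimes> (w \<otimes> c)))) = 2 + ?b"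
      using Qs[THEN cv_A_zyx[OF z]] by (simp_all add: Q_def N_def neqs word_simps)
    have b: "cv B B (z \<otimes> (y \<otimes> w)) = 1 + ?b" "cv B B (z \<otimes> (y \<otimes> (w \<otimes> w))) = 1 + ?b"
      "cv B B (z \<otimes> (y \<otimes> (w \<otimes> c))) = 2 + ?b" "cv B B (z \<otimes> (y \<otimes> (w \<otimes> (w \<otimes> c)))) = 4 + ?b"
      using Qs[THEN Bz] a by (simp_all add: N_def N'_def neqs)
    show ?thesis unfolding Qsum a b by (simp add: power3_eq_cube algebra_simps)
  qed
  have X_sum: "(\<Sum>s\<in>X. h s) = (\<Sum>z\<in>{f, inv f}. \<Sum>x\<in>Q. h (z \<otimes> (y \<otimes> x)))" for h :: "'a \<Rightarrow> int"
    unfolding X_def sum.reindex[OF inj] sum.cartesian_product by (rule sum.cong) auto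
  have sumX: "(\<Sum>s\<in>X. cv B B s ^ 3) = (\<Sum>s\<in>X. cv A A s ^ 3) + 12 * int (card {f, inv f})"
  proof -
    have "(\<Sum>z\<in>{f, inv f}. \<Sum>x\<in>Q. cv B B (z \<otimes> (y \<otimes> x)) ^ 3) =
        (\<Sum>z\<in>{f, inv f}. (\<Sum>x\<in>Q. cv A A (z \<otimes> (y \<otimes> x)) ^ 3) + 12)"
      by (rule sum.cong[OF refl zsum])
    then show ?thesis unfolding X_sum sum.distrib by simp
  qed
  have split: "(\<Sum>s\<in>P \<union> T \<union> D. h s) = (\<Sum>s\<in>P. h s) + (\<Sum>s\<in>T. h s) + ((\<Sum>s\<in>D - X. h s) + (\<Sum>s\<in>X. h s))"
    if "T = Y \<or> T = Y'" for T and h :: "'a \<Rightarrow> int"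
  proof -
    have *: "finite T" "P \<inter> T = {}" "(P \<union> T) \<inter> D = {}" using that finites disjoint by auto
    then have "(\<Sum>s\<in>P \<union> T \<union> D. h s) = (\<Sum>s\<in>P. h s) + (\<Sum>s\<in>T. h s) + (\<Sum>s\<in>D. h s)"
      using finites by (simp add: sum.union_disjoint)
    then show ?thesis using sum.subset_diff[OF XD finites(4), of h] by simp
  qed
  show ?thesis
    unfolding split[of Y, folded A_def, OF disjI1[OF refl]] split[of Y', folded B_def, OF disjI2[OF refl]]
    using sumP sumD sumY sumX by simp
qed

theorem not_iso_A_B:
  "\<not> digraph_iso (with_proj (Cayley_graph G A)) (with_proj (Cayley_graph G B))"
proof
  assume "digraph_iso (with_proj (Cayley_graph G A)) (with_proj (Cayley_graph G B))"
  from Cayley_iso_invariant[OF fin A_carrier B_carrier this] cubes_differ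
  have "card {f, inv f} = 0" by simp
  then show False by simp
qed

end

section \<open>Generating sets of prescribed size\<close>

text \<open>The exponents 1 and -1 are compulsory, 0 adjusts the parity, and all others come in
  pairs of opposite sign. The bound 7 is the largest remainder left by classes of at most 8
  elements.\<close>

lemma exponent_set:
  assumes "\<rho> \<le> (7 :: nat)"
  obtains J :: "int set" where "J \<subseteq> {-5..5}" "1 \<in> J" "\<And>j. j \<in> J \<Longrightarrow> - j \<in> J" "card J = \<rho> + 2"
proof -
  define J :: "int set" where "J = {1, -1} \<union> (if odd \<rho> then {0} else {}) \<union>
    (if \<rho> \<ge> 2 then {3, -3} else {}) \<union> (if \<rho> \<ge> 4 then {4, -4} else {}) \<union>
    (if \<rho> \<ge> 6 then {5, -5} else {})"
  have "\<rho> \<in> {0, 1, 2, 3, 4, 5, 6, 7}" using assms by auto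
  then have "card J = \<rho> + 2" by (elim insertE) (simp_all add: J_def)
  moreover have "J \<subseteq> {-5..5}" "1 \<in> J" by (auto simp: J_def)
  moreover have "- j \<in> J" if "j \<in> J" for j
    using that by (auto simp: J_def split: if_splits)
  ultimately show ?thesis using that by blast
qed

context switching
begin

text \<open>The closure of \<open>g\<close> under inversion and under multiplication by
  \<open>c\<close> on both sides, hence the smallest piece by which \<open>D\<close> can be
  enlarged.\<close>

definition cls :: "'a \<Rightarrow> 'a set" where
  "cls g = (\<lambda>(a, h, b). a \<otimes> h \<otimes> b) ` ({\<one>, c} \<times> {g, inv g} \<times> {\<one>, c})"

text \<open>Filler for \<open>D\<close>: the conditions that force or forbid membership in
  \<open>D\<close> all concern elements of \<open>H\<close>, so a set that avoids \<open>H\<close>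
  is subject to the symmetries alone.\<close>

definition admissible :: "'a set \<Rightarrow> bool" where
  "admissible S \<longleftrightarrow> S \<subseteq> carrier G \<and> S \<inter> H = {} \<and>
    (\<forall>x\<in>S. inv x \<in> S \<and> c \<otimes> x \<in> S \<and> x \<otimes> c \<in> S)"

lemma admissibleD:
  assumes "admissible S"
  shows "S \<subseteq> carrier G" "S \<inter> H = {}" "x \<in> S \<Longrightarrow> inv x \<in> S" "x \<in> S \<Longrightarrow> c \<otimes> x \<in> S"
    "x \<in> S \<Longrightarrow> x \<otimes> c \<in> S"
  using assms by (simp_all add: admissible_def)

lemma c_H: "c \<in> H"
  using E_L[of c] by (simp add: H_def E_eq)

lemma cls_eq: "g \<in> carrier G \<Longrightarrow> cls g = {g, c \<otimes> g, g \<otimes> c, c \<otimes> (g \<otimes> c),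
    inv g, c \<otimes> inv g, inv g \<otimes> c, c \<otimes> (inv g \<otimes> c)}"
  by (auto simp: cls_def m_assoc image_iff)

lemma card_cls: "card (cls g) \<le> 8"
proof -
  have "card (cls g) \<le> card ({\<one>, c} \<times> {g, inv g} \<times> {\<one>, c})"
    unfolding cls_def by (rule card_image_le) simp
  also have "\<dots> = card {\<one>, c} * (card {g, inv g} * card {\<one>, c})"
    by (simp only: card_cartesian_product)
  also have "\<dots> \<le> 2 * (2 * 2)"
    by (intro mult_le_mono card_insert_le_m1) auto
  finally show ?thesis by simp
qed

lemma admissible_cls:
  assumes g: "g \<in> carrier G" "g \<notin> H"
  shows "admissible (cls g)" "g \<in> cls g"
proof -
  have inv_c: "inv c = c" using cc by (intro inv_equality) auto
  have "inv g \<notin> H" using g subgroup.m_inv_closed[OF subgroup_H, of "inv g"] by auto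
  then have "c \<otimes> g \<notin> H" "g \<otimes> c \<notin> H" "c \<otimes> (g \<otimes> c) \<notin> H" "c \<otimes> inv g \<notin> H" "inv g \<otimes> c \<notin> H"
    "c \<otimes> (inv g \<otimes> c) \<notin> H"
    using g c_H subgroup_cancel[OF subgroup_H c_H] by simp_all
  then have "cls g \<inter> H = {}" using g \<open>inv g \<notin> H\<close> by (simp add: cls_eq)
  moreover have "inv x \<in> cls g \<and> c \<otimes> x \<in> cls g \<and> x \<otimes> c \<in> cls g" if "x \<in> cls g" for x
    using that g(1) unfolding cls_eq[OF g(1)]
    by (elim insertE) (auto simp: m_assoc absorb cc inv_mult_group inv_c)
  ultimately show "admissible (cls g)" using g by (auto simp: admissible_def cls_eq)
  show "g \<in> cls g" using g by (simp add: cls_eq)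
qed

lemma admissible_Un: "admissible S \<Longrightarrow> admissible T \<Longrightarrow> admissible (S \<union> T)"
  unfolding admissible_def by blast

lemma admissible_closure:
  assumes "finite S" "S \<subseteq> carrier G" "S \<inter> H = {}"
  shows "\<exists>T. admissible T \<and> S \<subseteq> T \<and> card T \<le> 8 * card S"
  using assms
proof (induction S rule: finite_induct)
  case empty
  then show ?case by (intro exI[of _ "{}"]) (simp add: admissible_def)
next
  case (insert g S)
  then obtain T where T: "admissible T" "S \<subseteq> T" "card T \<le> 8 * card S" by auto
  have g: "g \<in> carrier G" "g \<notin> H" using insert by auto
  have "card (T \<union> cls g) \<le> 8 * card S + 8"
    using card_Un_le[of T "cls g"] T(3) card_cls[of g] by linarith
  then show ?case
    using admissible_Un[OF T(1) admissible_cls(1)[OF g]] admissible_cls(2)[OF g] T(2) insert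
    by (intro exI[of _ "T \<union> cls g"]) auto
qed

text \<open>Take \<open>S\<close> of maximal size among the candidates. Since \<open>S\<close> and
  \<open>H\<close> do not exhaust the group, some class of at most 8 elements could be added if 8 or
  more places were free.\<close>

lemma admissible_of_size:
  assumes T: "admissible T" "card T \<le> n" and large: "n + card H < card (carrier G)"
  obtains S where "admissible S" "T \<subseteq> S" "card S \<le> n" "n \<le> card S + 7"
proof -
  define \<S> where "\<S> = {S. admissible S \<and> T \<subseteq> S \<and> card S \<le> n}"
  have "\<S> \<subseteq> Pow (carrier G)" using admissibleD(1) by (auto simp: \<S>_def)
  then have fin\<S>: "finite \<S>" using fin by (simp add: finite_subset)
  have "T \<in> \<S>" using T by (simp add: \<S>_def)
  then have "Max (card ` \<S>) \<in> card ` \<S>" using fin\<S> by (intro Max_in) auto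
  then obtain S where S: "S \<in> \<S>" and S_max: "Max (card ` \<S>) = card S" by (rule imageE)
  have max: "card S' \<le> card S" if "S' \<in> \<S>" for S'
    unfolding S_max[symmetric] using that fin\<S> by (intro Max_ge) auto
  have "S \<subseteq> carrier G" using S admissibleD(1) by (simp add: \<S>_def)
  then have finS: "finite S" using fin finite_subset by blast
  have "card (S \<union> H) < card (carrier G)"
    using card_Un_le[of S H] S large by (simp add: \<S>_def)
  moreover have "finite (S \<union> H)"
    using finS finite_subset[OF subgroup.subset[OF subgroup_H] fin] by simp
  ultimately have "\<not> carrier G \<subseteq> S \<union> H" using card_mono[of "S \<union> H" "carrier G"] by linarith
  then obtain g where g: "g \<in> carrier G" "g \<notin> S" "g \<notin> H" by blast
  have adm: "admissible (S \<union> cls g)" "T \<subseteq> S \<union> cls g"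
    using S admissible_Un[OF _ admissible_cls(1)[OF g(1,3)]] by (simp_all add: \<S>_def le_supI1)
  have "finite (cls g)" by (simp add: cls_def)
  then have "card S < card (S \<union> cls g)"
    using g(2) admissible_cls(2)[OF g(1,3)] finS by (intro psubset_card_mono) auto
  then have "S \<union> cls g \<notin> \<S>" using max by fastforce
  then have "n < card (S \<union> cls g)" using adm by (simp add: \<S>_def)
  also have "\<dots> \<le> card S + 8" using card_Un_le[of S "cls g"] card_cls[of g] by linarith
  finally have "n \<le> card S + 7" by simp
  then show ?thesis using S that[of S] by (simp add: \<S>_def)
qed

lemma Q_c: "x \<in> Q \<Longrightarrow> c \<otimes> x \<in> Q" "x \<in> Q \<Longrightarrow> x \<otimes> c \<in> Q" "x \<in> Q \<Longrightarrow> inv x \<in> Q"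
proof -
  have *: "inv u \<in> Q" if "u \<in> Q" "v \<in> Q" "v \<otimes> u = \<one>" for u v
    using inv_equality[OF that(3)] that by (auto simp: Q_def)
  show "x \<in> Q \<Longrightarrow> c \<otimes> x \<in> Q" "x \<in> Q \<Longrightarrow> x \<otimes> c \<in> Q"
    by (auto simp: Q_def word_simps)
  assume x: "x \<in> Q"
  then have "x = w \<or> x = w \<otimes> w \<or> x = w \<otimes> c \<or> x = w \<otimes> (w \<otimes> c)" by (simp add: Q_def)
  then show "inv x \<in> Q"
  proof (elim disjE)
    assume "x = w" then show ?thesis using x by (intro *[of _ "w \<otimes> w"]) (auto simp: Q_def word_simps)
  next
    assume "x = w \<otimes> w" then show ?thesis using x by (intro *[of _ w]) (auto simp: Q_def word_simps)
  next
    assume "x = w \<otimes> c" then show ?thesis using x by (intro *[of _ "w \<otimes> c"]) (auto simp: Q_def word_simps)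
  next
    assume "x = w \<otimes> (w \<otimes> c)"
    then show ?thesis using x by (intro *[of _ "w \<otimes> (w \<otimes> c)"]) (auto simp: Q_def word_simps)
  qed
qed

text \<open>The 14 compulsory elements are 8 in the two blocks, 3 in \<open>Y\<close> or
  \<open>Y'\<close>, and \<open>w c\<close>, \<open>f\<close>, \<open>inv f\<close>. Each element of
  \<open>D0\<close> costs up to 8 after closure. The exponents up to 5 in absolute value are those
  that \<open>exponent_set\<close> may use.\<close>

theorem exists_isospectral_pair:
  assumes f: "f \<in> F" and f_inj: "inj_on (\<lambda>j. f [^] j) {-5..5 :: int}"
    and D0: "D0 \<subseteq> carrier G" "D0 \<inter> H = {}"
    and gen: "generate G ({w, c, y} \<union> D0) = carrier G"
    and small: "8 * card D0 + 14 \<le> r" and large: "r + card H < card (carrier G)"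
  shows "\<exists>A B. symmetric_generating_set G A \<and> symmetric_generating_set G B \<and> card A = r \<and> card B = r \<and>
    isospectral (Cayley_graph G A) (Cayley_graph G B) \<and>
    \<not> digraph_iso (with_proj (Cayley_graph G A)) (with_proj (Cayley_graph G B))"
proof -
  have finD0: "finite D0" using D0 fin finite_subset by blast
  obtain T where T: "admissible T" "D0 \<subseteq> T" "card T \<le> 8 * card D0"
    using admissible_closure[OF finD0 D0] by blast
  have "card T \<le> r - 14" "r - 14 + card H < card (carrier G)" using T small large by auto
  then obtain S where S: "admissible S" "T \<subseteq> S" "card S \<le> r - 14" "r - 14 \<le> card S + 7"
    using admissible_of_size[OF T(1)] by metis
  \<comment> \<open>The number of places that whole classes cannot fill; further powers of
    \<open>f\<close> take them.\<close>
  define \<rho> where "\<rho> = r - 14 - card S"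
  have \<rho>: "\<rho> \<le> 7" "r = 14 + \<rho> + card S" using S small by (auto simp: \<rho>_def)
  obtain J :: "int set" where J: "J \<subseteq> {-5..5}" "1 \<in> J" "\<And>j. j \<in> J \<Longrightarrow> - j \<in> J" "card J = \<rho> + 2"
    using exponent_set[OF \<rho>(1)] by metis
  have fc: "f \<in> carrier G" using F_carrier f .
  define Z where "Z = (\<lambda>j. f [^] j) ` J"
  have fF: "f [^] (j :: int) \<in> F" for j using subgroup_int_pow_closed[OF F f] .
  have Z: "Z \<subseteq> F" "f \<in> Z" "inv f \<in> Z"
    using fF J(2) J(3)[OF J(2)] fc
    by (auto simp: Z_def int_pow_neg image_iff intro: bexI[of _ 1] bexI[of _ "-1"])
  have Z_inv: "inv z \<in> Z" if "z \<in> Z" for z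
    using that J(3) fc by (auto simp: Z_def int_pow_neg[symmetric])
  have card_Z: "card Z = \<rho> + 2"
    unfolding Z_def using card_image[OF inj_on_subset[OF f_inj J(1)]] J(4) by simp
  have f_neq: "f \<noteq> inv f" "f \<noteq> \<one>"
    using inj_onD[OF f_inj, of 1 "-1"] inj_onD[OF f_inj, of 1 0] fc by (auto simp: int_pow_neg)
  have f1: "inv f \<noteq> \<one>" using f_neq fc by (metis inv_inv inv_one)
  have ffF: "z \<in> F" if "z \<in> {f, inv f}" for z using that Z by blast
  define X where "X = (\<lambda>(z, x). z \<otimes> (y \<otimes> x)) ` ({f, inv f} \<times> Q)"
  have "{f, inv f} \<times> Q \<subseteq> F \<times> E" using ffF Q_E by blast
  then have "card X = card ({f, inv f} \<times> Q)"
    unfolding X_def by (intro card_image inj_on_subset[OF inj_on_zyx])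
  also have "\<dots> = 8" using f_neq unfolding card_cartesian_product by (simp add: Q_def neqs)
  finally have card_X: "card X = 8" .
  have X_iff: "z \<otimes> (y \<otimes> x) \<in> X \<longleftrightarrow> z \<in> {f, inv f} \<and> x \<in> Q" if "z \<in> F" "x \<in> E" for z x
  proof
    assume "z \<otimes> (y \<otimes> x) \<in> X"
    then obtain z' x' where zx: "z' \<in> {f, inv f}" "x' \<in> Q" "z \<otimes> (y \<otimes> x) = z' \<otimes> (y \<otimes> x')"
      by (auto simp: X_def)
    from zyx_inj[OF that(1) ffF[OF zx(1)] that(2) Q_E[OF zx(2)] zx(3)] zx
    show "z \<in> {f, inv f} \<and> x \<in> Q" by simp
  qed (auto simp: X_def)
  have X_yL: "\<exists>a\<in>L. s = y \<otimes> a" if sX: "s \<in> X" for s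
  proof -
    obtain z x where zx: "z \<in> {f, inv f}" "x \<in> Q" "s = z \<otimes> (y \<otimes> x)" using sX by (auto simp: X_def)
    have "s = y \<otimes> (z \<otimes> x)"
      unfolding zx(3) using ffF[OF zx(1)] E_carrier[OF Q_E[OF zx(2)]] by (simp add: absorbF)
    then show ?thesis using L_I[OF ffF[OF zx(1)] Q_E[OF zx(2)]] by blast
  qed
  then have XH: "X \<subseteq> H" and XL: "X \<inter> L = {}" using yL_notin_L by (auto simp: H_def)
  have X_sym: "inv s \<in> X \<and> c \<otimes> s \<in> X \<and> s \<otimes> c \<in> X" if sX: "s \<in> X" for s
  proof -
    obtain z x where zx: "z \<in> {f, inv f}" "x \<in> Q" "s = z \<otimes> (y \<otimes> x)" using sX by (auto simp: X_def)
    have zF: "z \<in> F" "inv z \<in> F" using ffF[OF zx(1)] subgroup.m_inv_closed[OF F] by auto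
    have xE: "x \<in> E" "inv x \<in> E" using Q_E[OF zx(2)] E_inv by auto
    have car: "z \<in> carrier G" "x \<in> carrier G" using F_carrier zF E_carrier xE by auto
    have "inv s = inv x \<otimes> (y \<otimes> inv z)"
      using zx(3) car by (simp add: inv_mult_group inv_y m_assoc)
    also have "\<dots> = (inv x \<otimes> inv z) \<otimes> y"
      using yF[OF zF(2)] car by (simp add: m_assoc)
    also have "\<dots> = (inv z \<otimes> inv x) \<otimes> y" using EF_comm[OF xE(2) zF(2)] by simp
    also have "\<dots> = inv z \<otimes> (y \<otimes> inv x)" using Ey_comm[OF xE(2)] car by (simp add: m_assoc)
    finally have "inv s \<in> X" using X_iff[OF zF(2) xE(2)] Q_c(3)[OF zx(2)] zx(1) fc by auto
    moreover have "c \<otimes> s = z \<otimes> (y \<otimes> (c \<otimes> x))" "s \<otimes> c = z \<otimes> (y \<otimes> (x \<otimes> c))"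
      using zx(3) car zF by (simp_all add: absorbF absorb m_assoc)
    ultimately show ?thesis using zx(1) Q_c[OF zx(2)] by (auto simp: X_def)
  qed
  define D where "D = X \<union> S"
  note SH = admissibleD(2,1)[OF S(1)]
  have finS: "finite S" using SH fin finite_subset by blast
  have LH: "L \<subseteq> H" by (auto simp: H_def)
  have zyx_H: "z \<otimes> (y \<otimes> x) \<in> H" if "z \<in> F" "x \<in> E" for z x
    using that L_I[OF that] E_carrier[OF that(2)] by (auto simp: absorbF[symmetric] H_def)
  interpret S: switching_sets G w c y F f Z D
  proof
    show "Z \<subseteq> F" "f \<in> Z" "inv f \<in> Z" by fact+
    show "D \<subseteq> carrier G" using SH XH subgroup.subset[OF subgroup_H] by (auto simp: D_def)
    show "c \<otimes> x \<in> D" "x \<otimes> c \<in> D" if "x \<in> D" for x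
      using that X_sym admissibleD(3-5)[OF S(1)] unfolding D_def by blast+
    show "x \<notin> D" if "x \<in> L" for x using that XL SH LH by (auto simp: D_def)
    show "y \<otimes> x \<notin> D" if x: "x \<in> E" for x
    proof -
      \<comment> \<open>With the trivial element of \<open>F\<close> in front, \<open>X_iff\<close>
        applies; neither \<open>f\<close> nor its inverse is trivial, so \<open>X\<close> misses the
        translate of \<open>E\<close> by \<open>y\<close>.\<close>
      have eq: "y \<otimes> x = \<one> \<otimes> (y \<otimes> x)" using E_carrier[OF x] by simp
      have "\<one> \<in> F" by (rule subgroup.one_closed[OF F])
      then show ?thesis
        using X_iff[of \<one> x] zyx_H[of \<one> x] x SH f_neq f1 unfolding eq[symmetric] by (auto simp: D_def)
    qed
    show "z \<otimes> (y \<otimes> x) \<in> D \<longleftrightarrow> (z = f \<or> z = inv f) \<and> x \<in> Q" if "z \<in> Z" "x \<in> E" for z x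
    proof -
      have "z \<in> F" using that Z by blast
      then show ?thesis using X_iff[of z x] zyx_H[of z x] that SH by (auto simp: D_def)
    qed
  qed
  have card_Y: "card Y = 3" "card Y' = 3"
    using Y_eq neqs by simp_all
  have card_D: "card D = 8 + card S"
    unfolding D_def using SH XH finS card_X
    by (subst card_Un_disjoint) (auto simp: card_ge_0_finite)
  have card_P: "card S.P = \<rho> + 3"
    unfolding S.P_def using S.r_notin_Z S.finites card_Z by simp
  have card_A: "card S.A = r" "card S.B = r"
    unfolding S.A_def S.B_def using S.finites S.disjoint card_Y card_D card_P \<rho>(2)
    by (simp_all add: card_Un_disjoint Int_Un_distrib2)
  have P_inv: "inv s \<in> S.P" if "s \<in> S.P" for s
    using that Z_inv S.inv_r by (auto simp: S.P_def)
  have D_inv: "inv s \<in> D" if "s \<in> D" for s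
    using that X_sym admissibleD(3-5)[OF S(1)] unfolding D_def by blast+
  have genI: "generate G K = carrier G"
    if K: "K \<subseteq> carrier G" "D \<subseteq> K" "w \<in> generate G K" "c \<in> generate G K" "y \<in> generate G K" for K
  proof
    show "generate G K \<subseteq> carrier G" using generate_incl K(1) .
    have "D0 \<subseteq> K" using K(2) S(2) T(2) unfolding D_def by blast
    then have "{w, c, y} \<union> D0 \<subseteq> generate G K" using K(3-5) generate.incl[of _ K G] by blast
    from generate_subgroup_incl[OF this generate_is_subgroup[OF K(1)]]
    show "carrier G \<subseteq> generate G K" unfolding gen .
  qed
  have gA: "generate G S.A = carrier G"
  proof (rule genI[OF S.A_carrier])
    show "D \<subseteq> S.A" by (auto simp: S.A_def)
    have inc: "y \<in> generate G S.A" "y \<otimes> w \<in> generate G S.A" "w \<otimes> c \<in> generate G S.A"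
      by (rule generate.incl; simp add: S.A_def Y_eq S.P_def)+
    show "y \<in> generate G S.A" by (rule inc(1))
    have "y \<otimes> (y \<otimes> w) \<in> generate G S.A" by (rule generate.eng[OF inc(1,2)])
    then show w: "w \<in> generate G S.A" by (simp add: absorb)
    have "w \<otimes> (w \<otimes> (w \<otimes> c)) \<in> generate G S.A"
      by (intro generate.eng[OF w] inc(3))
    then show "c \<in> generate G S.A" by (simp add: absorb)
  qed
  have gB: "generate G S.B = carrier G"
  proof (rule genI[OF S.B_carrier])
    show "D \<subseteq> S.B" by (auto simp: S.B_def)
    have inc: "y \<otimes> c \<in> generate G S.B" "y \<otimes> (w \<otimes> c) \<in> generate G S.B" "w \<otimes> c \<in> generate G S.B"
      by (rule generate.incl; simp add: S.B_def Y_eq S.P_def)+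
    \<comment> \<open>The two reflections multiply to the rotation \<open>w\<close>, and the two
      factors \<open>y\<close> cancel.\<close>
    have "(y \<otimes> (w \<otimes> c)) \<otimes> (y \<otimes> c) \<in> generate G S.B" by (rule generate.eng[OF inc(2,1)])
    then show w: "w \<in> generate G S.B" by (simp add: word_simps)
    have "w \<otimes> (w \<otimes> (w \<otimes> c)) \<in> generate G S.B"
      by (intro generate.eng[OF w] inc(3))
    then show c: "c \<in> generate G S.B" by (simp add: absorb)
    have "(y \<otimes> c) \<otimes> c \<in> generate G S.B" by (rule generate.eng[OF inc(1) c])
    then show "y \<in> generate G S.B" by (simp add: m_assoc cc)
  qed
  have "symmetric_generating_set G S.A" "symmetric_generating_set G S.B"
  proof -
    have "inv s \<in> S.A" if "s \<in> S.A" for s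
      using that P_inv[of s] inv_Y(1)[of s] D_inv[of s] by (auto simp: S.A_def)
    then show "symmetric_generating_set G S.A"
      using gA S.A_carrier by (simp add: symmetric_generating_set_def)
    have "inv s \<in> S.B" if "s \<in> S.B" for s
      using that P_inv[of s] inv_Y(2)[of s] D_inv[of s] by (auto simp: S.B_def)
    then show "symmetric_generating_set G S.B"
      using gB S.B_carrier by (simp add: symmetric_generating_set_def)
  qed
  then show ?thesis using card_A S.isospectral_A_B S.not_iso_A_B by blast
qed

end

section \<open>The special linear group is generated by transvections\<close>

locale transvection_closed =
  fixes d :: nat and K :: "'f :: field mat set"
  assumes one: "1\<^sub>m d \<in> K" and mult: "A \<in> K \<Longrightarrow> B \<in> K \<Longrightarrow> A * B \<in> K"
    and addrow_mat: "k < d \<Longrightarrow> l < d \<Longrightarrow> k \<noteq> l \<Longrightarrow> addrow_mat d a k l \<in> K"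
begin

text \<open>A row operation is undone by the transvection with the opposite parameter, so closure of
  \<open>K\<close> under products is enough and inverses never enter.\<close>

lemma addrow_imp:
  assumes M: "M \<in> carrier_mat d d" and kl: "k < d" "l < d" "k \<noteq> l" and K: "addrow a k l M \<in> K"
  shows "M \<in> K"
proof -
  have "addrow_mat d (- a) k l * addrow a k l M = (addrow_mat d (- a) k l * addrow_mat d a k l) * M"
    unfolding Gauss_Jordan_Elimination.addrow_mat[OF M kl(2)]
    by (rule assoc_mult_mat[symmetric]) (use M in auto)
  also have "addrow_mat d (- a) k l * addrow_mat d a k l = 1\<^sub>m d"
    using addrow_mat_inv[OF kl, of "- a"] by simp
  finally have "M = addrow_mat d (- a) k l * addrow a k l M" using M by simp
  then show ?thesis using mult[OF addrow_mat[OF kl] K] by metis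
qed

definition reduced :: "nat \<Rightarrow> 'f mat \<Rightarrow> bool" where
  "reduced k M \<longleftrightarrow> M \<in> carrier_mat d d \<and> det M = 1 \<and>
    (\<forall>i<d. \<forall>j<k. M $$ (i, j) = of_bool (i = j))"

text \<open>Row \<open>l\<close> with \<open>m \<le> l\<close> is zero in the first \<open>m\<close>
  columns, so adding a multiple of it leaves these columns intact.\<close>

lemma reduced_addrow:
  assumes "reduced m M" "m \<le> d" "k < d" "l < d" "k \<noteq> l" "m \<le> l"
  shows "reduced m (addrow a k l M)"
proof -
  have M: "M \<in> carrier_mat d d" using assms by (simp add: reduced_def)
  have "det (addrow a k l M) = 1"
    using det_addrow[OF assms(4,5) M] assms(1) by (simp add: reduced_def)
  moreover have "addrow a k l M $$ (i, j) = of_bool (i = j)" if "i < d" "j < m" for i j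
    using assms that M by (auto simp: reduced_def)
  ultimately show ?thesis using M by (simp add: reduced_def)
qed

text \<open>Induction on the number of nonzero entries of column \<open>m\<close> away from the
  pivot; each is cleared with the pivot row.\<close>

lemma reduced_pivot:
  assumes m: "m < d" and IH: "\<And>M. reduced (Suc m) M \<Longrightarrow> M \<in> K"
    and M: "reduced m M" "M $$ (m, m) = 1"
  shows "M \<in> K"
  using M
proof (induction "card {i. i < d \<and> i \<noteq> m \<and> M $$ (i, m) \<noteq> 0}" arbitrary: M)
  case 0
  then have "M $$ (i, m) = of_bool (i = m)" if "i < d" for i using that by auto
  then have "reduced (Suc m) M" using 0 by (auto simp: reduced_def less_Suc_eq)
  then show ?case by (rule IH)
next
  case (Suc n)
  then obtain i where i: "i < d" "i \<noteq> m" "M $$ (i, m) \<noteq> 0"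
    by (metis (mono_tags, lifting) card.empty empty_Collect_eq nat.distinct(1))
  have M: "M \<in> carrier_mat d d" using Suc by (simp add: reduced_def)
  let ?M = "addrow (- M $$ (i, m)) i m M"
  have ent: "?M $$ (j, m) = (if j = i then 0 else M $$ (j, m))" if "j < d" for j
    using that M m Suc.prems(2) by auto
  have "{j. j < d \<and> j \<noteq> m \<and> ?M $$ (j, m) \<noteq> 0} = {j. j < d \<and> j \<noteq> m \<and> M $$ (j, m) \<noteq> 0} - {i}"
    by (auto simp: ent split: if_splits)
  then have "n = card {j. j < d \<and> j \<noteq> m \<and> ?M $$ (j, m) \<noteq> 0}"
    using Suc.hyps(2) i by simp
  moreover have "reduced m ?M" using reduced_addrow[OF Suc.prems(1) _ i(1) m i(2)] m by simp
  moreover have "?M $$ (m, m) = 1" using ent[OF m] i Suc.prems(2) by simp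
  ultimately have "?M \<in> K" by (rule Suc.hyps(1))
  then show ?case by (rule addrow_imp[OF M i(1) m i(2)])
qed

text \<open>Transvections cannot rescale a row, but a nonzero entry below the pivot lets a suitable
  multiple of its row correct the pivot to 1.\<close>

lemma reduced_below:
  assumes m: "m < d" and IH: "\<And>M. reduced (Suc m) M \<Longrightarrow> M \<in> K"
    and M: "reduced m M" and i: "m < i" "i < d" "M $$ (i, m) \<noteq> 0"
  shows "M \<in> K"
proof -
  have Mc: "M \<in> carrier_mat d d" using M by (simp add: reduced_def)
  let ?M = "addrow ((1 - M $$ (m, m)) / M $$ (i, m)) m i M"
  have "?M $$ (m, m) = 1" using Mc m i by simp
  moreover have "reduced m ?M" using reduced_addrow[OF M] m i by simp
  ultimately have "?M \<in> K" using reduced_pivot[OF m IH] by blast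
  then show ?thesis using addrow_imp[OF Mc m i(2)] i(1) by simp
qed

text \<open>If nothing nonzero stands below the pivot, invertibility makes the pivot itself nonzero.
  Before the last column it is copied one row down, which reduces to \<open>reduced_below\<close>;
  in the last column the matrix is triangular and the determinant forces the pivot to be 1.\<close>

lemma reduced_step:
  assumes m: "m < d" and IH: "\<And>M. reduced (Suc m) M \<Longrightarrow> M \<in> K" and M: "reduced m M"
  shows "M \<in> K"
proof (cases "\<exists>i. m < i \<and> i < d \<and> M $$ (i, m) \<noteq> 0")
  case True
  then show ?thesis using reduced_below[OF m IH M] by blast
next
  case False
  have col: "M $$ (i, j) = of_bool (i = j)" if "i < d" "j < m" for i j
    using M that by (auto simp: reduced_def)
  have Mc: "M \<in> carrier_mat d d" and det: "det M = 1" using M by (auto simp: reduced_def)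
  have nz: "M $$ (m, m) \<noteq> 0"
  proof
    assume z: "M $$ (m, m) = 0"
    \<comment> \<open>With a zero pivot, column \<open>m\<close> would be the combination of the
      first \<open>m\<close> unit columns with its own entries as coefficients; \<open>v\<close>
      records this dependence as a kernel vector.\<close>
    define v where "v = vec d (\<lambda>j. if j = m then 1 else if j < m then - M $$ (j, m) else 0)"
    have v: "v \<in> carrier_vec d" "v \<noteq> 0\<^sub>v d" using m by (auto simp: v_def vec_eq_iff)
    have "M *\<^sub>v v = 0\<^sub>v d"
    proof (rule eq_vecI)
      fix i assume "i < dim_vec (0\<^sub>v d :: 'f vec)"
      then have i: "i < d" by simp
      have "(M *\<^sub>v v) $ i = (\<Sum>j\<in>{0..<d}. M $$ (i, j) * v $ j)"
        using i Mc v by (auto simp: scalar_prod_def intro!: sum.cong)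
      also have "\<dots> = (\<Sum>j\<in>{0..<d}. (if j = m then M $$ (i, m) else 0) +
          (if j = i then if i < m then - M $$ (i, m) else 0 else 0))"
        using i col[OF i] by (intro sum.cong) (auto simp: v_def)
      also have "\<dots> = M $$ (i, m) + (if i < m then - M $$ (i, m) else 0)"
        using i m by (simp add: sum.distrib)
      also have "\<dots> = 0" using False z i by (cases i m rule: linorder_cases) auto
      finally show "(M *\<^sub>v v) $ i = 0\<^sub>v d $ i" using i by simp
    qed (use Mc in auto)
    then have "det M = 0" using det_0_iff_vec_prod_zero[OF Mc] v by blast
    then show False using det by simp
  qed
  show ?thesis
  proof (cases "Suc m < d")
    case True
    let ?M = "addrow 1 (Suc m) m M"
    have "reduced m ?M" using reduced_addrow[OF M] True by simp
    moreover have "?M $$ (Suc m, m) \<noteq> 0" using nz False True Mc by auto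
    ultimately have "?M \<in> K" using reduced_below[OF m IH] True by blast
    then show ?thesis using addrow_imp[OF Mc True m] by simp
  next
    case False
    then have dm: "d = Suc m" using m by simp
    have "upper_triangular M" using col Mc dm by (auto simp: upper_triangular_def)
    then have "det M = prod_list (diag_mat M)" using det_upper_triangular Mc by blast
    also have "\<dots> = (\<Prod>i<d. M $$ (i, i))"
      using Mc by (simp add: diag_mat_def prod.list_conv_set_nth[of "map _ _"] atLeast0LessThan)
    also have "\<dots> = M $$ (m, m)" unfolding dm using col dm by simp
    finally have "M $$ (m, m) = 1" using det by simp
    then show ?thesis using reduced_pivot[OF m IH M] by blast
  qed
qed

theorem SL_subset: "M \<in> carrier_mat d d \<Longrightarrow> det M = 1 \<Longrightarrow> M \<in> K"
proof -
  have "reduced m M \<longrightarrow> M \<in> K" if "m \<le> d" for m M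
    using that
  proof (induction m arbitrary: M rule: inc_induct)
    case base
    show ?case
    proof
      assume "reduced d M"
      then have "M = 1\<^sub>m d" by (intro eq_matI) (auto simp: reduced_def)
      then show "M \<in> K" using one by simp
    qed
  next
    case (step n)
    then show ?case using reduced_step[of n M] by blast
  qed
  from this[of 0 M] show "M \<in> carrier_mat d d \<Longrightarrow> det M = 1 \<Longrightarrow> M \<in> K"
    by (simp add: reduced_def)
qed

end

section \<open>Monomial matrices and a small generating set\<close>

text \<open>Row \<open>i\<close> has its entry in column \<open>p i\<close>. With this convention
  products compose the permutations in reverse order.\<close>

definition mon :: "nat \<Rightarrow> (nat \<Rightarrow> nat) \<Rightarrow> (nat \<Rightarrow> 'f) \<Rightarrow> 'f :: field mat" where
  "mon d p v = mat d d (\<lambda>(i, j). if j = p i then v i else 0)"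

lemma mon_carrier [simp]: "mon d p v \<in> carrier_mat d d"
  by (simp add: mon_def)

lemma mon_index: "i < d \<Longrightarrow> j < d \<Longrightarrow> mon d p v $$ (i, j) = (if j = p i then v i else 0)"
  by (simp add: mon_def)

lemma mon_cong: "(\<And>i. i < d \<Longrightarrow> p i = p' i \<and> v i = v' i) \<Longrightarrow> mon d p v = mon d p' v'"
  by (intro eq_matI) (auto simp: mon_def)

lemma mon_one: "mon d id (\<lambda>_. 1) = 1\<^sub>m d"
  by (intro eq_matI) (auto simp: mon_def)

lemma mon_mult:
  assumes "\<And>i. i < d \<Longrightarrow> p i < d"
  shows "mon d p v * mon d p' v' = mon d (p' \<circ> p) (\<lambda>i. v i * v' (p i))"
proof (rule eq_matI)
  fix i j
  assume "i < dim_row (mon d (p' \<circ> p) (\<lambda>i. v i * v' (p i)))"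
    "j < dim_col (mon d (p' \<circ> p) (\<lambda>i. v i * v' (p i)))"
  then have ij: "i < d" "j < d" by (simp_all add: mon_def)
  have "(mon d p v * mon d p' v') $$ (i, j) =
      (\<Sum>k\<in>{0..<d}. mon d p v $$ (i, k) * mon d p' v' $$ (k, j))"
    using ij by (simp add: mon_def scalar_prod_def)
  also have "\<dots> = (\<Sum>k\<in>{0..<d}. if k = p i then v i * (if j = p' k then v' k else 0) else 0)"
    using ij by (intro sum.cong) (auto simp: mon_index)
  also have "\<dots> = mon d (p' \<circ> p) (\<lambda>i. v i * v' (p i)) $$ (i, j)"
    using ij assms[OF ij(1)] by (simp add: mon_index)
  finally show "(mon d p v * mon d p' v') $$ (i, j) = mon d (p' \<circ> p) (\<lambda>i. v i * v' (p i)) $$ (i, j)" .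
qed (simp_all add: mon_def)

lemma det_mon:
  fixes v :: "nat \<Rightarrow> 'f :: field"
  assumes "p permutes {0..<d}"
  shows "det (mon d p v) = signof p * (\<Prod>i = 0..<d. v i)"
proof -
  have "(\<Prod>i = 0..<d. mon d p v $$ (i, q i)) = (if q = p then \<Prod>i = 0..<d. v i else 0)"
    if q: "q permutes {0..<d}" for q
  proof (cases "q = p")
    case True
    then show ?thesis using permutes_in_image[OF assms] by (simp add: mon_index)
  next
    case False
    have "\<exists>i\<in>{0..<d}. q i \<noteq> p i"
    proof (rule ccontr)
      assume "\<not> ?thesis"
      moreover have "q i = i" "p i = i" if "i \<notin> {0..<d}" for i
        using that q assms by (auto simp: permutes_def)
      ultimately have "q = p" by (intro ext) metis
      then show False using False by simp
    qed
    then obtain i where i: "i < d" "q i \<noteq> p i" by auto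
    have "q i < d" using permutes_in_image[OF q, of i] i by simp
    then have "mon d p v $$ (i, q i) = 0" using i by (simp add: mon_index)
    then have "(\<Prod>i = 0..<d. mon d p v $$ (i, q i)) = 0" using i by (intro prod_zero) auto
    then show ?thesis using False by simp
  qed
  then have "det (mon d p v) = (\<Sum>q | q permutes {0..<d}. if q = p then signof q * (\<Prod>i = 0..<d. v i) else 0)"
    unfolding det_def'[OF mon_carrier] by (intro sum.cong) auto
  then show ?thesis using assms by (simp add: finite_permutations)
qed

text \<open>Conjugation of a transvection by a monomial matrix permutes its position and rescales
  its parameter; written without inverses to stay among matrix products.\<close>

lemma mon_addrow_conj:
  fixes v :: "nat \<Rightarrow> 'f :: field"
  assumes p: "p permutes {0..<d}" and kl: "k < d" "l < d" "k \<noteq> l" and vl: "v l \<noteq> 0"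
  shows "mon d p v * addrow_mat d a (p k) (p l) = addrow_mat d (v k * a / v l) k l * mon d p v"
proof (rule eq_matI)
  have pd: "p i < d" if "i < d" for i using permutes_in_image[OF p, of i] that by simp
  have p_eq: "p i = p j \<longleftrightarrow> i = j" for i j using permutes_inj[OF p] by (auto dest: injD)
  fix i j
  assume "i < dim_row (addrow_mat d (v k * a / v l) k l * mon d p v)"
    "j < dim_col (addrow_mat d (v k * a / v l) k l * mon d p v)"
  then have ij: "i < d" "j < d" by (simp_all add: mon_def)
  have "(mon d p v * addrow_mat d a (p k) (p l)) $$ (i, j) =
      (\<Sum>m\<in>{0..<d}. mon d p v $$ (i, m) * addrow_mat d a (p k) (p l) $$ (m, j))"
    using ij by (simp add: mon_def scalar_prod_def)
  also have "\<dots> = (\<Sum>m\<in>{0..<d}. if m = p i then v i * addrow_mat d a (p k) (p l) $$ (m, j) else 0)"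
    using ij by (intro sum.cong) (auto simp: mon_index)
  also have "\<dots> = v i * addrow_mat d a (p k) (p l) $$ (p i, j)" using pd[OF ij(1)] by simp
  finally have L: "(mon d p v * addrow_mat d a (p k) (p l)) $$ (i, j) =
      v i * addrow_mat d a (p k) (p l) $$ (p i, j)" .
  have "(addrow_mat d (v k * a / v l) k l * mon d p v) $$ (i, j) =
      addrow (v k * a / v l) k l (mon d p v) $$ (i, j)"
    by (simp only: addrow_mat[OF mon_carrier kl(2)])
  then show "(mon d p v * addrow_mat d a (p k) (p l)) $$ (i, j) =
      (addrow_mat d (v k * a / v l) k l * mon d p v) $$ (i, j)"
    unfolding L using ij kl vl pd[OF ij(1)]
    by (auto simp: mon_index mon_def p_eq algebra_simps)
qed (simp_all add: mon_def)

text \<open>The Steinberg commutator relation, again in a form free of inverses.\<close>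

lemma addrow_mat_commutator:
  fixes a b :: "'f :: field"
  assumes "i < d" "j < d" "k < d" "i \<noteq> j" "j \<noteq> k" "i \<noteq> k"
  shows "addrow_mat d a i j * addrow_mat d b j k =
    addrow_mat d (a * b) i k * (addrow_mat d b j k * addrow_mat d a i j)"
proof -
  have "addrow_mat d a i j * addrow_mat d b j k = addrow a i j (addrow_mat d b j k)"
    by (rule addrow_mat[symmetric]) (use assms in auto)
  also have "\<dots> = addrow (a * b) i k (addrow b j k (addrow_mat d a i j))"
    using assms by (intro eq_matI) auto
  also have "addrow b j k (addrow_mat d a i j) = addrow_mat d b j k * addrow_mat d a i j"
    by (rule addrow_mat) (use assms in auto)
  also have "addrow (a * b) i k \<dots> = addrow_mat d (a * b) i k * (addrow_mat d b j k * addrow_mat d a i j)"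
    by (rule addrow_mat) (use assms in auto)
  finally show ?thesis .
qed

section \<open>Generation of SL_d by a 3-cycle, a torus element and few transvections\<close>

definition rot :: "nat \<Rightarrow> nat" where "rot = transpose 0 1 \<circ> transpose 1 2"

lemma rot_simps [simp]: "rot 0 = 1" "rot (Suc 0) = 2" "rot 2 = 0" "3 \<le> i \<Longrightarrow> rot i = i"
  by (auto simp: rot_def transpose_def)

lemma rot_permutes: "3 \<le> d \<Longrightarrow> rot permutes {0..<d}"
  unfolding rot_def by (intro permutes_compose permutes_swap_id) auto

text \<open>Positions 3 and 4 serve two ends: conjugation changes the parameter of a transvection at
  (2, 3) by a factor that generates the multiplicative group, and the unequal entries at 3 and 4
  will keep the matrix out of the subgroup \<open>H\<close>.\<close>

definition split_torus :: "nat \<Rightarrow> 'f :: field \<Rightarrow> 'f mat" where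
  "split_torus d s = mon d id (\<lambda>i. if i = 3 then s else if i = 4 then inverse s else 1)"

lemma mat_SL_simps [simp]:
  "carrier (SL TYPE('f :: field) d) = {M \<in> carrier_mat d d. det M = 1}"
  "A \<otimes>\<^bsub>SL TYPE('f) d\<^esub> B = A * B" "\<one>\<^bsub>SL TYPE('f) d\<^esub> = 1\<^sub>m d"
  by (simp_all add: SL_def)

text \<open>The torus element yields all parameters at position (2, 3). Commutators with the given
  transvections through index 2 spread them to all positions with indices in {2,...,d-1}, and the
  3-cycle carries index 2 to 1 and to 0.\<close>

lemma SL_subgroup_top:
  fixes K :: "'f :: field mat set"
  assumes d: "5 \<le> d" and K: "subgroup K (SL TYPE('f) d)"
    and s0: "s \<noteq> 0" and s: "\<And>a :: 'f. a \<noteq> 0 \<Longrightarrow> \<exists>n :: nat. a = s ^ n"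
    and rotK: "mon d rot (\<lambda>_. 1) \<in> K" and torK: "split_torus d s \<in> K"
    and out: "\<And>k. 3 \<le> k \<Longrightarrow> k < d \<Longrightarrow> addrow_mat d 1 2 k \<in> K"
    and inn: "\<And>k. 3 \<le> k \<Longrightarrow> k < d \<Longrightarrow> addrow_mat d 1 k 2 \<in> K"
  shows "K = carrier (SL TYPE('f) d)"
proof -
  interpret SL: group "SL TYPE('f) d" by (rule group_SL)
  let ?X = "\<lambda>i j a. addrow_mat d a i j"
  have Kc: "A \<in> carrier_mat d d" if "A \<in> K" for A using subgroup.mem_carrier[OF K that] by simp
  have mult: "A * B \<in> K" if "A \<in> K" "B \<in> K" for A B using subgroup.m_closed[OF K that] by simp
  have cancel: "A \<in> K" if AB: "A * B \<in> K" and B: "B \<in> K" and A: "A \<in> carrier_mat d d" for A B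
  proof -
    define B' where "B' = inv\<^bsub>SL TYPE('f) d\<^esub> B"
    have B': "B' \<in> K" unfolding B'_def by (rule subgroup.m_inv_closed[OF K B])
    have "B * B' = 1\<^sub>m d"
      using SL.r_inv[OF subgroup.mem_carrier[OF K B]] by (simp add: B'_def)
    then have "(A * B) * B' = A" using assoc_mult_mat[OF A Kc[OF B] Kc[OF B']] A by simp
    then show ?thesis using mult[OF AB B'] by simp
  qed
  have conj: "?X k l (v k * a / v l) \<in> K"
    if M: "mon d p v \<in> K" and p: "p permutes {0..<d}" and kl: "k < d" "l < d" "k \<noteq> l" "v l \<noteq> 0"
      and X: "?X (p k) (p l) a \<in> K" for p v k l and a :: 'f
  proof (rule cancel[OF _ M])
    show "?X k l (v k * a / v l) * mon d p v \<in> K"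
      using mult[OF M X] mon_addrow_conj[OF p kl(1-3), of v a] kl(4) by simp
  qed simp
  have comm: "?X i k (a * b) \<in> K"
    if "?X i j a \<in> K" "?X j k b \<in> K" "i < d" "j < d" "k < d" "i \<noteq> j" "j \<noteq> k" "i \<noteq> k"
    for i j k and a b :: 'f
  proof (rule cancel)
    show "?X i k (a * b) * (?X j k b * ?X i j a) \<in> K"
      using mult[OF that(1,2)] addrow_mat_commutator[OF that(3-8), of a b] by simp
    show "?X j k b * ?X i j a \<in> K" using mult[OF that(2,1)] .
  qed simp
  have one: "1\<^sub>m d \<in> K" using subgroup.one_closed[OF K] by simp
  have zero: "?X i j (0 :: 'f) = 1\<^sub>m d" if "i < d" "j < d" "i \<noteq> j" for i j
    using that by (intro eq_matI) auto
  have X23: "?X 2 3 a \<in> K" for a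
  proof (cases "a = 0")
    case True
    then show ?thesis using zero[of 2 3] one d by simp
  next
    case False
    \<comment> \<open>Conjugation by the torus element divides the parameter by \<open>s\<close>, so
      it is \<open>inverse a\<close> that is written as a power.\<close>
    then obtain n where n: "inverse a = s ^ n" using s[of "inverse a"] by auto
    have "?X 2 3 (inverse (s ^ n)) \<in> K" for n
    proof (induction n)
      case 0
      then show ?case using out[of 3] d by simp
    next
      case (Suc n)
      have "?X 2 3 (1 * inverse (s ^ n) / s) \<in> K"
        using conj[of id "\<lambda>i. if i = 3 then s else if i = 4 then inverse s else 1" 2 3 "inverse (s ^ n)"]
          torK s0 d Suc by (simp add: split_torus_def permutes_id)
      then show ?case by (simp add: field_simps)
    qed
    from this[of n] show ?thesis using n by (metis inverse_inverse_eq)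
  qed
  have X3k: "?X k l 1 \<in> K" if "3 \<le> k" "k < d" "3 \<le> l" "l < d" "k \<noteq> l" for k l
    using comm[OF inn[of k] out[of l]] that by simp
  have X2k: "?X 2 k a \<in> K" if "3 \<le> k" "k < d" for k a
  proof (cases "k = 3")
    case True
    then show ?thesis using X23 by simp
  next
    case False
    then show ?thesis using comm[OF X23[of a] X3k[of 3 k]] that d by simp
  qed
  have Xkl: "?X k l a \<in> K" if "3 \<le> k" "k < d" "3 \<le> l" "l < d" "k \<noteq> l" for k l a
    using comm[OF inn[of k] X2k[of l a]] that by simp
  have Xk2: "?X k 2 a \<in> K" if "3 \<le> k" "k < d" for k a
  proof -
    \<comment> \<open>A second index of at least 3 is required; 3 and 4 are both available since
      \<open>5 \<le> d\<close>.\<close>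
    obtain l where l: "3 \<le> l" "l < d" "l \<noteq> k" using d by (cases "k = 3") (auto intro: that[of 4] that[of 3])
    then show ?thesis using comm[OF Xkl[of k l a] inn[of l]] that by simp
  qed
  have rotate: "?X i j a \<in> K" if "?X (rot i) (rot j) a \<in> K" "i < d" "j < d" "i \<noteq> j" for i j a
    using conj[OF rotK rot_permutes that(2-4) _ that(1)] d by simp
  have X1: "?X 1 k a \<in> K" "?X k 1 a \<in> K" if "3 \<le> k" "k < d" for k a
    using rotate[of a 1 k] rotate[of a k 1] X2k[OF that] Xk2[OF that] that by simp_all
  have X0: "?X 0 k a \<in> K" "?X k 0 a \<in> K" if "3 \<le> k" "k < d" for k a
    using rotate[of a 0 k] rotate[of a k 0] X1[OF that] that by simp_all
  have low: "i = 0 \<or> i = 1 \<or> i = 2" if "\<not> 3 \<le> i" for i :: nat using that by auto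
  have right: "?X i k a \<in> K" "?X k i a \<in> K" if "\<not> 3 \<le> i" "3 \<le> k" "k < d" for i k a
    using low[OF that(1)] X0[OF that(2,3)] X1[OF that(2,3)] X2k[OF that(2,3)] Xk2[OF that(2,3)] by auto
  have all: "?X i j a \<in> K" if "i < d" "j < d" "i \<noteq> j" for i j a
  proof (cases "3 \<le> i")
    case True
    then show ?thesis using Xkl right(2) that by (cases "3 \<le> j") auto
  next
    case i: False
    show ?thesis
    proof (cases "3 \<le> j")
      case True
      then show ?thesis using right(1) i that by auto
    next
      case False
      \<comment> \<open>Two indices below 3 are connected by a commutator through index 3.\<close>
      have "?X i 3 a \<in> K" "?X 3 j 1 \<in> K" using right i False d by simp_all
      from comm[OF this] show ?thesis using i False that d by simp
    qed
  qed
  interpret transvection_closed d K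
    by unfold_locales (use one mult all in auto)
  show ?thesis using SL_subset subgroup.subset[OF K] by auto
qed

lemma finite_field_primitive:
  obtains s :: "'f :: {finite, field}" where "s \<noteq> 0" "\<And>a. a \<noteq> 0 \<Longrightarrow> \<exists>n :: nat. a = s ^ n"
proof -
  let ?R = "class_ring :: 'f ring"
  have "\<exists>s\<in>carrier (mult_of ?R). carrier (mult_of ?R) = {s [^]\<^bsub>?R\<^esub> i | i :: nat. i \<in> UNIV}"
    by (rule field.finite_field_mult_group_has_gen[OF class_field]) simp
  then obtain s where s: "s \<in> carrier (mult_of ?R)"
    "carrier (mult_of ?R) = {s [^]\<^bsub>?R\<^esub> i | i :: nat. i \<in> UNIV}"
    by blast
  have "s [^]\<^bsub>?R\<^esub> n = s ^ n" for n :: nat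
    by (induction n) (simp_all add: mult.commute)
  then show ?thesis using s by (intro that[of s]) auto
qed

text \<open>If \<open>s ^ m\<close> were 1, the powers of \<open>s\<close> would take at most
  \<open>m\<close> values, too few to cover the nonzero elements.\<close>

lemma primitive_power_neq_one:
  fixes s :: "'f :: {finite, field}"
  assumes s: "s \<noteq> 0" "\<And>a. a \<noteq> 0 \<Longrightarrow> \<exists>n :: nat. a = s ^ n" and m: "0 < m" "m < CARD('f) - 1"
  shows "s ^ m \<noteq> 1"
proof
  assume "s ^ m = 1"
  have "UNIV - {0} \<subseteq> (\<lambda>n. s ^ n) ` {..<m}"
  proof
    fix a :: 'f assume "a \<in> UNIV - {0}"
    then obtain n where "a = s ^ n" using s(2) by auto
    also have "\<dots> = s ^ (m * (n div m) + n mod m)" by simp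
    also have "\<dots> = s ^ (n mod m)"
      unfolding power_add power_mult \<open>s ^ m = 1\<close> by simp
    finally show "a \<in> (\<lambda>n. s ^ n) ` {..<m}" using m by auto
  qed
  then have "card (UNIV - {0 :: 'f}) \<le> card {..<m}" by (rule surj_card_le[rotated]) simp
  then show False using m by (simp add: card_Diff_singleton)
qed

section \<open>The switching configuration in the projective special linear group\<close>

definition proj :: "nat \<Rightarrow> 'f :: field mat \<Rightarrow> 'f mat set" where
  "proj d A = group_center (SL TYPE('f) d) #>\<^bsub>SL TYPE('f) d\<^esub> A"

lemma proj_hom: "proj d \<in> hom (SL TYPE('f :: field) d) (PSL TYPE('f) d)"
  unfolding proj_def[abs_def] PSL_def
  by (intro normal.r_coset_hom_Mod normal_group_center group_SL)

lemma carrier_PSL: "carrier (PSL TYPE('f :: field) d) = proj d ` carrier (SL TYPE('f) d)"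
  by (auto simp: PSL_def FactGroup_def RCOSETS_def proj_def)

lemma card_carrier_mat:
  "card (carrier_mat a b :: 'f :: finite mat set) = CARD('f) ^ (a * b) \<and> finite (carrier_mat a b :: 'f mat set)"
proof -
  let ?I = "{0..<a} \<times> {0..<b}"
  have "bij_betw (\<lambda>g. mat a b g) (?I \<rightarrow>\<^sub>E (UNIV :: 'f set)) (carrier_mat a b)"
  proof (rule bij_betwI[where g = "\<lambda>A. restrict (\<lambda>ij. A $$ ij) ?I"])
    show "(\<lambda>g. mat a b g) \<in> (?I \<rightarrow>\<^sub>E (UNIV :: 'f set)) \<rightarrow> carrier_mat a b" by auto
    show "(\<lambda>A. restrict (\<lambda>ij. A $$ ij) ?I) \<in> carrier_mat a b \<rightarrow> ?I \<rightarrow>\<^sub>E (UNIV :: 'f set)"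
      by (intro funcsetI) simp
    show "restrict (\<lambda>ij. mat a b g $$ ij) ?I = g" if g: "g \<in> ?I \<rightarrow>\<^sub>E UNIV" for g :: "nat \<times> nat \<Rightarrow> 'f"
    proof (rule PiE_ext[OF _ g])
      show "restrict (\<lambda>ij. mat a b g $$ ij) ?I \<in> ?I \<rightarrow>\<^sub>E UNIV" by simp
      show "restrict (\<lambda>ij. mat a b g $$ ij) ?I x = g x" if "x \<in> ?I" for x using that by auto
    qed
    show "mat a b (restrict (\<lambda>ij. A $$ ij) ?I) = A" if "A \<in> carrier_mat a b" for A :: "'f mat"
      by (rule eq_matI) (simp_all add: carrier_matD[OF that])
  qed
  note * = bij_betw_same_card[OF this] bij_betw_finite[OF this]
  show ?thesis unfolding *(1)[symmetric] *(2)[symmetric]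
    by (simp add: card_PiE finite_PiE card_cartesian_product)
qed

lemma finite_SL: "finite (carrier (SL TYPE('f :: {finite, field}) n))"
  by (rule finite_subset[of _ "carrier_mat n n"]) (use card_carrier_mat in auto)

lemma finite_PSL: "finite (carrier (PSL TYPE('f :: {finite, field}) d))"
  unfolding carrier_PSL by (rule finite_imageI[OF finite_SL])

text \<open>Commuting with the transvection at (k, l) gives the entrywise relation
  \<open>key\<close>. Suitable positions in it kill the off-diagonal entries and equate the diagonal
  ones with the first.\<close>

lemma center_SL_scalar:
  fixes z :: "'f :: field mat"
  assumes z: "z \<in> group_center (SL TYPE('f) d)" and ij: "i < d" "j < d"
  shows "z $$ (i, j) = (if i = j then z $$ (0, 0) else 0)"
proof -
  have zc: "z \<in> carrier_mat d d" using z by (simp add: group_center_def)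
  have key: "(if b = l then z $$ (a, k) else 0) = (if a = k then z $$ (l, b) else 0)"
    if "k < d" "l < d" "k \<noteq> l" "a < d" "b < d" for k l a b
  proof -
    have "addrow_mat d 1 k l \<in> carrier (SL TYPE('f) d)" using that det_addrow_mat by simp
    then have comm: "z * addrow_mat d 1 k l = addrow_mat d 1 k l * z"
      using z by (auto simp: group_center_def)
    have "(z * addrow_mat d 1 k l) $$ (a, b) = (\<Sum>m\<in>{0..<d}. z $$ (a, m) * addrow_mat d 1 k l $$ (m, b))"
      using that zc by (simp add: scalar_prod_def)
    also have "\<dots> = (\<Sum>m\<in>{0..<d}. (if m = b then z $$ (a, b) else 0) +
        (if m = k then if b = l then z $$ (a, k) else 0 else 0))"
      using that by (intro sum.cong) auto
    also have "\<dots> = z $$ (a, b) + (if b = l then z $$ (a, k) else 0)"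
      using that by (simp add: sum.distrib)
    finally have 1: "(z * addrow_mat d 1 k l) $$ (a, b) = z $$ (a, b) + (if b = l then z $$ (a, k) else 0)" .
    have "addrow_mat d 1 k l * z = addrow 1 k l z" by (rule addrow_mat[OF zc that(2), symmetric])
    then have "(addrow_mat d 1 k l * z) $$ (a, b) = z $$ (a, b) + (if a = k then z $$ (l, b) else 0)"
      using that zc by simp
    then show ?thesis using 1 comm by simp
  qed
  show ?thesis
  proof (cases "i = j")
    case True
    show ?thesis
    proof (cases "i = 0")
      case False
      then show ?thesis using key[of 0 i 0 i] True ij by simp
    qed (use True in simp)
  next
    case False
    then show ?thesis using key[of j i i i] ij by simp
  qed
qed

text \<open>The two matrices differ by a central, hence scalar, factor. Every later proof that
  elements of PSL are distinct goes through this proportionality of entries.\<close>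

lemma proj_eqD:
  fixes A B :: "'f :: field mat"
  assumes A: "A \<in> carrier (SL TYPE('f) d)" and B: "B \<in> carrier (SL TYPE('f) d)"
    and eq: "proj d A = proj d B"
  obtains c where "\<And>i j. i < d \<Longrightarrow> j < d \<Longrightarrow> A $$ (i, j) = c * B $$ (i, j)"
proof -
  interpret SL: group "SL TYPE('f) d" by (rule group_SL)
  let ?Z = "group_center (SL TYPE('f) d)"
  have "A \<in> ?Z #>\<^bsub>SL TYPE('f) d\<^esub> A"
    by (rule SL.rcos_self[OF A normal_imp_subgroup[OF normal_group_center[OF group_SL]]])
  then have "A \<in> ?Z #>\<^bsub>SL TYPE('f) d\<^esub> B" using eq by (simp add: proj_def)
  then obtain z where z: "z \<in> ?Z" "A = z * B" by (auto simp: r_coset_def)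
  have zc: "z \<in> carrier_mat d d" using z by (simp add: group_center_def)
  have Bc: "B \<in> carrier_mat d d" using B by simp
  have "A $$ (i, j) = z $$ (0, 0) * B $$ (i, j)" if ij: "i < d" "j < d" for i j
  proof -
    have "A $$ (i, j) = (\<Sum>m\<in>{0..<d}. z $$ (i, m) * B $$ (m, j))"
      unfolding z(2) using ij carrier_matD[OF zc] carrier_matD[OF Bc] by (simp add: scalar_prod_def)
    also have "\<dots> = (\<Sum>m\<in>{0..<d}. if m = i then z $$ (0, 0) * B $$ (i, j) else 0)"
    proof (rule sum.cong[OF refl])
      fix m assume "m \<in> {0..<d}"
      then have "z $$ (i, m) = (if i = m then z $$ (0, 0) else 0)"
        by (intro center_SL_scalar[OF z(1) ij(1)]) simp
      then show "z $$ (i, m) * B $$ (m, j) = (if m = i then z $$ (0, 0) * B $$ (i, j) else 0)" by auto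
    qed
    finally show ?thesis using ij by simp
  qed
  then show ?thesis by (rule that)
qed

section \<open>Monomial matrices realising S_3, the involution and the commuting subgroup\<close>

locale psl =
  fixes d :: nat and s :: "'f :: {finite, field}"
  assumes d: "5 \<le> d" and q: "100 < CARD('f)" and s0: "s \<noteq> 0"
    and s: "\<And>a. a \<noteq> 0 \<Longrightarrow> \<exists>n :: nat. a = s ^ n"
begin

abbreviation "S \<equiv> SL TYPE('f) d"
abbreviation "G \<equiv> PSL TYPE('f) d"
abbreviation "\<pi> \<equiv> proj d"

definition sw01 :: "nat \<Rightarrow> nat" where "sw01 = transpose 0 1"
definition sw34 :: "nat \<Rightarrow> nat" where "sw34 = transpose 3 4"
text \<open>A transposition has determinant -1, and three sign changes correct it. The signs are
  constant on {0, 1, 2} and on {3, 4}, which the permutations in use preserve, so the relations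
  among permutations lift.\<close>

definition sgn3 :: "nat \<Rightarrow> 'f" where "sgn3 i = (if i < 3 then - 1 else 1)"
text \<open>Constant on the blocks {0, 1, 2} and {3, 4}, so that the diagonal matrix commutes with
  \<open>wM\<close>, \<open>cM\<close> and \<open>yM\<close>; its determinant is
  \<open>a ^ 3 * b ^ 2\<close>.\<close>

definition bl :: "'f \<Rightarrow> 'f \<Rightarrow> nat \<Rightarrow> 'f" where "bl a b i = (if i < 3 then a else if i < 5 then b else 1)"
definition wM :: "'f mat" where "wM = mon d rot (\<lambda>_. 1)"
definition cM :: "'f mat" where "cM = mon d sw01 sgn3"
definition yM :: "'f mat" where "yM = mon d sw34 sgn3"
definition bM :: "'f \<Rightarrow> 'f \<Rightarrow> 'f mat" where "bM a b = mon d id (bl a b)"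
definition \<F> :: "'f mat set set" where "\<F> = {\<pi> (bM a b) | a b. a ^ 3 * b ^ 2 = 1}"

lemma index_values:
  "rot 0 = Suc 0" "rot (Suc 0) = 2" "rot 2 = 0" "rot 3 = 3" "rot 4 = 4" "5 \<le> i \<Longrightarrow> rot i = i"
  "sw01 0 = Suc 0" "sw01 (Suc 0) = 0" "sw01 2 = 2" "sw01 3 = 3" "sw01 4 = 4" "5 \<le> i \<Longrightarrow> sw01 i = i"
  "sw34 0 = 0" "sw34 (Suc 0) = Suc 0" "sw34 2 = 2" "sw34 3 = 4" "sw34 4 = 3" "5 \<le> i \<Longrightarrow> sw34 i = i"
  "sgn3 0 = - 1" "sgn3 (Suc 0) = - 1" "sgn3 2 = - 1" "sgn3 3 = 1" "sgn3 4 = 1" "5 \<le> i \<Longrightarrow> sgn3 i = 1"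
  "bl a b 0 = a" "bl a b (Suc 0) = a" "bl a b 2 = a" "bl a b 3 = b" "bl a b 4 = b" "5 \<le> i \<Longrightarrow> bl a b i = 1"
  by (simp_all add: rot_def sw01_def sw34_def transpose_def sgn3_def bl_def)

text \<open>The index functions in use are trivial from 5 on, so matrix identities for arbitrary
  \<open>d\<close> reduce to five evaluations.\<close>

lemma mon_cong_five:
  assumes "p 0 = p' 0 \<and> v 0 = v' 0" "p (Suc 0) = p' (Suc 0) \<and> v (Suc 0) = v' (Suc 0)"
    "p 2 = p' 2 \<and> v 2 = v' 2" "p 3 = p' 3 \<and> v 3 = v' 3" "p 4 = p' 4 \<and> v 4 = v' 4"
    "\<And>i. 5 \<le> i \<Longrightarrow> p i = p' i \<and> v i = v' i"
  shows "mon d p v = mon d p' v'"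
proof (rule mon_cong)
  fix i
  have "i = 0 \<or> i = Suc 0 \<or> i = 2 \<or> i = 3 \<or> i = 4 \<or> 5 \<le> i" by linarith
  then show "p i = p' i \<and> v i = v' i" using assms by metis
qed

lemma prod_first_five: "(\<And>i. 5 \<le> i \<Longrightarrow> v i = 1) \<Longrightarrow> (\<Prod>i = 0..<d. v i :: 'f) = v 0 * v 1 * v 2 * v 3 * v 4"
proof -
  assume v: "\<And>i. 5 \<le> i \<Longrightarrow> v i = 1"
  have "(\<Prod>i = 0..<d. v i) = (\<Prod>i\<in>{0, 1, 2, 3, 4}. v i)"
    using d v by (intro prod.mono_neutral_right) auto
  then show ?thesis by (simp add: mult.assoc)
qed

lemma perms: "rot permutes {0..<d}" "sw01 permutes {0..<d}" "sw34 permutes {0..<d}"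
  using d by (auto simp: sw01_def sw34_def intro: rot_permutes permutes_swap_id)

lemma S_mem: "wM \<in> carrier S" "cM \<in> carrier S" "yM \<in> carrier S"
  "a ^ 3 * b ^ 2 = 1 \<Longrightarrow> bM a b \<in> carrier S"
proof -
  have "sign rot = 1" unfolding rot_def by (simp add: sign_compose permutation_swap_id sign_swap_id)
  then show "wM \<in> carrier S" by (simp add: wM_def det_mon[OF perms(1)])
  have "det cM = 1" "det yM = 1"
    unfolding cM_def yM_def det_mon[OF perms(2)] det_mon[OF perms(3)]
    by (simp_all add: prod_first_five sgn3_def sw01_def sw34_def sign_swap_id)
  then show "cM \<in> carrier S" "yM \<in> carrier S" by (simp_all add: cM_def yM_def)
  show "bM a b \<in> carrier S" if "a ^ 3 * b ^ 2 = 1"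
    using that by (simp add: bM_def det_mon[OF permutes_id] prod_first_five bl_def
        power3_eq_cube power2_eq_square mult.assoc)
qed

lemma S_mult: "A \<in> carrier S \<Longrightarrow> B \<in> carrier S \<Longrightarrow> A * B \<in> carrier S"
  by (auto simp: det_mult)

lemma \<pi>_mult: "A \<in> carrier S \<Longrightarrow> B \<in> carrier S \<Longrightarrow> \<pi> A \<otimes>\<^bsub>G\<^esub> \<pi> B = \<pi> (A * B)"
  by (subst mat_SL_simps(2)[symmetric], rule hom_mult[OF proj_hom, symmetric])

lemma \<pi>_one: "\<one>\<^bsub>G\<^esub> = \<pi> (1\<^sub>m d)"
  by (subst mat_SL_simps(3)[symmetric], rule hom_one[OF proj_hom group_SL group_PSL, symmetric])

lemma \<pi>_carrier: "A \<in> carrier S \<Longrightarrow> \<pi> A \<in> carrier G"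
  by (simp add: carrier_PSL)

lemma mon_mult_perm:
  assumes "p permutes {0..<d}"
  shows "mon d p v * mon d p' v' = mon d (p' \<circ> p) (\<lambda>i. v i * v' (p i))"
  using permutes_in_image[OF assms] by (intro mon_mult) auto

lemma matrix_relations:
  "wM * (wM * wM) = 1\<^sub>m d" "cM * cM = 1\<^sub>m d" "yM * yM = 1\<^sub>m d" "cM * wM = wM * (wM * cM)"
  "wM * yM = yM * wM" "cM * yM = yM * cM" "wM * bM a b = bM a b * wM" "cM * bM a b = bM a b * cM"
  "bM a b * yM = yM * bM a b" "bM a b * bM a' b' = bM (a * a') (b * b')"
  unfolding wM_def cM_def yM_def bM_def mon_mult_perm[OF perms(1)] mon_mult_perm[OF perms(2)]
    mon_mult_perm[OF perms(3)] mon_mult_perm[OF permutes_id] mon_one[symmetric]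
  by (rule mon_cong_five; simp add: index_values)+

text \<open>Proportional matrices have their nonzero entries in the same places, so the permutation
  survives the passage to PSL.\<close>

lemma mon_entries_eq:
  assumes "mon d p v \<in> carrier S" "mon d p' v' \<in> carrier S" "\<pi> (mon d p v) = \<pi> (mon d p' v')"
    and "i < d" "p i < d" "v i \<noteq> 0"
  shows "p i = p' i"
proof -
  obtain c where "mon d p v $$ (i, p i) = c * mon d p' v' $$ (i, p i)"
    using proj_eqD[OF assms(1-3)] assms(4,5) by metis
  then show ?thesis using assms(4-6) by (auto simp: mon_index split: if_splits)
qed

end

lemma (in group_hom) subgroup_vimage:
  assumes K: "subgroup K H"
  shows "subgroup {x \<in> carrier G. h x \<in> K} G"
proof (rule G.subgroupI)
  show "{x \<in> carrier G. h x \<in> K} \<noteq> {}" using subgroup.one_closed[OF K] G.one_closed hom_one by auto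
qed (auto simp: subgroup.m_inv_closed[OF K] subgroup.m_closed[OF K])

context psl
begin

abbreviation "w \<equiv> \<pi> wM"
abbreviation "c \<equiv> \<pi> cM"
abbreviation "y \<equiv> \<pi> yM"

text \<open>Every element of \<open>sw.H\<close> has such a representative; the additional generators in \<open>\<D>\<close> do not.\<close>

definition rep :: "'f mat set \<Rightarrow> (nat \<Rightarrow> nat) \<Rightarrow> (nat \<Rightarrow> 'f) \<Rightarrow> bool" where
  "rep x p v \<longleftrightarrow> x = \<pi> (mon d p v) \<and> mon d p v \<in> carrier S \<and> p permutes {0..<d} \<and> (\<forall>i. v i \<noteq> 0) \<and>
    p 3 \<in> {3, 4} \<and> p 4 \<in> {3, 4} \<and> v 3 = v 4"

lemma rep_mult:
  assumes "rep x p v" "rep x' p' v'"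
  shows "rep (x \<otimes>\<^bsub>G\<^esub> x') (p' \<circ> p) (\<lambda>i. v i * v' (p i))"
proof -
  have mm: "mon d p v * mon d p' v' = mon d (p' \<circ> p) (\<lambda>i. v i * v' (p i))"
    using assms by (intro mon_mult_perm) (simp add: rep_def)
  have "x \<otimes>\<^bsub>G\<^esub> x' = \<pi> (mon d (p' \<circ> p) (\<lambda>i. v i * v' (p i)))"
    unfolding mm[symmetric] using assms \<pi>_mult unfolding rep_def by blast
  moreover have "mon d (p' \<circ> p) (\<lambda>i. v i * v' (p i)) \<in> carrier S"
    unfolding mm[symmetric] using assms S_mult unfolding rep_def by blast
  ultimately show ?thesis using assms unfolding rep_def
    by (auto intro: permutes_compose)
qed

lemma rep_basic:
  "rep \<one>\<^bsub>G\<^esub> id (\<lambda>_. 1)" "rep w rot (\<lambda>_. 1)" "rep c sw01 sgn3" "rep y sw34 sgn3"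
  "a ^ 3 * b ^ 2 = 1 \<Longrightarrow> rep (\<pi> (bM a b)) id (bl a b)"
proof -
  show "rep \<one>\<^bsub>G\<^esub> id (\<lambda>_. 1)"
    by (simp add: rep_def \<pi>_one mon_one permutes_id)
  show "rep w rot (\<lambda>_. 1)" "rep c sw01 sgn3" "rep y sw34 sgn3"
    using S_mem(1-3) perms by (simp_all add: rep_def wM_def cM_def yM_def index_values sgn3_def)
  assume ab: "a ^ 3 * b ^ 2 = 1"
  then have "a \<noteq> 0" "b \<noteq> 0" by auto
  then show "rep (\<pi> (bM a b)) id (bl a b)"
    using S_mem(4)[OF ab] by (simp add: rep_def bM_def permutes_id index_values) (simp add: bl_def)
qed

lemma rep_unique:
  assumes "rep x p v" "rep x p' v'" "i < d"
  shows "p i = p' i"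
proof (rule mon_entries_eq[of p v p' v' i])
  show "mon d p v \<in> carrier S" "mon d p' v' \<in> carrier S" "v i \<noteq> 0" "i < d"
    using assms unfolding rep_def by blast+
  show "\<pi> (mon d p v) = \<pi> (mon d p' v')" using assms unfolding rep_def by metis
  show "p i < d" using assms permutes_in_image[of p "{0..<d}" i] by (simp add: rep_def)
qed

lemma \<F>_I: "a ^ 3 * b ^ 2 = 1 \<Longrightarrow> \<pi> (bM a b) \<in> \<F>"
  by (auto simp: \<F>_def)

lemma \<F>_E:
  assumes "z \<in> \<F>"
  obtains a b where "z = \<pi> (bM a b)" "a ^ 3 * b ^ 2 = 1" "a \<noteq> 0" "b \<noteq> 0"
proof -
  obtain a b where "z = \<pi> (bM a b)" "a ^ 3 * b ^ 2 = 1" using assms by (auto simp: \<F>_def)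
  moreover from this(2) have "a \<noteq> 0" "b \<noteq> 0" by auto
  ultimately show ?thesis by (rule that)
qed

lemma bM_mult:
  "a ^ 3 * b ^ 2 = 1 \<Longrightarrow> a' ^ 3 * b' ^ 2 = 1 \<Longrightarrow> \<pi> (bM a b) \<otimes>\<^bsub>G\<^esub> \<pi> (bM a' b') = \<pi> (bM (a * a') (b * b'))"
  using \<pi>_mult[OF S_mem(4) S_mem(4)] by (simp only: matrix_relations(10))

lemma bM_one: "\<pi> (bM 1 1) = \<one>\<^bsub>G\<^esub>"
proof -
  have "bM 1 1 = mon d id (\<lambda>_. 1)"
    unfolding bM_def by (rule mon_cong_five; simp add: index_values)
  then show ?thesis by (simp add: mon_one \<pi>_one)
qed

lemma \<F>_subgroup: "subgroup \<F> G"
proof -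
  interpret G: group G by (rule group_PSL)
  have cl: "a ^ 3 * b ^ 2 = 1 \<Longrightarrow> a' ^ 3 * b' ^ 2 = 1 \<Longrightarrow> (a * a') ^ 3 * (b * b') ^ 2 = 1" for a b a' b' :: 'f
    by (simp add: power_mult_distrib algebra_simps)
  show ?thesis
  proof (rule G.subgroupI)
    show "\<F> \<subseteq> carrier G" using \<pi>_carrier S_mem(4) unfolding \<F>_def by blast
    show "\<F> \<noteq> {}" using \<F>_I[of 1 1] by auto
    show "inv\<^bsub>G\<^esub> z \<in> \<F>" if "z \<in> \<F>" for z
    proof (rule \<F>_E[OF that])
      fix a b assume z: "z = \<pi> (bM a b)" "a ^ 3 * b ^ 2 = 1" "a \<noteq> 0" "b \<noteq> 0"
      have i: "inverse a ^ 3 * inverse b ^ 2 = 1"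
        using z(2) by (simp add: power_inverse nonzero_inverse_mult_distrib[symmetric] mult.commute flip: inverse_mult_distrib)
      have "\<pi> (bM (inverse a) (inverse b)) \<otimes>\<^bsub>G\<^esub> z = \<one>\<^bsub>G\<^esub>"
        unfolding z(1) bM_mult[OF i z(2)] using z(3,4) by (simp add: bM_one)
      then have "inv\<^bsub>G\<^esub> z = \<pi> (bM (inverse a) (inverse b))"
        unfolding z(1) by (intro G.inv_equality \<pi>_carrier S_mem(4) i z(2))
      then show ?thesis using \<F>_I[OF i] by simp
    qed
    show "z \<otimes>\<^bsub>G\<^esub> z' \<in> \<F>" if z: "z \<in> \<F>" and z': "z' \<in> \<F>" for z z'
    proof (rule \<F>_E[OF z], rule \<F>_E[OF z'])
      fix a b a' b' assume "z = \<pi> (bM a b)" "a ^ 3 * b ^ 2 = 1" "z' = \<pi> (bM a' b')" "a' ^ 3 * b' ^ 2 = 1"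
      then show ?thesis using bM_mult \<F>_I cl by metis
    qed
  qed
qed

text \<open>Moving 0 or 1 separates the nontrivial words from the diagonal elements of
  \<open>\<F>\<close>, as \<open>indep\<close> requires; fixing 3 separates all of them from
  \<open>y\<close>, as \<open>y_notin\<close> requires.\<close>

lemma rep_word:
  assumes "x \<in> {\<one>\<^bsub>G\<^esub>, w, w \<otimes>\<^bsub>G\<^esub> w, c, w \<otimes>\<^bsub>G\<^esub> c, w \<otimes>\<^bsub>G\<^esub> (w \<otimes>\<^bsub>G\<^esub> c)}"
  shows "\<exists>p v. rep x p v \<and> p 3 = 3 \<and> (x = \<one>\<^bsub>G\<^esub> \<or> p 0 \<noteq> 0 \<or> p (Suc 0) \<noteq> Suc 0)"
proof -
  note r = rep_basic(1-3)
  note r2 = rep_mult[OF r(2) r(2)] rep_mult[OF r(2) r(3)] rep_mult[OF r(2) rep_mult[OF r(2) r(3)]]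
  have *: ?thesis if "rep x p v" "p 3 = 3 \<and> (x = \<one>\<^bsub>G\<^esub> \<or> p 0 \<noteq> 0 \<or> p (Suc 0) \<noteq> Suc 0)" for p v
    using that by blast
  consider "x = \<one>\<^bsub>G\<^esub>" | "x = w" | "x = w \<otimes>\<^bsub>G\<^esub> w" | "x = c" | "x = w \<otimes>\<^bsub>G\<^esub> c"
    | "x = w \<otimes>\<^bsub>G\<^esub> (w \<otimes>\<^bsub>G\<^esub> c)"
    using assms by blast
  then show ?thesis
  proof cases
    case 1 show ?thesis using r(1)[folded 1] by (rule *) (simp add: 1)
  next
    case 2 show ?thesis using r(2)[folded 2] by (rule *) (simp add: index_values)
  next
    case 3 show ?thesis using r2(1)[folded 3] by (rule *) (simp add: index_values)
  next
    case 4 show ?thesis using r(3)[folded 4] by (rule *) (simp add: index_values)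
  next
    case 5 show ?thesis using r2(2)[folded 5] by (rule *) (simp add: index_values)
  next
    case 6 show ?thesis using r2(3)[folded 6] by (rule *) (simp add: index_values)
  qed
qed

lemma \<F>_rep: "z \<in> \<F> \<Longrightarrow> \<exists>v. rep z id v"
  using rep_basic(5) by (auto simp: \<F>_def)

text \<open>All inequalities are read off from permutations, so the argument also covers
  characteristic 2, where the signs are lost.\<close>

sublocale sw: switching G w c y \<F>
proof -
  have one: "\<one>\<^bsub>G\<^esub> = \<pi> (1\<^sub>m d)" by (rule \<pi>_one)
  note m = S_mem(1-3)
  note mm = \<pi>_mult[OF m(1) S_mult[OF m(1) m(1)]] \<pi>_mult[OF m(1) m(1)] \<pi>_mult[OF m(2) m(2)]
    \<pi>_mult[OF m(3) m(3)] \<pi>_mult[OF m(2) m(1)] \<pi>_mult[OF m(1) m(2)] \<pi>_mult[OF m(1) S_mult[OF m(1) m(2)]]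
    \<pi>_mult[OF m(1) m(3)] \<pi>_mult[OF m(3) m(1)] \<pi>_mult[OF m(2) m(3)] \<pi>_mult[OF m(3) m(2)]
  have dd: "0 < d" "Suc 0 < d" "3 < d" using d by auto
  show "switching G w c y \<F>"
  proof (intro switching.intro group_PSL switching_axioms.intro)
    show "finite (carrier G)" by (rule finite_PSL)
    show "w \<in> carrier G" "c \<in> carrier G" "y \<in> carrier G" using m \<pi>_carrier by blast+
    show "subgroup \<F> G" by (rule \<F>_subgroup)
    show "w \<otimes>\<^bsub>G\<^esub> (w \<otimes>\<^bsub>G\<^esub> w) = \<one>\<^bsub>G\<^esub>" "c \<otimes>\<^bsub>G\<^esub> c = \<one>\<^bsub>G\<^esub>" "y \<otimes>\<^bsub>G\<^esub> y = \<one>\<^bsub>G\<^esub>"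
      "c \<otimes>\<^bsub>G\<^esub> w = w \<otimes>\<^bsub>G\<^esub> (w \<otimes>\<^bsub>G\<^esub> c)" "w \<otimes>\<^bsub>G\<^esub> y = y \<otimes>\<^bsub>G\<^esub> w" "c \<otimes>\<^bsub>G\<^esub> y = y \<otimes>\<^bsub>G\<^esub> c"
      by (simp_all only: mm matrix_relations(1-6) one)
    have comm: "\<pi> A \<otimes>\<^bsub>G\<^esub> z = z \<otimes>\<^bsub>G\<^esub> \<pi> A"
      if z: "z \<in> \<F>" and A: "A \<in> carrier S" and eq: "\<And>a b. A * bM a b = bM a b * A" for z A
    proof (rule \<F>_E[OF z])
      fix a b assume zb: "z = \<pi> (bM a b)" "a ^ 3 * b ^ 2 = 1"
      show ?thesis
        unfolding zb(1) \<pi>_mult[OF A S_mem(4)[OF zb(2)]] \<pi>_mult[OF S_mem(4)[OF zb(2)] A] eq ..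
    qed
    show "w \<otimes>\<^bsub>G\<^esub> z = z \<otimes>\<^bsub>G\<^esub> w" if "z \<in> \<F>" for z
      by (rule comm[OF that m(1) matrix_relations(7)])
    show "c \<otimes>\<^bsub>G\<^esub> z = z \<otimes>\<^bsub>G\<^esub> c" if "z \<in> \<F>" for z
      by (rule comm[OF that m(2) matrix_relations(8)])
    show "z \<otimes>\<^bsub>G\<^esub> y = y \<otimes>\<^bsub>G\<^esub> z" if "z \<in> \<F>" for z
      by (rule comm[OF that m(3) matrix_relations(9)[symmetric], symmetric])
    note r = rep_basic(1-3) and r2 = rep_mult[OF rep_basic(2) rep_basic(2)]
    show "w \<noteq> \<one>\<^bsub>G\<^esub>" using rep_unique[OF r(2) _ dd(1)] r(1) by (force simp: index_values)
    show "c \<notin> {\<one>\<^bsub>G\<^esub>, w, w \<otimes>\<^bsub>G\<^esub> w}"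
    proof
      assume "c \<in> {\<one>\<^bsub>G\<^esub>, w, w \<otimes>\<^bsub>G\<^esub> w}"
      then consider "rep c id (\<lambda>_. 1)" | "rep c rot (\<lambda>_. 1)" | "rep c (rot \<circ> rot) (\<lambda>i. 1 * 1)"
        using r(1,2) r2 by auto
      then show False
      proof cases
        case 1 then show False using rep_unique[OF r(3) 1 dd(1)] by (simp add: index_values)
      next
        case 2 then show False using rep_unique[OF r(3) 2 dd(2)] by (simp add: index_values)
      next
        case 3 then show False using rep_unique[OF r(3) 3 dd(1)] by (simp add: index_values)
      qed
    qed
    show "{\<one>\<^bsub>G\<^esub>, w, w \<otimes>\<^bsub>G\<^esub> w, c, w \<otimes>\<^bsub>G\<^esub> c, w \<otimes>\<^bsub>G\<^esub> (w \<otimes>\<^bsub>G\<^esub> c)} \<inter> \<F> = {\<one>\<^bsub>G\<^esub>}" (is "?W \<inter> _ = _")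
    proof
      show "{\<one>\<^bsub>G\<^esub>} \<subseteq> ?W \<inter> \<F>" using subgroup.one_closed[OF \<F>_subgroup] by simp
      show "?W \<inter> \<F> \<subseteq> {\<one>\<^bsub>G\<^esub>}"
      proof
        fix x assume x: "x \<in> ?W \<inter> \<F>"
        then obtain v where v: "rep x id v" using \<F>_rep by blast
        obtain p v' where p: "rep x p v'" "x = \<one>\<^bsub>G\<^esub> \<or> p 0 \<noteq> 0 \<or> p (Suc 0) \<noteq> Suc 0"
          using rep_word[of x] x by blast
        show "x \<in> {\<one>\<^bsub>G\<^esub>}"
          using p(2) rep_unique[OF p(1) v dd(1)] rep_unique[OF p(1) v dd(2)] by simp
      qed
    qed
    show "y \<noteq> z \<otimes>\<^bsub>G\<^esub> x"
      if x: "x \<in> {\<one>\<^bsub>G\<^esub>, w, w \<otimes>\<^bsub>G\<^esub> w, c, w \<otimes>\<^bsub>G\<^esub> c, w \<otimes>\<^bsub>G\<^esub> (w \<otimes>\<^bsub>G\<^esub> c)}" and z: "z \<in> \<F>" for x z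
    proof
      assume eq: "y = z \<otimes>\<^bsub>G\<^esub> x"
      obtain v where v: "rep z id v" using \<F>_rep[OF z] by blast
      obtain p v' where p: "rep x p v'" "p 3 = 3" using rep_word[OF x] by blast
      show False
        using rep_unique[OF rep_basic(4) rep_mult[OF v p(1), folded eq] dd(3)] p(2)
        by (simp add: index_values)
    qed
  qed
qed

lemma H_rep: "x \<in> sw.H \<Longrightarrow> \<exists>p v. rep x p v"
proof -
  have L: "\<exists>p v. rep x p v" if xL: "x \<in> sw.L" for x
  proof -
    obtain z e where "z \<in> \<F>" "e \<in> sw.E" "x = z \<otimes>\<^bsub>G\<^esub> e" using xL unfolding sw.L_def by blast
    moreover obtain v where "rep z id v" using \<F>_rep[OF calculation(1)] by blast
    moreover obtain p v' where "rep e p v'" using rep_word[of e] calculation(2) unfolding sw.E_eq by blast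
    ultimately show ?thesis using rep_mult by blast
  qed
  assume "x \<in> sw.H"
  then consider "x \<in> sw.L" | a where "a \<in> sw.L" "x = y \<otimes>\<^bsub>G\<^esub> a" unfolding sw.H_def by blast
  then show ?thesis
  proof cases
    case 1
    then show ?thesis by (rule L)
  next
    case 2
    then show ?thesis using L[OF 2(1)] rep_mult[OF rep_basic(4)] by blast
  qed
qed

section \<open>Extra generators outside \<open>sw.H\<close> and the element \<open>f\<close>\<close>

definition \<D> :: "'f mat set" where
  "\<D> = insert (split_torus d s) ((\<lambda>k. addrow_mat d 1 2 k) ` {3..<d} \<union> (\<lambda>k. addrow_mat d 1 k 2) ` {3..<d})"

lemma \<D>_S: "A \<in> \<D> \<Longrightarrow> A \<in> carrier S"
proof -
  have "det (split_torus d s) = 1"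
    unfolding split_torus_def det_mon[OF permutes_id] using s0 by (simp add: prod_first_five)
  then have "split_torus d s \<in> carrier S" by (simp add: split_torus_def)
  then show "A \<in> \<D> \<Longrightarrow> A \<in> carrier S" by (auto simp: \<D>_def det_addrow_mat)
qed

lemma s_power: "0 < m \<Longrightarrow> m < 99 \<Longrightarrow> s ^ m \<noteq> 1"
  using primitive_power_neq_one[OF s0 s, of m] q by simp

text \<open>Representatives of \<open>sw.H\<close> have one nonzero entry per row, which excludes
  the transvections, and equal entries in rows 3 and 4, which excludes the torus element because
  \<open>s ^ 2\<close> is not 1. Both properties are unaffected by scalars.\<close>

lemma \<D>_H: "\<pi> ` \<D> \<inter> sw.H = {}"
proof (rule ccontr)
  assume "\<pi> ` \<D> \<inter> sw.H \<noteq> {}"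
  then obtain A where A: "A \<in> \<D>" "\<pi> A \<in> sw.H" by blast
  obtain p v where r: "rep (\<pi> A) p v" using H_rep[OF A(2)] by blast
  obtain a where ent: "\<And>i j. i < d \<Longrightarrow> j < d \<Longrightarrow> A $$ (i, j) = a * mon d p v $$ (i, j)"
    using proj_eqD[OF \<D>_S[OF A(1)], of "mon d p v"] r unfolding rep_def by metis
  consider "A = split_torus d s" | k where "k \<in> {3..<d}" "A = addrow_mat d 1 2 k"
    | k where "k \<in> {3..<d}" "A = addrow_mat d 1 k 2"
    using A(1) unfolding \<D>_def by blast
  then show False
  proof cases
    case 1
    have "s = a * (if 3 = p 3 then v 3 else 0)" "inverse s = a * (if 4 = p 4 then v 4 else 0)"
      using ent[of 3 3] ent[of 4 4] d unfolding 1 by (simp_all add: split_torus_def mon_index)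
    moreover have "v 3 = v 4" using r by (simp add: rep_def)
    ultimately have "s = inverse s" using s0 by (auto split: if_splits)
    then have "s ^ 2 = 1" using s0 by (metis power2_eq_square right_inverse)
    then show False using s_power[of 2] by simp
  next
    case (2 k)
    have "1 = a * (if 2 = p 2 then v 2 else 0)" "1 = a * (if k = p 2 then v 2 else 0)"
      using ent[of 2 2] ent[of 2 k] 2(1) unfolding 2(2) by (simp_all add: mon_index)
    then show False using 2(1) by (auto split: if_splits)
  next
    case (3 k)
    have "1 = a * (if k = p k then v k else 0)" "1 = a * (if 2 = p k then v k else 0)"
      using ent[of k k] ent[of k 2] 3(1) unfolding 3(2) by (simp_all add: mon_index)
    then show False using 3(1) by (auto split: if_splits)
  qed
qed

lemma card_\<D>: "card (\<pi> ` \<D>) \<le> 2 * (d - 3) + 1"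
proof -
  let ?A = "(\<lambda>k. addrow_mat d (1 :: 'f) 2 k) ` {3..<d}" and ?B = "(\<lambda>k. addrow_mat d (1 :: 'f) k 2) ` {3..<d}"
  have "card ?A \<le> d - 3" "card ?B \<le> d - 3" using card_image_le[of "{3..<d}"] by force+
  then have "card (?A \<union> ?B) \<le> 2 * (d - 3)" using card_Un_le[of ?A ?B] by linarith
  then have "card \<D> \<le> 2 * (d - 3) + 1" unfolding \<D>_def by (simp add: card_insert_if)
  moreover have "finite \<D>" by (simp add: \<D>_def)
  ultimately show ?thesis using card_image_le[of \<D> \<pi>] by linarith
qed

text \<open>The exponents 2 and -3 balance the block sizes 3 and 2, giving determinant 1; the ratio
  of the two block entries is the fifth power of \<open>s\<close>.\<close>

definition f :: "'f mat set" where "f = \<pi> (bM (s ^ 2) (inverse s ^ 3))"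

lemma f_exponents: "(s ^ 2) ^ 3 * (inverse s ^ 3) ^ 2 = 1"
proof -
  have "(s ^ 2) ^ 3 * (inverse s ^ 3) ^ 2 = (s * inverse s) ^ 6"
    by (simp only: power_mult[symmetric] power_mult_distrib) simp
  then show ?thesis using s0 by simp
qed

lemma f_\<F>: "f \<in> \<F>"
  unfolding f_def by (rule \<F>_I[OF f_exponents])

lemma f_pow:
  "f [^]\<^bsub>G\<^esub> (n :: nat) = \<pi> (bM ((s ^ 2) ^ n) ((inverse s ^ 3) ^ n)) \<and> ((s ^ 2) ^ n) ^ 3 * ((inverse s ^ 3) ^ n) ^ 2 = 1"
proof (induction n)
  case 0
  then show ?case by (simp add: bM_one)
next
  case (Suc n)
  let ?a = "(s ^ 2) ^ n" and ?b = "(inverse s ^ 3) ^ n"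
  have "f [^]\<^bsub>G\<^esub> Suc n = \<pi> (bM ?a ?b) \<otimes>\<^bsub>G\<^esub> f" using Suc by (simp add: nat_pow_def)
  also have "\<dots> = \<pi> (bM (?a * s ^ 2) (?b * inverse s ^ 3))"
    unfolding f_def using Suc f_exponents by (intro bM_mult) auto
  finally have 1: "f [^]\<^bsub>G\<^esub> Suc n = \<pi> (bM (?a * s ^ 2) (?b * inverse s ^ 3))" .
  have "(?a * s ^ 2) ^ 3 * (?b * inverse s ^ 3) ^ 2 = (?a ^ 3 * ?b ^ 2) * ((s ^ 2) ^ 3 * (inverse s ^ 3) ^ 2)"
    by (simp only: power_mult_distrib mult_ac)
  also have "\<dots> = 1" using Suc f_exponents by simp
  finally show ?case unfolding 1 by (simp only: power_Suc2)
qed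

text \<open>A trivial power makes the two block entries equal, that is
  \<open>s ^ (5 * n) = 1\<close>, and \<open>5 * n\<close> is at most 50. The bound 10 is the
  largest difference of two exponents between -5 and 5.\<close>

lemma f_pow_neq_one:
  assumes n: "0 < n" "n \<le> 10"
  shows "f [^]\<^bsub>G\<^esub> (n :: nat) \<noteq> \<one>\<^bsub>G\<^esub>"
proof
  let ?a = "(s ^ 2) ^ n" and ?b = "(inverse s ^ 3) ^ n"
  assume "f [^]\<^bsub>G\<^esub> n = \<one>\<^bsub>G\<^esub>"
  then have eq: "\<pi> (bM ?a ?b) = \<pi> (bM 1 1)" using f_pow[of n] bM_one by simp
  have "bM ?a ?b \<in> carrier S" "bM 1 1 \<in> carrier S" using f_pow[of n] S_mem(4) by auto
  then obtain k where "\<And>i j. i < d \<Longrightarrow> j < d \<Longrightarrow> bM ?a ?b $$ (i, j) = k * bM 1 1 $$ (i, j)"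
    using proj_eqD[OF _ _ eq] by metis
  from this[of 0 0] this[of 3 3] have "?a = ?b"
    using d by (simp add: bM_def mon_index index_values)
  moreover have "?a = s ^ (2 * n)" "?b = inverse s ^ (3 * n)" by (simp_all only: power_mult[symmetric])
  ultimately have "s ^ (2 * n) * s ^ (3 * n) = (inverse s * s) ^ (3 * n)"
    by (simp only: power_mult_distrib)
  then have "s ^ (5 * n) = 1" using s0 by (simp add: power_add[symmetric])
  then show False using s_power[of "5 * n"] n by simp
qed

lemma f_inj: "inj_on (\<lambda>j. f [^]\<^bsub>G\<^esub> j) {-5..5 :: int}"
proof (rule linorder_inj_onI', rule notI)
  have fc: "f \<in> carrier G" using subgroup.mem_carrier[OF \<F>_subgroup f_\<F>] .
  fix i j :: int assume ij: "i \<in> {-5..5}" "j \<in> {-5..5}" "i < j" and eq: "f [^]\<^bsub>G\<^esub> i = f [^]\<^bsub>G\<^esub> j"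
  have "f [^]\<^bsub>G\<^esub> (j - i) = \<one>\<^bsub>G\<^esub>" using fc by (simp add: sw.int_pow_diff eq)
  moreover have "j - i = int (nat (j - i))" using ij by simp
  ultimately have "f [^]\<^bsub>G\<^esub> nat (j - i) = \<one>\<^bsub>G\<^esub>" by (metis int_pow_int)
  moreover have "0 < nat (j - i)" "nat (j - i) \<le> 10" using ij by (auto simp: nat_le_iff)
  ultimately show False using f_pow_neq_one by blast
qed

text \<open>Passing to the preimage in SL_d makes \<open>SL_subgroup_top\<close> applicable; its
  3-cycle is \<open>wM\<close>.\<close>

lemma generate_\<D>: "generate G ({w, c, y} \<union> \<pi> ` \<D>) = carrier G"
proof -
  interpret SL: group S by (rule group_SL)
  let ?T = "{w, c, y} \<union> \<pi> ` \<D>"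
  have T: "?T \<subseteq> carrier G" using S_mem(1-3) \<D>_S \<pi>_carrier by blast
  note gen = sw.generate_is_subgroup[OF T]
  define K where "K = {A \<in> carrier S. \<pi> A \<in> generate G ?T}"
  have "group_hom S G \<pi>"
    using SL.group_axioms sw.group_axioms proj_hom by (simp add: group_hom_def group_hom_axioms_def)
  from group_hom.subgroup_vimage[OF this gen] have K: "subgroup K S" unfolding K_def .
  have inK: "A \<in> K" if "A \<in> carrier S" "\<pi> A \<in> ?T" for A
    using that generate.incl[of "\<pi> A" ?T G] unfolding K_def by blast
  have \<D>K: "A \<in> K" if "A \<in> \<D>" for A
    using inK[OF \<D>_S[OF that]] that by blast
  have "wM \<in> K" using inK S_mem(1) by blast
  then have "K = carrier S"
  proof (intro SL_subgroup_top[OF d K s0 s])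
    show "mon d rot (\<lambda>_. 1) \<in> K" if "wM \<in> K" using that by (simp add: wM_def)
    show "split_torus d s \<in> K" by (rule \<D>K) (simp add: \<D>_def)
    show "addrow_mat d 1 2 k \<in> K" "addrow_mat d 1 k 2 \<in> K" if "3 \<le> k" "k < d" for k
      by (rule \<D>K; use that in \<open>simp add: \<D>_def\<close>)+
  qed
  then have "carrier G \<subseteq> generate G ?T" unfolding carrier_PSL K_def by blast
  then show ?thesis using sw.generate_incl[OF T] by blast
qed

text \<open>The factor 12 is 2 cosets of \<open>sw.L\<close> times 6 elements of
  \<open>sw.E\<close>, and at most \<open>CARD('f) ^ 2\<close> pairs of block entries describe
  \<open>\<F>\<close>.\<close>

lemma card_H: "card sw.H \<le> 12 * CARD('f) ^ 2"
proof -
  have "card \<F> \<le> card ((\<lambda>(a, b). \<pi> (bM a b)) ` (UNIV :: ('f \<times> 'f) set))"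
    by (intro card_mono) (auto simp: \<F>_def)
  also have "\<dots> \<le> card (UNIV :: ('f \<times> 'f) set)" by (intro card_image_le) simp
  also have "\<dots> = CARD('f) ^ 2" by (simp add: power2_eq_square)
  finally have F: "card \<F> \<le> CARD('f) ^ 2" .
  have finF: "finite \<F>" using finite_subset[OF subgroup.subset[OF \<F>_subgroup] finite_PSL] .
  have "sw.L = (\<lambda>(z, x). z \<otimes>\<^bsub>G\<^esub> x) ` (\<F> \<times> sw.E)" by (auto simp: sw.L_def)
  then have "card sw.L \<le> card (\<F> \<times> sw.E)"
    using card_image_le[OF finite_cartesian_product[OF finF sw.finite_E]] by metis
  then have L: "card sw.L \<le> 6 * card \<F>" by (simp add: card_cartesian_product sw.card_E)
  have "finite sw.L" using finite_subset[OF subgroup.subset[OF sw.subgroup_L] finite_PSL] .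
  then have "card sw.H \<le> card sw.L + card sw.L"
    unfolding sw.H_def using card_Un_le[of sw.L "(\<lambda>a. y \<otimes>\<^bsub>G\<^esub> a) ` sw.L"]
      card_image_le[of sw.L "\<lambda>a. y \<otimes>\<^bsub>G\<^esub> a"] by linarith
  then show ?thesis using L F by linarith
qed

text \<open>The lower bound on \<open>r\<close> is 8 times the number \<open>2 * (d - 3) + 1\<close>
  bounding the extra generators, plus the 14 compulsory elements.\<close>

theorem PSL_isospectral_pair:
  assumes "16 * (d - 3) + 22 \<le> r" and "r + 12 * CARD('f) ^ 2 < card (carrier G)"
  shows "\<exists>A B. symmetric_generating_set G A \<and> symmetric_generating_set G B \<and> card A = r \<and> card B = r \<and>
    isospectral (Cayley_graph G A) (Cayley_graph G B) \<and>
    \<not> digraph_iso (with_proj (Cayley_graph G A)) (with_proj (Cayley_graph G B))"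
proof (rule sw.exists_isospectral_pair[OF f_\<F> f_inj _ \<D>_H generate_\<D>])
  show "\<pi> ` \<D> \<subseteq> carrier G" using \<D>_S \<pi>_carrier by blast
  show "8 * card (\<pi> ` \<D>) + 14 \<le> r" using card_\<D> assms(1) by linarith
  show "r + card sw.H < card (carrier G)" using card_H assms(2) by linarith
qed

end

section \<open>Counting\<close>

lemma card_carrier_vec:
  "card (carrier_vec n :: 'f :: finite vec set) = CARD('f) ^ n \<and> finite (carrier_vec n :: 'f vec set)"
proof -
  have eq: "(carrier_vec n :: 'f vec set) = vec_of_list ` {xs. set xs \<subseteq> UNIV \<and> length xs = n}"
  proof (intro equalityI subsetI)
    fix v :: "'f vec" assume "v \<in> carrier_vec n"
    then have "length (list_of_vec v) = n" by simp
    then show "v \<in> vec_of_list ` {xs. set xs \<subseteq> UNIV \<and> length xs = n}"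
      by (intro image_eqI[of _ _ "list_of_vec v"]) (simp_all add: vec_list)
  next
    fix v :: "'f vec" assume "v \<in> vec_of_list ` {xs. set xs \<subseteq> UNIV \<and> length xs = n}"
    then obtain xs where "v = vec_of_list xs" "length xs = n" by blast
    then show "v \<in> carrier_vec n" by (intro carrier_vecI) simp
  qed
  have "inj_on vec_of_list X" for X :: "'f list set" by (rule inj_on_inverseI) (rule list_vec)
  then show ?thesis
    unfolding eq using card_lists_length_eq[of "UNIV :: 'f set" n] finite_lists_length_eq[of "UNIV :: 'f set" n]
    by (simp only: card_image finite_imageI finite simp_thms)
qed

section \<open>Counting proper subspaces\<close>

context
  fixes d :: nat and K :: "'k :: {finite, field} itself"
begin

abbreviation "V \<equiv> module_vec TYPE('k) d"
abbreviation "vspan \<equiv> LinearCombinations.module.span class_ring V"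
abbreviation "vdim W \<equiv> vectorspace.dim (class_ring :: 'k ring) (V\<lparr>carrier := W\<rparr>)"

interpretation M: vectorspace "class_ring :: 'k ring" V by (rule vec_vs)

lemma carrier_V: "carrier V = carrier_vec d"
  by (simp add: module_vec_def)

lemma subspace_gen_iff:
  assumes W: "VectorSpace.subspace class_ring W V" and A: "A \<subseteq> W"
  shows "LinearCombinations.module.span class_ring (V\<lparr>carrier := W\<rparr>) A = vspan A"
  using M.span_li_not_depend(1)[OF A] W by (simp add: VectorSpace.subspace_def)

lemma subspace_sub: "VectorSpace.subspace class_ring W V \<Longrightarrow> W \<subseteq> carrier_vec d"
  using submodule.subset[of "class_ring :: 'k ring" W V] by (simp add: VectorSpace.subspace_def carrier_V)

text \<open>The dimension is a least cardinality of a generating set, hence attained as soon as some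
  finite generating set exists; the finite set \<open>W\<close> is one.\<close>

lemma subspace_spanning_set:
  assumes W: "VectorSpace.subspace class_ring W V"
  shows "\<exists>A. finite A \<and> card A = vdim W \<and> A \<subseteq> W \<and> vspan A = W"
proof -
  interpret W: vectorspace "class_ring :: 'k ring" "V\<lparr>carrier := W\<rparr>" by (rule M.subspace_is_vs[OF W])
  have fW: "finite W" using subspace_sub[OF W] card_carrier_vec finite_subset by blast
  have "W.span W \<subseteq> W" using W.span_is_subset2[of W] by simp
  moreover have "W \<subseteq> W.span W" using W.in_own_span[of W] by simp
  ultimately have "\<exists>A. finite A \<and> card A = card W \<and> A \<subseteq> carrier (V\<lparr>carrier := W\<rparr>) \<and> W.gen_set A"
    using fW by (intro exI[of _ W]) auto
  then have "\<exists>A. finite A \<and> card A = vdim W \<and> A \<subseteq> carrier (V\<lparr>carrier := W\<rparr>) \<and> W.gen_set A"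
    unfolding W.dim_def by (rule LeastI)
  then show ?thesis using subspace_gen_iff[OF W] by auto
qed

lemma dim_span_le:
  assumes A: "finite A" "A \<subseteq> carrier_vec d"
  shows "VectorSpace.subspace class_ring (vspan A) V" "vdim (vspan A) \<le> card A" "A \<subseteq> vspan A"
proof -
  have Ac: "A \<subseteq> carrier V" using A by (simp add: carrier_V)
  show W: "VectorSpace.subspace class_ring (vspan A) V" by (rule M.span_is_subspace[OF Ac])
  show sub: "A \<subseteq> vspan A" by (rule M.in_own_span[OF Ac])
  interpret W: vectorspace "class_ring :: 'k ring" "V\<lparr>carrier := vspan A\<rparr>"
    by (rule M.subspace_is_vs[OF W])
  show "vdim (vspan A) \<le> card A"
    unfolding W.dim_def
    by (rule Least_le, rule exI[of _ A]) (use A sub subspace_gen_iff[OF W sub] in auto)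
qed

definition proper_subspaces :: "'k vec set set" where
  "proper_subspaces = {W. VectorSpace.subspace class_ring W V \<and> vdim W \<in> {1..d - 1}}"

lemma finite_proper_subspaces: "finite proper_subspaces"
proof (rule finite_subset)
  show "proper_subspaces \<subseteq> Pow (carrier_vec d)" using subspace_sub by (auto simp: proper_subspaces_def)
qed (use card_carrier_vec in blast)

lemma sum_gaussian_binomial:
  "(\<Sum>i = 1..d - 1. gaussian_binomial TYPE('k) d i) = card proper_subspaces"
proof -
  have "proper_subspaces = (\<Union>i\<in>{1..d - 1}. {W \<in> proper_subspaces. vdim W = i})"
    by (auto simp: proper_subspaces_def)
  then have "card proper_subspaces = card (\<Union>i\<in>{1..d - 1}. {W \<in> proper_subspaces. vdim W = i})" by simp
  also have "\<dots> = (\<Sum>i = 1..d - 1. card {W \<in> proper_subspaces. vdim W = i})"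
    using finite_proper_subspaces by (intro card_UN_disjoint) auto
  also have "\<dots> = (\<Sum>i = 1..d - 1. gaussian_binomial TYPE('k) d i)"
    unfolding gaussian_binomial_def proper_subspaces_def
    by (intro sum.cong refl arg_cong[where f = card]) auto
  finally show ?thesis ..
qed

text \<open>Each such subspace is the span of a list of exactly \<open>d - 1\<close> vectors: a
  generating set is nonempty because the dimension is positive, and repeating one of its vectors
  pads the list without changing the span.\<close>

lemma card_proper_subspaces_le: "card proper_subspaces \<le> CARD('k) ^ (d * (d - 1))"
proof -
  let ?X = "{xs. set xs \<subseteq> (carrier_vec d :: 'k vec set) \<and> length xs = d - 1}"
  have fX: "finite ?X" by (intro finite_lists_length_eq) (use card_carrier_vec in blast)
  have "proper_subspaces \<subseteq> (\<lambda>xs. vspan (set xs)) ` ?X"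
  proof
    fix W assume W: "W \<in> proper_subspaces"
    then obtain A where A: "finite A" "card A = vdim W" "A \<subseteq> W" "vspan A = W"
      using subspace_spanning_set by (auto simp: proper_subspaces_def)
    have "A \<noteq> {}" "card A \<le> d - 1" using W A by (auto simp: proper_subspaces_def)
    obtain bs where bs: "set bs = A" "distinct bs" using finite_distinct_list[OF A(1)] by blast
    have "bs \<noteq> []" using bs \<open>A \<noteq> {}\<close> by auto
    define xs where "xs = bs @ replicate (d - 1 - card A) (hd bs)"
    have "set xs = A" using bs \<open>bs \<noteq> []\<close> by (auto simp: xs_def)
    moreover have "length xs = d - 1"
      using bs distinct_card[OF bs(2)] \<open>card A \<le> d - 1\<close> by (simp add: xs_def)
    moreover have "A \<subseteq> carrier_vec d" using A(3) W subspace_sub by (auto simp: proper_subspaces_def)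
    ultimately show "W \<in> (\<lambda>xs. vspan (set xs)) ` ?X" using A(4) by (intro image_eqI[of _ _ xs]) auto
  qed
  then have "card proper_subspaces \<le> card ?X" using surj_card_le[OF fX] by blast
  also have "\<dots> = CARD('k) ^ (d * (d - 1))"
    using card_carrier_vec[of d, where 'f = 'k] by (simp add: card_lists_length_eq power_mult)
  finally show ?thesis .
qed

text \<open>The vectors for 0 and 1 span the graph of a linear map from the first two coordinates to
  the other \<open>d - 2\<close>; distinct maps have distinct graphs.\<close>

definition graph_vec :: "nat \<Rightarrow> 'k vec \<Rightarrow> 'k vec" where
  "graph_vec m a = vec d (\<lambda>i. if i < 2 then of_bool (i = m) else a $ (i - 2))"

text \<open>The equation cuts out a submodule that contains both generators.\<close>

lemma graph_span:
  assumes d: "2 \<le> d" and a: "a \<in> carrier_vec (d - 2)" and b: "b \<in> carrier_vec (d - 2)"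
    and v: "v \<in> vspan {graph_vec 0 a, graph_vec 1 b}" and j: "j < d - 2"
  shows "v $ (j + 2) = v $ 0 * a $ j + v $ 1 * b $ j"
proof -
  define W where "W = {v \<in> carrier_vec d. \<forall>j < d - 2. v $ (j + 2) = v $ 0 * a $ j + v $ 1 * b $ j}"
  have idx: "0 < d" "Suc 0 < d" "j < d - 2 \<Longrightarrow> Suc (Suc j) < d" for j using d by auto
  have "submodule (class_ring :: 'k ring) W V"
  proof (rule submodule.intro)
    show "module (class_ring :: 'k ring) V" by (rule M.module_axioms)
    show "W \<subseteq> carrier V" by (auto simp: W_def carrier_V)
    show "x \<oplus>\<^bsub>V\<^esub> x' \<in> W" if "x \<in> W" "x' \<in> W" for x x'
      using that idx by (auto simp: W_def module_vec_def algebra_simps)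
    show "\<zero>\<^bsub>V\<^esub> \<in> W" using idx by (auto simp: W_def module_vec_def)
    show "r \<odot>\<^bsub>V\<^esub> x \<in> W" if "r \<in> carrier class_ring" "x \<in> W" for r x
      using that idx by (auto simp: W_def module_vec_def algebra_simps)
  qed
  moreover have "{graph_vec 0 a, graph_vec 1 b} \<subseteq> W"
    using idx by (auto simp: W_def graph_vec_def)
  ultimately have "vspan {graph_vec 0 a, graph_vec 1 b} \<subseteq> W" by (intro M.span_is_subset)
  then show ?thesis using v j by (auto simp: W_def)
qed

text \<open>Dimension exactly 2 is never established: two generators bound it by 2, which is at most
  \<open>d - 1\<close>, and a nonzero vector excludes 0.\<close>

lemma card_proper_subspaces_ge:
  assumes d: "3 \<le> d"
  shows "CARD('k) ^ (2 * (d - 2)) \<le> card proper_subspaces"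
proof -
  let ?C = "carrier_vec (d - 2) :: 'k vec set"
  let ?W = "\<lambda>(a, b). vspan {graph_vec 0 a, graph_vec 1 b}"
  have gc: "graph_vec m a \<in> carrier_vec d" for m a by (simp add: graph_vec_def)
  have A: "finite {graph_vec 0 a, graph_vec 1 b}" "{graph_vec 0 a, graph_vec 1 b} \<subseteq> carrier_vec d"
    for a b using gc by auto
  have ent: "graph_vec m a $ 0 = of_bool (m = 0)" "graph_vec m a $ 1 = of_bool (m = 1)"
    "j < d - 2 \<Longrightarrow> graph_vec m a $ (j + 2) = a $ j" for m a j
    using d by (auto simp: graph_vec_def)
  have "?W ` (?C \<times> ?C) \<subseteq> proper_subspaces"
  proof clarify
    fix a b :: "'k vec"
    let ?A = "{graph_vec 0 a, graph_vec 1 b}"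
    have sub: "VectorSpace.subspace class_ring (vspan ?A) V" by (rule dim_span_le(1)[OF A])
    have "card ?A \<le> 2" by (simp add: card_insert_if)
    then have "vdim (vspan ?A) \<le> d - 1" using dim_span_le(2)[OF A, of a b] d by linarith
    moreover have "vdim (vspan ?A) \<noteq> 0"
    proof
      assume "vdim (vspan ?A) = 0"
      then obtain B where "finite B" "card B = 0" "vspan B = vspan ?A"
        using subspace_spanning_set[OF sub] by auto
      then have "vspan ?A = {0\<^sub>v d}" using M.span_empty by (simp add: module_vec_def)
      then have "graph_vec 0 a = 0\<^sub>v d" using dim_span_le(3)[OF A, of a b] by auto
      then show False using ent(1)[of 0 a] d by simp
    qed
    ultimately show "vspan ?A \<in> proper_subspaces" using sub by (simp add: proper_subspaces_def)
  qed
  moreover have "inj_on ?W (?C \<times> ?C)"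
  proof (rule inj_onI, clarify)
    fix a b a' b'
    assume C: "a \<in> ?C" "b \<in> ?C" "a' \<in> ?C" "b' \<in> ?C"
      and eq: "vspan {graph_vec 0 a, graph_vec 1 b} = vspan {graph_vec 0 a', graph_vec 1 b'}"
    have mem: "graph_vec 0 a \<in> vspan {graph_vec 0 a', graph_vec 1 b'}"
      "graph_vec 1 b \<in> vspan {graph_vec 0 a', graph_vec 1 b'}"
      using dim_span_le(3)[OF A, of a b] eq by auto
    have d2: "2 \<le> d" using d by simp
    have "a $ j = a' $ j" "b $ j = b' $ j" if "j < d - 2" for j
      using graph_span[OF d2 C(3,4) mem(1) that] graph_span[OF d2 C(3,4) mem(2) that]
      unfolding ent(1,2) ent(3)[OF that] by simp_all
    then show "a = a' \<and> b = b'" using C by (auto intro!: eq_vecI)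
  qed
  ultimately have "card (?C \<times> ?C) \<le> card proper_subspaces"
    using card_inj_on_le finite_proper_subspaces by blast
  then show ?thesis
    using card_carrier_vec[of "d - 2", where 'f = 'k]
    by (simp add: card_cartesian_product power_add[symmetric] mult_2)
qed

end

section \<open>A lower bound for the order of PSL_d\<close>

text \<open>A lower unipotent block matrix times a block upper triangular one with diagonal 1,
  \<open>M\<close>. The corner entry 1 fixes the projective scalar.\<close>

definition bordered :: "'f :: field mat \<Rightarrow> 'f mat \<Rightarrow> 'f mat \<Rightarrow> 'f mat" where
  "bordered u v M = four_block_mat (1\<^sub>m 1) v u (u * v + M)"

lemma bordered_SL:
  fixes u v M :: "'f :: field mat"
  assumes u: "u \<in> carrier_mat n 1" and v: "v \<in> carrier_mat 1 n" and M: "M \<in> carrier (SL TYPE('f) n)"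
  shows "bordered u v M \<in> carrier (SL TYPE('f) (Suc n))"
proof -
  have Mc: "M \<in> carrier_mat n n" and det: "det M = 1" using M by auto
  let ?L = "four_block_mat (1\<^sub>m 1) (0\<^sub>m 1 n) u (1\<^sub>m n)" and ?R = "four_block_mat (1\<^sub>m 1) v (0\<^sub>m n 1) M"
  have "?L * ?R = four_block_mat (1\<^sub>m 1 * 1\<^sub>m 1 + 0\<^sub>m 1 n * 0\<^sub>m n 1) (1\<^sub>m 1 * v + 0\<^sub>m 1 n * M)
      (u * 1\<^sub>m 1 + 1\<^sub>m n * 0\<^sub>m n 1) (u * v + 1\<^sub>m n * M)"
    by (rule mult_four_block_mat) (use u v Mc in auto)
  also have "\<dots> = bordered u v M"
    unfolding bordered_def using u v Mc by simp
  finally have eq: "bordered u v M = ?L * ?R" ..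
  have L: "?L \<in> carrier_mat (1 + n) (1 + n)" and R: "?R \<in> carrier_mat (1 + n) (1 + n)"
    using u v Mc by (auto intro: four_block_carrier_mat)
  have "det ?L = det (1\<^sub>m 1 :: 'f mat) * det (1\<^sub>m n :: 'f mat)"
    by (rule det_four_block_mat_upper_right_zero) (use u in auto)
  moreover have "det ?R = det (1\<^sub>m 1 :: 'f mat) * det M"
    by (rule det_four_block_mat_lower_left_zero) (use v Mc in auto)
  ultimately have "det (bordered u v M) = 1"
    unfolding eq using det_mult[OF L R] det by simp
  moreover have "bordered u v M \<in> carrier_mat (Suc n) (Suc n)"
    unfolding eq using mult_carrier_mat[OF L R] by simp
  ultimately show ?thesis by simp
qed

lemma bordered_inj:
  fixes u v M :: "'f :: field mat"
  assumes c: "u \<in> carrier_mat n 1" "v \<in> carrier_mat 1 n" "M \<in> carrier_mat n n"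
    "u' \<in> carrier_mat n 1" "v' \<in> carrier_mat 1 n" "M' \<in> carrier_mat n n"
    and eq: "\<And>i j. i < Suc n \<Longrightarrow> j < Suc n \<Longrightarrow> bordered u v M $$ (i, j) = k * bordered u' v' M' $$ (i, j)"
  shows "u = u' \<and> v = v' \<and> M = M'"
proof -
  note dims = c[THEN carrier_matD(1)] c[THEN carrier_matD(2)]
  have ent: "bordered u v M $$ (i, j) = (if i = 0 then if j = 0 then 1 else v $$ (0, j - 1)
      else if j = 0 then u $$ (i - 1, 0) else (u * v + M) $$ (i - 1, j - 1))"
    if "u \<in> carrier_mat n 1" "v \<in> carrier_mat 1 n" "M \<in> carrier_mat n n" "i < Suc n" "j < Suc n"
    for u v M :: "'f mat" and i j
    using that unfolding bordered_def by (subst index_mat_four_block(1)) auto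
  note e = ent[OF c(1-3)] ent[OF c(4-6)]
  have "k = 1" using eq[of 0 0] by (simp add: e)
  then have eq: "bordered u v M $$ (i, j) = bordered u' v' M' $$ (i, j)" if "i < Suc n" "j < Suc n" for i j
    using eq that by simp
  have u: "u = u'"
  proof (rule eq_matI)
    fix i j assume ij: "i < dim_row u'" "j < dim_col u'"
    then show "u $$ (i, j) = u' $$ (i, j)" using eq[of "Suc i" 0] by (simp add: e dims)
  qed (simp_all add: dims)
  have v: "v = v'"
  proof (rule eq_matI)
    fix i j assume ij: "i < dim_row v'" "j < dim_col v'"
    then show "v $$ (i, j) = v' $$ (i, j)" using eq[of 0 "Suc j"] by (simp add: e dims)
  qed (simp_all add: dims)
  have "M = M'"
  proof (rule eq_matI)
    fix i j assume ij: "i < dim_row M'" "j < dim_col M'"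
    then have ij: "i < n" "j < n" by (simp_all add: dims)
    then have "(u * v + M) $$ (i, j) = (u' * v' + M') $$ (i, j)"
      using eq[of "Suc i" "Suc j"] by (simp add: e del: index_add_mat)
    then have "(u * v) $$ (i, j) + M $$ (i, j) = (u' * v') $$ (i, j) + M' $$ (i, j)"
      using index_add_mat(1)[of i M j "u * v"] index_add_mat(1)[of i M' j "u' * v'"] ij
      by (simp only: dims)
    then show "M $$ (i, j) = M' $$ (i, j)" unfolding u v by (rule add_left_imp_eq)
  qed (simp_all add: dims)
  then show ?thesis using u v by simp
qed

lemma card_PSL_le_SL: "card (carrier (PSL TYPE('f :: {finite, field}) n)) \<le> card (carrier (SL TYPE('f) n))"
  unfolding carrier_PSL by (rule card_image_le[OF finite_SL])

lemma card_PSL_Suc: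
  "CARD('f) ^ (2 * n) * card (carrier (SL TYPE('f :: {finite, field}) n)) \<le> card (carrier (PSL TYPE('f) (Suc n)))"
proof -
  let ?X = "(carrier_mat n 1 :: 'f mat set) \<times> (carrier_mat 1 n :: 'f mat set) \<times> carrier (SL TYPE('f) n)"
  let ?g = "\<lambda>(u, v, M). proj (Suc n) (bordered u v M)"
  have "inj_on ?g ?X"
  proof (rule inj_onI, clarify)
    fix u v M u' v' M' :: "'f mat"
    assume c: "u \<in> carrier_mat n 1" "v \<in> carrier_mat 1 n" "M \<in> carrier (SL TYPE('f) n)"
      "u' \<in> carrier_mat n 1" "v' \<in> carrier_mat 1 n" "M' \<in> carrier (SL TYPE('f) n)"
      and eq: "proj (Suc n) (bordered u v M) = proj (Suc n) (bordered u' v' M')"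
    obtain k where "\<And>i j. i < Suc n \<Longrightarrow> j < Suc n \<Longrightarrow> bordered u v M $$ (i, j) = k * bordered u' v' M' $$ (i, j)"
      using proj_eqD[OF bordered_SL[OF c(1-3)] bordered_SL[OF c(4-6)] eq] by metis
    then have "u = u' \<and> v = v' \<and> M = M'" using c by (intro bordered_inj) auto
    then show "u = u' \<and> (v, M) = (v', M')" by simp
  qed
  moreover have "?g ` ?X \<subseteq> carrier (PSL TYPE('f) (Suc n))"
  proof (rule image_subsetI)
    fix x assume "x \<in> ?X"
    then obtain u v M where x: "x = (u, v, M)"
      and c: "u \<in> carrier_mat n 1" "v \<in> carrier_mat 1 n" "M \<in> carrier (SL TYPE('f) n)" by (elim SigmaE) simp
    show "?g x \<in> carrier (PSL TYPE('f) (Suc n))"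
      unfolding carrier_PSL x prod.case using bordered_SL[OF c] by (rule imageI)
  qed
  ultimately have "card ?X \<le> card (carrier (PSL TYPE('f) (Suc n)))"
    by (rule card_inj_on_le[OF _ _ finite_PSL])
  then show ?thesis
    using card_carrier_mat[of n 1, where 'f = 'f] card_carrier_mat[of 1 n, where 'f = 'f]
    by (simp add: card_cartesian_product mult_2 power_add mult.assoc)
qed

text \<open>The factor 2 comes from two disjoint families of equal size: matrices with corner entry
  1, and their translates by a diagonal matrix, with corner entry \<open>a\<close> different from 0
  and 1.\<close>

lemma card_SL_2:
  assumes q: "2 < CARD('f :: {finite, field})"
  shows "2 * CARD('f) ^ 2 \<le> card (carrier (SL TYPE('f) 2))"
proof -
  have "\<not> (UNIV :: 'f set) \<subseteq> {0, 1}"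
    using q card_mono[of "{0, 1 :: 'f}" UNIV] by auto
  then obtain a :: 'f where a: "a \<noteq> 0" "a \<noteq> 1" by auto
  define T where "T = mon 2 id (\<lambda>i. if i = 0 then a else inverse a)"
  define T' where "T' = mon 2 id (\<lambda>i. if i = 0 then inverse a else a)"
  have Tc: "T \<in> carrier_mat 2 2" "T' \<in> carrier_mat 2 2" by (simp_all add: T_def T'_def)
  have two: "{0..<2 :: nat} = {0, 1}" by auto
  have det_T: "det T = 1" unfolding T_def det_mon[OF permutes_id] using a by (simp add: two)
  have T'T: "T' * T = 1\<^sub>m 2"
  proof -
    have "T' * T = mon 2 id (\<lambda>_. 1)"
      unfolding T_def T'_def using a by (subst mon_mult) (auto intro!: mon_cong)
    then show ?thesis by (simp add: mon_one)
  qed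
  let ?X = "(carrier_mat 1 1 :: 'f mat set) \<times> (carrier_mat 1 1 :: 'f mat set)"
  let ?g = "\<lambda>(u, v). bordered u v (1\<^sub>m 1 :: 'f mat)"
  define R where "R = ?g ` ?X"
  have R_sub: "R \<subseteq> carrier (SL TYPE('f) 2)"
    unfolding R_def
  proof (rule image_subsetI)
    fix x :: "'f mat \<times> 'f mat" assume "x \<in> ?X"
    then have "bordered (fst x) (snd x) (1\<^sub>m 1) \<in> carrier (SL TYPE('f) (Suc 1))"
      by (intro bordered_SL) auto
    then show "?g x \<in> carrier (SL TYPE('f) 2)" by (simp only: case_prod_unfold Suc_1)
  qed
  have "inj_on ?g ?X"
  proof (rule inj_onI, clarify)
    fix u v u' v' :: "'f mat"
    assume "u \<in> carrier_mat 1 1" "v \<in> carrier_mat 1 1" "u' \<in> carrier_mat 1 1" "v' \<in> carrier_mat 1 1"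
      and "bordered u v (1\<^sub>m 1) = bordered u' v' (1\<^sub>m 1)"
    then show "u = u' \<and> v = v'" using bordered_inj[of u 1 v "1\<^sub>m 1" u' v' "1\<^sub>m 1" 1] by auto
  qed
  then have "card R = card ?X" unfolding R_def by (rule card_image)
  then have card_R: "card R = CARD('f) ^ 2"
    using card_carrier_mat[of 1 1, where 'f = 'f] by (simp add: card_cartesian_product power2_eq_square)
  have R00: "A $$ (0, 0) = 1" if "A \<in> R" for A
    using that by (auto simp: R_def bordered_def)
  have TA00: "(T * A) $$ (0, 0) = a" if A: "A \<in> R" for A
  proof -
    have Ac: "A \<in> carrier_mat 2 2" using R_sub A by auto
    have "(T * A) $$ (0, 0) = (\<Sum>m\<in>{0..<2}. T $$ (0, m) * A $$ (m, 0))"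
      using carrier_matD[OF Ac] carrier_matD[OF Tc(1)] by (simp add: scalar_prod_def)
    then show ?thesis using R00[OF A] by (simp add: two T_def mon_index)
  qed
  have "inj_on (\<lambda>A. T * A) R"
  proof (rule inj_onI)
    fix A A' assume A: "A \<in> R" "A' \<in> R" and eq: "T * A = T * A'"
    have c: "A \<in> carrier_mat 2 2" "A' \<in> carrier_mat 2 2" using R_sub A by auto
    have "T' * (T * A) = T' * (T * A')" using eq by simp
    then show "A = A'"
      using assoc_mult_mat[OF Tc(2,1) c(1)] assoc_mult_mat[OF Tc(2,1) c(2)] c by (simp add: T'T)
  qed
  then have card_TR: "card ((\<lambda>A. T * A) ` R) = CARD('f) ^ 2" using card_image card_R by metis
  have "R \<inter> (\<lambda>A. T * A) ` R = {}"
  proof (rule ccontr)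
    assume "R \<inter> (\<lambda>A. T * A) ` R \<noteq> {}"
    then obtain A where "A \<in> R" "T * A \<in> R" by auto
    then show False using R00[of "T * A"] TA00[of A] a by simp
  qed
  moreover have finR: "finite R" by (rule finite_subset[OF R_sub finite_SL])
  ultimately have "card (R \<union> (\<lambda>A. T * A) ` R) = 2 * CARD('f) ^ 2"
    using card_R card_TR by (subst card_Un_disjoint) auto
  moreover have "(\<lambda>A. T * A) ` R \<subseteq> carrier (SL TYPE('f) 2)"
  proof (rule image_subsetI)
    fix A assume "A \<in> R"
    then have A: "A \<in> carrier_mat 2 2" "det A = 1" using R_sub by auto
    show "T * A \<in> carrier (SL TYPE('f) 2)" using det_mult[OF Tc(1) A(1)] A Tc(1) det_T by auto
  qed
  then have "card (R \<union> (\<lambda>A. T * A) ` R) \<le> card (carrier (SL TYPE('f) 2))"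
    using R_sub by (intro card_mono[OF finite_SL] Un_least)
  ultimately show ?thesis by (simp only:)
qed

lemma card_PSL_Suc_ge:
  assumes n: "2 \<le> n" and SL: "2 * CARD('f) ^ (n * (n - 1)) \<le> card (carrier (SL TYPE('f :: {finite, field}) n))"
  shows "2 * CARD('f) ^ (Suc n * n) \<le> card (carrier (PSL TYPE('f) (Suc n)))"
proof -
  have "n * (n - 1) + 2 * n = Suc n * n" using n by (cases n) auto
  then have "2 * CARD('f) ^ (Suc n * n) = CARD('f) ^ (2 * n) * (2 * CARD('f) ^ (n * (n - 1)))"
    by (simp add: power_add[symmetric] algebra_simps)
  also have "\<dots> \<le> CARD('f) ^ (2 * n) * card (carrier (SL TYPE('f) n))" using SL by simp
  also have "\<dots> \<le> card (carrier (PSL TYPE('f) (Suc n)))" by (rule card_PSL_Suc)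
  finally show ?thesis .
qed

lemma card_SL_ge:
  assumes q: "2 < CARD('f :: {finite, field})" and n: "2 \<le> n"
  shows "2 * CARD('f) ^ (n * (n - 1)) \<le> card (carrier (SL TYPE('f) n))"
  using n
proof (induction n rule: dec_induct)
  case base
  then show ?case using card_SL_2[OF q] by simp
next
  case (step n)
  show ?case using le_trans[OF card_PSL_Suc_ge[OF step(1) step.IH] card_PSL_le_SL] by simp
qed

lemma card_PSL_ge:
  assumes q: "2 < CARD('f :: {finite, field})" and d: "3 \<le> d"
  shows "2 * CARD('f) ^ (d * (d - 1)) \<le> card (carrier (PSL TYPE('f) d))"
proof -
  obtain n where n: "d = Suc n" "2 \<le> n" using d by (cases d) auto
  then show ?thesis using card_PSL_Suc_ge[OF n(2) card_SL_ge[OF q n(2)]] by simp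
qed

section \<open>The prescribed sizes fit between the bounds\<close>

text \<open>The two values of \<open>r\<close> are at least \<open>2 * (2 ^ d - 1)\<close> and
  \<open>2 ^ (2 * (d - 2))\<close>. The constant 24 instead of 22 makes up for the subtracted
  2.\<close>

lemma linear_le_power:
  assumes "5 \<le> (d :: nat)"
  shows "16 * (d - 3) + 24 \<le> 2 * 2 ^ d" "16 * (d - 3) + 22 \<le> 2 ^ (2 * (d - 2))"
proof -
  obtain m where d: "d = m + 5" using assms by (metis le_iff_add add.commute)
  have x: "m + 1 \<le> 2 ^ m" by (induction m) simp_all
  have x1: "1 \<le> (2 :: nat) ^ m" by simp
  have xx: "2 ^ m \<le> 2 ^ m * (2 :: nat) ^ m" using mult_le_mono1[OF x1, of "2 ^ m"] by (simp only: mult_1)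
  have "2 * 2 ^ d = 64 * (2 :: nat) ^ m" unfolding d power_add by simp
  then show "16 * (d - 3) + 24 \<le> 2 * 2 ^ d" using x x1 d by linarith
  have "2 * (d - 2) = m + m + 6" using d by simp
  then have "2 ^ (2 * (d - 2)) = 64 * ((2 :: nat) ^ m * 2 ^ m)" by (simp only: power_add) simp
  then show "16 * (d - 3) + 22 \<le> 2 ^ (2 * (d - 2))" using x x1 xx d by linarith
qed

theorem theorem1:
  fixes d q e :: nat
  assumes "d \<ge> 5" and "d \<noteq> 6"
    and "primepow q" and "e \<ge> 1" and "q ^ e > 4 * d ^ 2 + 1"
    and "CARD('k::{finite,field}) = q"
    and "CARD('f::{finite,field}) = q ^ e"
  shows "\<forall>r \<in> {2 * ((q ^ d - 1) div (q - 1)), \<Sum>i = 1..d - 1. gaussian_binomial TYPE('k) d i}.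
    \<exists>A B. symmetric_generating_set (PSL TYPE('f) d) A \<and>
          symmetric_generating_set (PSL TYPE('f) d) B \<and>
          card A = r \<and> card B = r \<and>
          isospectral (Cayley_graph (PSL TYPE('f) d) A) (Cayley_graph (PSL TYPE('f) d) B) \<and>
          \<not> digraph_iso (with_proj (Cayley_graph (PSL TYPE('f) d) A))
              (with_proj (Cayley_graph (PSL TYPE('f) d) B))"
proof
  let ?r1 = "2 * ((q ^ d - 1) div (q - 1))" and ?r2 = "\<Sum>i = 1..d - 1. gaussian_binomial TYPE('k) d i"
  have q2: "2 \<le> q" using primepow_gt_Suc_0[OF assms(3)] by simp
  \<comment> \<open>\<open>4 * d ^ 2 + 1\<close> is at least 101.\<close>
  have "5 * 5 \<le> d * d" using assms(1) by (intro mult_le_mono)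
  then have Q: "100 < CARD('f)" using assms(5,7) by (simp add: power2_eq_square)
  obtain s :: 'f where "s \<noteq> 0" "\<And>a. a \<noteq> 0 \<Longrightarrow> \<exists>n :: nat. a = s ^ n"
    by (rule finite_field_primitive) blast
  then interpret psl d s using assms(1) Q by unfold_locales
  have dd: "d + 1 \<le> d * (d - 1)" "20 \<le> d * (d - 1)"
    using mult_le_mono2[of 4 "d - 1" d] assms(1) by linarith+
  have qQ: "q ^ n \<le> CARD('f) ^ n" for n
    unfolding assms(7) using self_le_power[of q e] q2 assms(4) by (intro power_mono) auto
  \<comment> \<open>The geometric sum replaces truncated subtraction and division, and is monotone
    in \<open>q\<close>.\<close>
  have quot: "(q ^ d - 1) div (q - 1) = (\<Sum>i<d. q ^ i)"
  proof -
    have "int (q - 1) * int (\<Sum>i<d. q ^ i) = int (q ^ d - 1)"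
      using power_diff_1_eq[of "int q" d] q2 by (simp add: of_nat_diff)
    then have eq: "(q - 1) * (\<Sum>i<d. q ^ i) = q ^ d - 1" by (metis of_nat_eq_iff of_nat_mult)
    show ?thesis
      unfolding eq[symmetric]
      by (intro nonzero_mult_div_cancel_left) (use q2 in simp)
  qed
  have "(\<Sum>i<d. 2 ^ i :: nat) \<le> (\<Sum>i<d. q ^ i)" using q2 by (intro sum_mono power_mono) auto
  then have "2 ^ d - 1 \<le> (q ^ d - 1) div (q - 1)"
    unfolding quot using mask_eq_sum_exp_nat[of d] by (simp add: lessThan_def)
  then have lower1: "16 * (d - 3) + 22 \<le> ?r1" using linear_le_power(1)[OF assms(1)] by linarith
  have "2 ^ (2 * (d - 2)) \<le> q ^ (2 * (d - 2))" using q2 by (intro power_mono) auto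
  also have "\<dots> \<le> ?r2"
    unfolding sum_gaussian_binomial using card_proper_subspaces_ge[of d, where 'k = 'k] assms(1,6) by simp
  finally have lower2: "16 * (d - 3) + 22 \<le> ?r2" using linear_le_power(2)[OF assms(1)] by linarith
  have "(q ^ d - 1) div (q - 1) \<le> q ^ d" by (rule le_trans[OF div_le_dividend]) simp
  then have "?r1 \<le> q ^ (d + 1)" using mult_le_mono[OF q2] by simp
  also have "\<dots> \<le> q ^ (d * (d - 1))" using q2 dd by (intro power_increasing) auto
  finally have upper1: "?r1 \<le> CARD('f) ^ (d * (d - 1))" by (rule le_trans[OF _ qQ])
  have upper2: "?r2 \<le> CARD('f) ^ (d * (d - 1))"
    unfolding sum_gaussian_binomial
    using card_proper_subspaces_le[of d, where 'k = 'k] unfolding assms(6) by (rule le_trans[OF _ qQ])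
  \<comment> \<open>Of the two copies of \<open>CARD('f) ^ (d * (d - 1))\<close> available in PSL,
    one has room for \<open>r\<close> and the other for \<open>sw.H\<close>.\<close>
  have "12 * CARD('f) ^ 2 < CARD('f) * CARD('f) ^ 2" using Q by simp
  also have "\<dots> = CARD('f) ^ 3" by (simp add: eval_nat_numeral)
  also have "\<dots> \<le> CARD('f) ^ (d * (d - 1))" using Q dd by (intro power_increasing) auto
  finally have "12 * CARD('f) ^ 2 < CARD('f) ^ (d * (d - 1))" .
  moreover have "2 * CARD('f) ^ (d * (d - 1)) \<le> card (carrier G)"
    using assms(1) Q by (intro card_PSL_ge) auto
  ultimately have upper: "r + 12 * CARD('f) ^ 2 < card (carrier G)"
    if "r \<le> CARD('f) ^ (d * (d - 1))" for r using that by linarith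
  fix r assume "r \<in> {?r1, ?r2}"
  then have "16 * (d - 3) + 22 \<le> r" "r \<le> CARD('f) ^ (d * (d - 1))"
    using lower1 lower2 upper1 upper2 by auto
  then show "\<exists>A B. symmetric_generating_set G A \<and> symmetric_generating_set G B \<and> card A = r \<and> card B = r \<and>
      isospectral (Cayley_graph G A) (Cayley_graph G B) \<and>
      \<not> digraph_iso (with_proj (Cayley_graph G A)) (with_proj (Cayley_graph G B))"
    by (intro PSL_isospectral_pair upper)
qed

end
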